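(* For plane arrangements $\mathcal{A}:f=0$ in $\mathbb{P}^3$, the Hilbert polynomial $P(M(f))$ is determined neither by the topology of the complement $U(f)=\mathbb{P}^3\setminus\mathcal{A}$, nor by the topology of the corresponding Milnor fibration $$\mathbb{C}^4\setminus\{(x,y,z,w)\in\mathbb{C}^4 : f(x,y,z,w)=0\}\to\mathbb{C}^*,\quad (x,y,z,w)\mapsto f(x,y,z,w).$$ That is: (a) there exist plane arrangements $\mathcal{A}:f=0$ and $\mathcal{A}':f'=0$ in $\mathbb{P}^3$ such that $U(f)$ and $U(f')$ are homeomorphic but $P(M(f))\neq P(M(f'))$; and (b) there exist plane arrangements $\mathcal{A}:f=0$ and $\mathcal{A}':f'=0$ in $\mathbb{P}^3$ whose Milnor fibrations are topologically equivalent but $P(M(f))\neq P(M(f'))$.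
   Context: A plane arrangement $\mathcal{A}:f=0$ in $\mathbb{P}^3$ is given by a product $f$ of pairwise non-proportional linear forms in $S=\mathbb{C}[x,y,z,w]$. The Jacobian algebra is $M(f)=S/J_f$, where $J_f=(f_x,f_y,f_z,f_w)$ is the ideal generated by the partial derivatives of $f$. The Hilbert polynomial $P(M(f))\in\mathbb{Q}[u]$ is the unique polynomial with $P(M(f))(k)=\dim_{\mathbb{C}}M(f)_k$ for all sufficiently large integers $k$. Two Milnor fibrations $f:E\to\mathbb{C}^*$ and $f':E'\to\mathbb{C}^*$, with $E=\mathbb{C}^4\setminus\{f=0\}$ and $E'=\mathbb{C}^4\setminus\{f'=0\}$, are topologically equivalent if there are homeomorphisms $\Phi:E\to E'$ and $\varphi:\mathbb{C}^*\to\mathbb{C}^*$ with $f'\circ\Phi=\varphi\circ f$. *)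

theory Defs
  imports
    "HOL-Analysis.Analysis"
    "HOL-Library.Poly_Mapping"
    "HOL-Computational_Algebra.Polynomial"
    "HOL-Algebra.QuotRing"
    "HOL-Algebra.Embedded_Algebras"
    "HOL-Algebra.Algebraic_Closure_Type"
begin

section \<open>Polynomials in four variables\<close>

text \<open>
  The ring \<open>S = \<complex>[x, y, z, w]\<close> is the monoid algebra of the exponent vectors
  \<open>4 \<Rightarrow>\<^sub>0 nat\<close>; the variables are indexed by the four-element type \<open>4\<close>, which also indexes
  the coordinates of \<open>complex ^ 4\<close>.
\<close>

type_synonym mpoly4 = "(4 \<Rightarrow>\<^sub>0 nat) \<Rightarrow>\<^sub>0 complex"

definition mconst :: "complex \<Rightarrow> mpoly4"
  where "mconst c = Poly_Mapping.single 0 c"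

definition meval :: "mpoly4 \<Rightarrow> complex ^ 4 \<Rightarrow> complex"
  where "meval f v =
    (\<Sum>m\<in>Poly_Mapping.keys f.
       Poly_Mapping.lookup f m * (\<Prod>i\<in>UNIV. (v $ i) ^ Poly_Mapping.lookup m i))"

text \<open>The subtraction of exponents truncates only where the coefficient is \<open>0\<close>.\<close>

definition mpderiv :: "4 \<Rightarrow> mpoly4 \<Rightarrow> mpoly4"
  where "mpderiv i f =
    (\<Sum>m\<in>Poly_Mapping.keys f.
       Poly_Mapping.single (m - Poly_Mapping.single i 1)
         (of_nat (Poly_Mapping.lookup m i) * Poly_Mapping.lookup f m))"

text \<open>The homogeneous component \<open>S\<^sub>k\<close> (it contains \<open>0\<close>).\<close>

definition homog :: "nat \<Rightarrow> mpoly4 set"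
  where "homog k =
    {p. \<forall>m\<in>Poly_Mapping.keys p. (\<Sum>i\<in>UNIV. Poly_Mapping.lookup m i) = k}"

section \<open>Plane arrangements\<close>

definition linear_form :: "mpoly4 \<Rightarrow> bool"
  where "linear_form L \<longleftrightarrow> L \<in> homog 1 \<and> L \<noteq> 0"

definition plane_arrangement :: "mpoly4 \<Rightarrow> bool"
  where "plane_arrangement f \<longleftrightarrow>
    (\<exists>\<L>. finite \<L> \<and> \<L> \<noteq> {} \<and> (\<forall>L\<in>\<L>. linear_form L) \<and>
         pairwise (\<lambda>L L'. \<nexists>c. L' = mconst c * L) \<L> \<and>
         f = \<Prod>\<L>)"

section \<open>The Jacobian algebra and its Hilbert polynomial\<close>

abbreviation mpoly4_ring :: "mpoly4 ring"
  where "mpoly4_ring \<equiv> ring_of_type_algebra"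

definition jacobian_ideal :: "mpoly4 \<Rightarrow> mpoly4 set"
  where "jacobian_ideal f = genideal mpoly4_ring {mpderiv i f | i. True}"

definition jacobian_algebra :: "mpoly4 \<Rightarrow> mpoly4 set ring"
  where "jacobian_algebra f = mpoly4_ring Quot jacobian_ideal f"

definition jacobian_class :: "mpoly4 \<Rightarrow> mpoly4 \<Rightarrow> mpoly4 set"
  where "jacobian_class f p = jacobian_ideal f +>\<^bsub>mpoly4_ring\<^esub> p"

text \<open>
  \<open>M(f)\<^sub>k\<close> is the image of \<open>S\<^sub>k\<close> in \<open>M(f) = S / J\<^sub>f\<close>, and the field of scalars is the image of
  the constant polynomials.  When \<open>J\<^sub>f = S\<close> (a single plane) that image is the zero ring,
  and \<open>ring.dim\<close> correctly gives \<open>0\<close>.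
\<close>

definition jacobian_dim :: "mpoly4 \<Rightarrow> nat \<Rightarrow> nat"
  where "jacobian_dim f k =
    ring.dim (jacobian_algebra f)
      (jacobian_class f ` {mconst c | c. True}) (jacobian_class f ` homog k)"

definition hilbert_polynomial :: "mpoly4 \<Rightarrow> rat poly"
  where "hilbert_polynomial f =
    (THE P. \<exists>k0. \<forall>k\<ge>k0. poly P (of_nat k) = of_nat (jacobian_dim f k))"

section \<open>Projective space and the complement\<close>

text \<open>
  A point of \<open>\<P>\<^sup>3\<close> is a line through the origin with the origin removed; the topology is the
  quotient topology of \<open>\<complex>\<^sup>4 \<setminus> {0}\<close>.
\<close>

definition proj_point :: "complex ^ 4 \<Rightarrow> (complex ^ 4) set"
  where "proj_point v = {c *s v | c. c \<noteq> 0}"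

definition projective_3space :: "(complex ^ 4) set topology"
  where "projective_3space =
    topology (\<lambda>U. U \<subseteq> proj_point ` (- {0}) \<and> open {v. v \<noteq> 0 \<and> proj_point v \<in> U})"

lemma openin_projective_3space:
  "openin projective_3space U \<longleftrightarrow>
    U \<subseteq> proj_point ` (- {0}) \<and> open {v. v \<noteq> 0 \<and> proj_point v \<in> U}"
proof -
  have "istopology (\<lambda>U. U \<subseteq> proj_point ` (- {0}) \<and> open {v. v \<noteq> 0 \<and> proj_point v \<in> U})"
    unfolding istopology_def
  proof (intro conjI allI impI, goal_cases)
    case (2 S T)
    have "{v. v \<noteq> 0 \<and> proj_point v \<in> S \<inter> T} =
        {v. v \<noteq> 0 \<and> proj_point v \<in> S} \<inter> {v. v \<noteq> 0 \<and> proj_point v \<in> T}"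
      by auto
    with 2 show ?case by (simp only: open_Int)
  next
    case (4 K)
    have "{v. v \<noteq> 0 \<and> proj_point v \<in> \<Union>K} = (\<Union>U\<in>K. {v. v \<noteq> 0 \<and> proj_point v \<in> U})"
      by auto
    with 4 show ?case by (auto intro!: open_UN)
  qed blast+
  then show ?thesis
    by (simp add: projective_3space_def)
qed

lemma topspace_projective_3space: "topspace projective_3space = proj_point ` (- {0})"
proof
  show "topspace projective_3space \<subseteq> proj_point ` (- {0})"
    using openin_projective_3space openin_topspace by blast
  have "{v. v \<noteq> 0 \<and> proj_point v \<in> proj_point ` (- {0})} = - {0}"
    by auto
  then have "openin projective_3space (proj_point ` (- {0}))"
    by (simp add: openin_projective_3space open_Compl)
  then show "proj_point ` (- {0}) \<subseteq> topspace projective_3space"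
    by (rule openin_subset)
qed

lemma quotient_map_proj_point:
  "quotient_map (top_of_set (- {0})) projective_3space proj_point"
  unfolding quotient_map_def topspace_projective_3space
proof (intro conjI allI impI, goal_cases)
  case 1
  show ?case by simp
next
  case (2 U)
  have "{x \<in> topspace (top_of_set (- {0})). proj_point x \<in> U} = {v. v \<noteq> 0 \<and> proj_point v \<in> U}"
    by auto
  moreover have "openin (top_of_set (- {0})) V \<longleftrightarrow> open V" if "V \<subseteq> - {0}" for V :: "(complex ^ 4) set"
    using that by (metis open_Compl closed_singleton openin_open_eq)
  moreover have "{v. v \<noteq> 0 \<and> proj_point v \<in> U} \<subseteq> - {0}"
    by auto
  ultimately show ?case
    using 2 by (simp add: openin_projective_3space)
qed

definition arrangement_complement :: "mpoly4 \<Rightarrow> (complex ^ 4) set topology"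
  where "arrangement_complement f =
    subtopology projective_3space {proj_point v | v. v \<noteq> 0 \<and> meval f v \<noteq> 0}"

section \<open>Milnor fibrations\<close>

definition milnor_total :: "mpoly4 \<Rightarrow> (complex ^ 4) set"
  where "milnor_total f = {v. meval f v \<noteq> 0}"

definition milnor_equivalent :: "mpoly4 \<Rightarrow> mpoly4 \<Rightarrow> bool"
  where "milnor_equivalent f f' \<longleftrightarrow>
    (\<exists>\<Phi> \<Phi>' \<phi> \<phi>'.
       homeomorphism (milnor_total f) (milnor_total f') \<Phi> \<Phi>' \<and>
       homeomorphism (- {0}) (- {0}) \<phi> \<phi>' \<and>
       (\<forall>v\<in>milnor_total f. meval f' (\<Phi> v) = \<phi> (meval f v)))"

end

theory Submission
  imports Defs
begin

text \<open>
  The arrangements are the cones, with vertex \<open>(0 : 0 : 0 : 1)\<close>, over the nine lines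
  \<open>p\<^sub>ip\<^sub>j\<close>, \<open>i \<in> {1, 2, 3}\<close>, \<open>j \<in> {4, 5, 6}\<close>, joining six points of the plane, one of which depends on a
  parameter \<open>t\<close>; the points lie on a conic if and only if \<open>t = 0\<close> (a relative of Ziegler's pair).

  Topology: near every point of the plane the lines through that point are moved to their
  positions for a small \<open>t\<close> by a linear map close to the identity.  Patching these maps with a
  partition of unity made of homogeneous functions of degree \<open>0\<close>, and rescaling, gives a
  \<open>\<complex>\<^sup>*\<close>-equivariant homeomorphism \<open>\<Phi>\<close> of \<open>\<complex>\<^sup>4\<close> minus the planes with
      \<open>f\<^sub>t \<circ> \<Phi> = f\<^sub>0\<close>.
  It identifies the Milnor fibrations and, modulo scalars, the complements.

  Algebra: \<open>f\<^sub>t\<close> does not involve \<open>w\<close>, so \<open>dim M(f\<^sub>t)\<^sub>k\<close> is the sum over \<open>j \<le> k\<close> of the dimensions in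
  degree \<open>j\<close> of \<open>\<complex>[x, y, z] / J\<close>, where \<open>J\<close> is generated by the partial derivatives.  By
  semicontinuity, each of these is at most its value for \<open>t = 0\<close> when \<open>t\<close> avoids a countable set.  For
  \<open>t = 0\<close> the partial derivatives have a syzygy of degree \<open>5\<close>, and for \<open>t = - 1\<close> they have none, so in
  degree \<open>8 + 5 = 13\<close> the inequality is strict and the Hilbert polynomials differ.
\<close>

text \<open>For a plane curve the Hilbert polynomial is constant and forgets a difference in one low
  degree. Coning turns dimensions into their partial sums, so a single strict inequality shifts all
  later values.

  The two halves restrict \<open>t\<close> differently: the homeomorphism needs \<open>t\<close>
  near 0, while the algebra excludes a countable set. The value -1 is not the second arrangement; it
  only witnesses that the syzygy is absent for most parameters. The second arrangement is not
  explicit: a disc around 0 is uncountable, hence contains a suitable \<open>t\<close>.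

  The number \<open>3 + t\<close> comes from the Cremona map (x, y, z) to (1/x, 1/y, 1/z), which
  turns conics through the coordinate points into lines. The conic condition becomes the linear
  dependence of (1, 1, 1), (1, -3, -1) and (3 + t, -5, -1), whose determinant is 2t.

  As the Hilbert polynomial is given by a definite description, its existence has to be proved as
  well. In high degrees, multiplication by a generic linear form maps each graded piece of
  C[x, y, z] / J onto the next, so the dimensions stabilise.\<close>

abbreviation lookup :: "('a \<Rightarrow>\<^sub>0 'b::zero) \<Rightarrow> 'a \<Rightarrow> 'b" where "lookup \<equiv> Poly_Mapping.lookup"
abbreviation single :: "'a \<Rightarrow> 'b::zero \<Rightarrow> 'a \<Rightarrow>\<^sub>0 'b" where "single \<equiv> Poly_Mapping.single"
abbreviation keys :: "('a \<Rightarrow>\<^sub>0 'b::zero) \<Rightarrow> 'a set" where "keys \<equiv> Poly_Mapping.keys"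

section \<open>Polynomials in four variables\<close>

lemma sum_single_keys: "(\<Sum>m\<in>keys p. single m (lookup p m)) = p"
  by (rule poly_mapping_eqI)
    (simp add: lookup_sum lookup_single when_def sum.delta not_in_keys_iff_lookup_eq_zero)

lemma poly_mapping_add_induct [case_names single add]:
  fixes p :: "'a \<Rightarrow>\<^sub>0 'b::comm_monoid_add"
  assumes "\<And>m c. P (single m c)" "\<And>p q. P p \<Longrightarrow> P q \<Longrightarrow> P (p + q)"
  shows "P p"
proof -
  have "P (\<Sum>m\<in>A. single m (lookup p m))" if "finite A" for A
    using that by (induction A) (use assms(1)[of _ 0] in \<open>auto intro: assms\<close>)
  from this[of "keys p"] show ?thesis
    by (simp add: sum_single_keys)
qed

lemma sum_keys_superset:
  assumes "finite A" "keys p \<subseteq> A" "\<And>m. F m 0 = 0"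
  shows "(\<Sum>m\<in>keys p. F m (lookup p m)) = (\<Sum>m\<in>A. F m (lookup p m))"
  using assms by (intro sum.mono_neutral_left) (auto simp: not_in_keys_iff_lookup_eq_zero)

text \<open>\<open>meval\<close>, \<open>mpderiv\<close> and \<open>restrict_keys\<close> are all
  sums over the support, which may shrink in \<open>p + q\<close>. Additivity of \<open>F\<close>
  forces \<open>F m 0 = 0\<close>, so all three sums can be taken over the union of the
  supports.\<close>

lemma sum_keys_add:
  fixes F :: "'a \<Rightarrow> 'b::ab_group_add \<Rightarrow> 'c::ab_group_add"
  assumes "\<And>m a b. F m (a + b) = F m a + F m b"
  shows "(\<Sum>m\<in>keys (p + q). F m (lookup (p + q) m)) =
    (\<Sum>m\<in>keys p. F m (lookup p m)) + (\<Sum>m\<in>keys q. F m (lookup q m))"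
proof -
  have F0: "F m 0 = 0" for m
    using assms[of m 0 0] by simp
  define A where "A = keys p \<union> keys q"
  have A: "keys (p + q) \<subseteq> A" "keys p \<subseteq> A" "keys q \<subseteq> A"
    using keys_add[of p q] by (auto simp: A_def)
  have eq: "(\<Sum>m\<in>keys r. F m (lookup r m)) = (\<Sum>m\<in>A. F m (lookup r m))" if "keys r \<subseteq> A" for r
    using that F0 by (intro sum_keys_superset) (auto simp: A_def)
  show ?thesis
    unfolding A[THEN eq] by (simp add: lookup_add assms sum.distrib)
qed

lemma sum_keys_single:
  assumes "\<And>m. F m 0 = 0"
  shows "(\<Sum>m\<in>keys (single n c). F m (lookup (single n c) m)) = F n c"
  using assms by (cases "c = 0") auto

definition var :: "4 \<Rightarrow> mpoly4"
  where "var i = single (single i 1) 1"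

definition lform :: "complex ^ 4 \<Rightarrow> mpoly4"
  where "lform a = (\<Sum>i\<in>UNIV. mconst (a $ i) * var i)"

definition lval :: "complex ^ 4 \<Rightarrow> complex ^ 4 \<Rightarrow> complex"
  where "lval a v = (\<Sum>i\<in>UNIV. a $ i * v $ i)"

lemma mconst_add: "mconst (c + d) = mconst c + mconst d"
  and mconst_mult: "mconst (c * d) = mconst c * mconst d"
  and mconst_0 [simp]: "mconst 0 = 0"
  and mconst_1 [simp]: "mconst 1 = 1"
  and mconst_uminus: "mconst (- c) = - mconst c"
  and mconst_diff: "mconst (c - d) = mconst c - mconst d"
  and mconst_numeral [simp]: "mconst (numeral k) = numeral k"
  and mconst_of_nat: "mconst (of_nat j) = of_nat j"
  by (simp_all add: mconst_def single_add mult_single single_uminus single_diff)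

lemma mconst_power: "mconst (c ^ n) = mconst c ^ n"
  by (induction n) (auto simp: mconst_mult)

lemma mconst_inverse_mult: "c \<noteq> 0 \<Longrightarrow> mconst (inverse c) * (mconst c * p) = p"
  by (simp flip: mconst_mult mult.assoc)

lemma lookup_mconst_mult: "lookup (mconst c * p) m = c * lookup p m"
  unfolding mconst_def mult_map_scale_conv_mult[symmetric]
  by (simp add: Poly_Mapping.map.rep_eq when_def)

lemma single_eq_mconst: "single m c = mconst c * single m 1"
  by (simp add: mconst_def mult_single)

lemma var_mult_single: "var i * single m c = single (single i 1 + m) c"
  by (simp add: var_def mult_single)

text \<open>Multiplying by one variable at a time suits division with remainder: only the product of
  a variable and a remainder has to be reduced again.\<close>

lemma mpoly_var_induct [case_names mconst var add]:
  fixes p :: mpoly4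
  assumes c: "\<And>c. P (mconst c)" and v: "\<And>i p. P p \<Longrightarrow> P (var i * p)"
    and a: "\<And>p q. P p \<Longrightarrow> P q \<Longrightarrow> P (p + q)"
  shows "P p"
proof (induction p rule: poly_mapping_add_induct)
  case (single m c)
  have "P (single m c)" if "(\<Sum>i\<in>UNIV. lookup m i) = n" for n
    using that
  proof (induction n arbitrary: m)
    case 0
    then have "m = 0"
      by (intro poly_mapping_eqI) auto
    then show ?case
      using c by (simp add: mconst_def)
  next
    case (Suc n)
    then obtain i where i: "lookup m i \<noteq> 0"
      by (metis (no_types, lifting) nat.distinct(1) sum.neutral)
    define m' where "m' = m - single i 1"
    have m: "m = single i 1 + m'"
      using i by (intro poly_mapping_eqI) (auto simp: m'_def lookup_add lookup_minus lookup_single when_def)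
    have "(\<Sum>j\<in>UNIV. lookup m j) = Suc (\<Sum>j\<in>UNIV. lookup m' j)"
      by (simp add: m lookup_add sum.distrib lookup_single when_def sum.delta)
    with Suc have "P (single m' c)"
      by simp
    then show ?case
      using v[of "single m' c" i] by (simp add: var_mult_single m)
  qed
  then show ?case
    by blast
qed (rule a)

subsection \<open>Evaluation\<close>

lemma meval_add: "meval (p + q) v = meval p v + meval q v"
  unfolding meval_def by (rule sum_keys_add) (simp add: algebra_simps)

lemma meval_single: "meval (single m c) v = c * (\<Prod>i\<in>UNIV. (v $ i) ^ lookup m i)"
  unfolding meval_def by (rule sum_keys_single[where F = "\<lambda>m c. c * (\<Prod>i\<in>UNIV. (v $ i) ^ lookup m i)"]) simp

lemma meval_0 [simp]: "meval 0 v = 0"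
  by (simp add: meval_def)

lemma meval_mconst [simp]: "meval (mconst c) v = c"
  by (simp add: mconst_def meval_single)

lemma meval_1 [simp]: "meval 1 v = 1"
  using meval_mconst[of 1 v] by simp

lemma meval_mult: "meval (p * q) v = meval p v * meval q v"
proof (induction p rule: poly_mapping_add_induct)
  case (single m c)
  show ?case
  proof (induction q rule: poly_mapping_add_induct)
    case (single n d)
    show ?case
      by (simp add: mult_single meval_single lookup_add power_add prod.distrib)
  qed (simp add: meval_add algebra_simps)
qed (simp add: meval_add algebra_simps)

lemma meval_uminus: "meval (- p) v = - meval p v"
  using meval_add[of p "- p" v] by (simp add: eq_neg_iff_add_eq_0 add.commute)

lemma meval_diff: "meval (p - q) v = meval p v - meval q v"
  using meval_add[of p "- q" v] by (simp add: meval_uminus)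

lemma meval_sum: "meval (sum f I) v = (\<Sum>i\<in>I. meval (f i) v)"
  by (induction I rule: infinite_finite_induct) (auto simp: meval_add)

lemma meval_prod: "meval (prod f I) v = (\<Prod>i\<in>I. meval (f i) v)"
  by (induction I rule: infinite_finite_induct) (auto simp: meval_mult)

lemma meval_power: "meval (p ^ n) v = meval p v ^ n"
  by (induction n) (auto simp: meval_mult)

lemma meval_var [simp]: "meval (var i) v = v $ i"
proof -
  have "(\<Prod>j\<in>UNIV. (v $ j) ^ lookup (single i 1) j) = (\<Prod>j\<in>UNIV. if j = i then v $ i else 1)"
    by (rule prod.cong) (auto simp: lookup_single when_def)
  then show ?thesis
    by (simp add: var_def meval_single prod.delta)
qed

lemma continuous_on_meval [continuous_intros]:
  "continuous_on A g \<Longrightarrow> continuous_on A (\<lambda>x. meval f (g x))"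
  unfolding meval_def by (intro continuous_intros)

lemma meval_lform [simp]: "meval (lform a) v = lval a v"
  by (simp add: lform_def meval_sum meval_mult lval_def)

lemma lval_add_right: "lval a (u + v) = lval a u + lval a v"
  and lval_diff_right: "lval a (u - v) = lval a u - lval a v"
  and lval_add_left: "lval (a + b) v = lval a v + lval b v"
  and lval_diff_left: "lval (a - b) v = lval a v - lval b v"
  and lval_scale_right: "lval a (c *s v) = c * lval a v"
  and lval_scale_left: "lval (c *s a) v = c * lval a v"
  and lval_0 [simp]: "lval a 0 = 0" "lval 0 v = 0"
  by (simp_all add: lval_def sum.distrib sum_subtractf sum_distrib_left algebra_simps)

lemma lval_sum_right: "lval a (sum f I) = (\<Sum>i\<in>I. lval a (f i))"
  by (induction I rule: infinite_finite_induct) (auto simp: lval_add_right)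

lemma digits_unique:
  fixes N :: nat
  assumes "a + N * b = a' + N * b'" "a < N" "a' < N"
  shows "a = a' \<and> b = b'"
proof -
  have "(a + N * b) mod N = (a' + N * b') mod N" "(a + N * b) div N = (a' + N * b') div N"
    using assms(1) by auto
  then show ?thesis
    using assms(2,3) by simp
qed

text \<open>Kronecker substitution: on the curve \<open>(t, t\<^sup>N, t\<^sup>N\<^sup>*\<^sup>N, \<dots>)\<close> distinct monomials of
  exponents less than \<open>N\<close> become distinct powers of \<open>t\<close>.\<close>

lemma mpoly_eq_0I:
  assumes "\<And>v. meval p v = 0"
  shows "p = 0"
proof -
  \<comment> \<open>One more than the sum of all exponents that occur, so that every exponent is a
    digit in base \<open>N\<close>.\<close>
  define N where "N = Suc (\<Sum>m\<in>keys p. \<Sum>i\<in>UNIV. lookup m i)"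
  define \<phi> :: "(4 \<Rightarrow>\<^sub>0 nat) \<Rightarrow> nat"
    where "\<phi> m = lookup m 1 + N * (lookup m 2 + N * (lookup m 3 + N * lookup m 4))" for m
  have less: "lookup m i < N" if "m \<in> keys p" for m i
  proof -
    have "lookup m i \<le> (\<Sum>i\<in>UNIV. lookup m i)"
      by (rule member_le_sum) auto
    also have "\<dots> \<le> (\<Sum>m\<in>keys p. \<Sum>i\<in>UNIV. lookup m i)"
      using that by (intro member_le_sum) auto
    finally show ?thesis
      by (simp add: N_def)
  qed
  have inj: "m = n" if "m \<in> keys p" "n \<in> keys p" "\<phi> m = \<phi> n" for m n
  proof -
    have "lookup m 1 = lookup n 1 \<and> lookup m 2 = lookup n 2 \<and> lookup m 3 = lookup n 3 \<and> lookup m 4 = lookup n 4"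
      using digits_unique[OF that(3)[unfolded \<phi>_def] less[OF that(1)] less[OF that(2)]]
        digits_unique[OF _ less[OF that(1)] less[OF that(2)], of 2 _ 2]
        digits_unique[OF _ less[OF that(1)] less[OF that(2)], of 3 _ 3]
      by blast
    then show ?thesis
      by (intro poly_mapping_eqI) (metis exhaust_4)
  qed
  define P where "P = (\<Sum>m\<in>keys p. Polynomial.monom (lookup p m) (\<phi> m))"
  have "poly P t = 0" for t
  proof -
    define v :: "complex ^ 4"
      where "v = (\<chi> i. if i = 1 then t else if i = 2 then t ^ N else if i = 3 then t ^ (N * N) else t ^ (N * N * N))"
    have v: "v $ 1 = t" "v $ 2 = t ^ N" "v $ 3 = t ^ (N * N)" "v $ 4 = t ^ (N * N * N)"
      by (simp_all add: v_def)
    have "(\<Prod>i\<in>UNIV. (v $ i) ^ lookup m i) = t ^ \<phi> m" for m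
    proof -
      have "(\<Prod>i\<in>UNIV. (v $ i) ^ lookup m i) =
          t ^ (lookup m 1 + N * lookup m 2 + N * N * lookup m 3 + N * N * N * lookup m 4)"
        by (simp only: UNIV_4 power_add) (simp add: v mult.assoc flip: power_mult)
      also have "lookup m 1 + N * lookup m 2 + N * N * lookup m 3 + N * N * N * lookup m 4 = \<phi> m"
        by (simp add: \<phi>_def distrib_left)
      finally show ?thesis .
    qed
    then have "poly P t = meval p v"
      by (simp add: P_def meval_def poly_sum poly_monom)
    then show ?thesis
      using assms by simp
  qed
  then have "P = 0"
    using poly_all_0_iff_0 by blast
  have "lookup p n = 0" if n: "n \<in> keys p" for n
  proof -
    have "Polynomial.coeff P (\<phi> n) = (\<Sum>m\<in>keys p. if m = n then lookup p m else 0)"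
      unfolding P_def coeff_sum coeff_monom
      by (rule sum.cong) (use inj n in auto)
    also have "\<dots> = lookup p n"
      using n by simp
    finally show ?thesis
      using \<open>P = 0\<close> by simp
  qed
  then show ?thesis
    by (intro poly_mapping_eqI) (metis lookup_zero in_keys_iff)
qed

subsection \<open>Partial derivatives\<close>

lemma mpderiv_add: "mpderiv i (p + q) = mpderiv i p + mpderiv i q"
  unfolding mpderiv_def
  by (rule sum_keys_add) (simp add: algebra_simps single_add)

lemma mpderiv_single:
  "mpderiv i (single m c) = single (m - single i 1) (of_nat (lookup m i) * c)"
  unfolding mpderiv_def
  by (rule sum_keys_single[where F = "\<lambda>m c. single (m - single i 1) (of_nat (lookup m i) * c)"]) simp

lemma mpderiv_mconst [simp]: "mpderiv i (mconst c) = 0"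
  by (simp add: mconst_def mpderiv_single)

lemma mpderiv_0 [simp]: "mpderiv i 0 = 0"
  and mpderiv_1 [simp]: "mpderiv i 1 = 0"
  using mpderiv_mconst[of i 0] mpderiv_mconst[of i 1] by simp_all

lemma mpderiv_mult: "mpderiv i (p * q) = mpderiv i p * q + p * mpderiv i q"
proof (induction p rule: poly_mapping_add_induct)
  case (single m c)
  show ?case
  proof (induction q rule: poly_mapping_add_induct)
    case (single n d)
    \<comment> \<open>Subtraction of exponents is exact when the exponent is positive; otherwise the
      coefficient of the term is zero.\<close>
    have *: "n + (m - single i 1) = m + n - single i 1" if "lookup m i \<noteq> 0"
      using that by (intro poly_mapping_eqI) (auto simp: lookup_add lookup_minus lookup_single when_def)
    have **: "m + (n - single i 1) = m + n - single i 1" if "lookup n i \<noteq> 0"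
      using that by (intro poly_mapping_eqI) (auto simp: lookup_add lookup_minus lookup_single when_def)
    show ?case
      by (cases "lookup m i = 0"; cases "lookup n i = 0")
        (auto simp: mult_single mpderiv_single lookup_add * ** algebra_simps
          simp flip: single_add simp del: One_nat_def)
  qed (simp add: mpderiv_add algebra_simps)
qed (simp add: mpderiv_add algebra_simps)

lemma mpderiv_sum: "mpderiv i (sum f I) = (\<Sum>j\<in>I. mpderiv i (f j))"
  by (induction I rule: infinite_finite_induct) (simp_all add: mpderiv_add)

lemma mpderiv_var: "mpderiv i (var j) = (if i = j then 1 else 0)"
  by (cases "i = j") (simp_all add: var_def mpderiv_single lookup_single)

lemma mpderiv_lform [simp]: "mpderiv i (lform a) = mconst (a $ i)"
proof -
  have "mpderiv i (lform a) = (\<Sum>j\<in>UNIV. if j = i then mconst (a $ j) else 0)"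
    by (simp add: lform_def mpderiv_sum mpderiv_mult mpderiv_var if_distrib eq_commute[of i] cong: if_cong)
  then show ?thesis
    by (simp add: sum.delta)
qed

lemma mpderiv_prod_lform:
  assumes "finite I"
  shows "mpderiv i (\<Prod>n\<in>I. lform (a n)) = (\<Sum>n\<in>I. mconst (a n $ i) * (\<Prod>m\<in>I - {n}. lform (a m)))"
  using assms
proof (induction I rule: finite_induct)
  case (insert k I)
  have *: "(\<Prod>m\<in>insert k I - {n}. lform (a m)) = lform (a k) * (\<Prod>m\<in>I - {n}. lform (a m))" if "n \<in> I" for n
  proof -
    have "insert k I - {n} = insert k (I - {n})"
      using that insert by auto
    then show ?thesis
      using insert by simp
  qed
  have "insert k I - {k} = I"
    using insert by auto
  with insert show ?case
    by (simp add: mpderiv_mult * sum_distrib_left mult_ac cong: sum.cong)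
qed auto

section \<open>Perturbing an arrangement\<close>

text \<open>Lipschitz continuity in the form that suits functions homogeneous of degree 0, whose
  local Lipschitz constant at \<open>u\<close> grows like the inverse of \<open>norm u\<close>. With
  the factor \<open>norm u\<close>, the product of such a function and a linear map is
  Lipschitz.\<close>

definition conic_lipschitz :: "'a::real_normed_vector set \<Rightarrow> ('a \<Rightarrow> real) \<Rightarrow> bool"
  where "conic_lipschitz A \<phi> \<longleftrightarrow>
    (\<exists>C\<ge>0. \<forall>u\<in>A. \<forall>v\<in>A. \<bar>\<phi> u\<bar> \<le> C \<and> \<bar>\<phi> u - \<phi> v\<bar> * norm u \<le> C * norm (u - v))"

lemma conic_lipschitz_const: "conic_lipschitz A (\<lambda>_. c)"
  unfolding conic_lipschitz_def by (intro exI[of _ "\<bar>c\<bar>"]) auto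

lemma conic_lipschitz_add:
  assumes "conic_lipschitz A \<phi>" "conic_lipschitz A \<psi>"
  shows "conic_lipschitz A (\<lambda>v. \<phi> v + \<psi> v)"
proof -
  obtain C D where C: "C \<ge> 0" "\<And>u v. u \<in> A \<Longrightarrow> v \<in> A \<Longrightarrow> \<bar>\<phi> u\<bar> \<le> C \<and>
      \<bar>\<phi> u - \<phi> v\<bar> * norm u \<le> C * norm (u - v)"
    and D: "D \<ge> 0" "\<And>u v. u \<in> A \<Longrightarrow> v \<in> A \<Longrightarrow> \<bar>\<psi> u\<bar> \<le> D \<and> \<bar>\<psi> u -
        \<psi> v\<bar> * norm u \<le> D * norm (u - v)"
    using assms unfolding conic_lipschitz_def by metis
  have "\<bar>(\<phi> u + \<psi> u) - (\<phi> v + \<psi> v)\<bar> * norm u \<le> (C + D) * norm (u - v)" if "u \<in> A" "v \<in> A" for u v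
  proof -
    have "\<bar>(\<phi> u + \<psi> u) - (\<phi> v + \<psi> v)\<bar> * norm u \<le> (\<bar>\<phi> u - \<phi> v\<bar> + \<bar>\<psi> u - \<psi> v\<bar>) * norm u"
      by (intro mult_right_mono) auto
    then show ?thesis
      using C(2)[OF that] D(2)[OF that] by (simp add: distrib_right)
  qed
  moreover have "\<bar>\<phi> u + \<psi> u\<bar> \<le> C + D" if "u \<in> A" for u
    using C(2)[OF that that] D(2)[OF that that] by linarith
  ultimately show ?thesis
    unfolding conic_lipschitz_def using C(1) D(1) by (intro exI[of _ "C + D"]) auto
qed

lemma conic_lipschitz_mult:
  assumes "conic_lipschitz A \<phi>" "conic_lipschitz A \<psi>"
  shows "conic_lipschitz A (\<lambda>v. \<phi> v * \<psi> v)"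
proof -
  obtain C D where C: "C \<ge> 0" "\<And>u v. u \<in> A \<Longrightarrow> v \<in> A \<Longrightarrow> \<bar>\<phi> u\<bar> \<le> C \<and>
      \<bar>\<phi> u - \<phi> v\<bar> * norm u \<le> C * norm (u - v)"
    and D: "D \<ge> 0" "\<And>u v. u \<in> A \<Longrightarrow> v \<in> A \<Longrightarrow> \<bar>\<psi> u\<bar> \<le> D \<and> \<bar>\<psi> u -
        \<psi> v\<bar> * norm u \<le> D * norm (u - v)"
    using assms unfolding conic_lipschitz_def by metis
  have "\<bar>\<phi> u * \<psi> u - \<phi> v * \<psi> v\<bar> * norm u \<le> (2 * C * D) * norm (u - v)" if "u \<in> A" "v \<in> A" for u v
  proof -
    have "\<bar>\<phi> u * \<psi> u - \<phi> v * \<psi> v\<bar> * norm u = \<bar>\<phi> u * (\<psi> u - \<psi> v) + \<psi> v * (\<phi> u - \<phi> v)\<bar> * norm u"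
      by (simp add: algebra_simps)
    also have "\<dots> \<le> (\<bar>\<phi> u\<bar> * \<bar>\<psi> u - \<psi> v\<bar> + \<bar>\<psi> v\<bar> * \<bar>\<phi> u - \<phi> v\<bar>) * norm u"
      by (intro mult_right_mono) (metis abs_mult abs_triangle_ineq, simp)
    also have "\<dots> = \<bar>\<phi> u\<bar> * (\<bar>\<psi> u - \<psi> v\<bar> * norm u) + \<bar>\<psi> v\<bar> * (\<bar>\<phi> u - \<phi> v\<bar> * norm u)"
      by (simp add: algebra_simps)
    also have "\<dots> \<le> C * (D * norm (u - v)) + D * (C * norm (u - v))"
      using mult_mono[of "\<bar>\<phi> u\<bar>" C "\<bar>\<psi> u - \<psi> v\<bar> * norm u" "D * norm (u - v)"]
        mult_mono[of "\<bar>\<psi> v\<bar>" D "\<bar>\<phi> u - \<phi> v\<bar> * norm u" "C * norm (u - v)"]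
        C D that by (intro add_mono) auto
    finally show ?thesis
      by (simp add: algebra_simps)
  qed
  moreover have "\<bar>\<phi> u * \<psi> u\<bar> \<le> 2 * C * D" if "u \<in> A" for u
  proof -
    have "\<bar>\<phi> u\<bar> * \<bar>\<psi> u\<bar> \<le> C * D"
      using C D that by (intro mult_mono) auto
    moreover have "0 \<le> C * D"
      using C(1) D(1) by simp
    ultimately show ?thesis
      unfolding abs_mult by linarith
  qed
  ultimately show ?thesis
    unfolding conic_lipschitz_def using C(1) D(1) by (intro exI[of _ "2 * C * D"]) auto
qed

lemma conic_lipschitz_sum:
  "(\<And>i. i \<in> I \<Longrightarrow> conic_lipschitz A (\<phi> i)) \<Longrightarrow> conic_lipschitz A (\<lambda>v. \<Sum>i\<in>I. \<phi> i v)"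
  by (induction I rule: infinite_finite_induct) (auto intro: conic_lipschitz_const conic_lipschitz_add)

lemma conic_lipschitz_prod:
  "(\<And>i. i \<in> I \<Longrightarrow> conic_lipschitz A (\<phi> i)) \<Longrightarrow> conic_lipschitz A (\<lambda>v. \<Prod>i\<in>I. \<phi> i v)"
  by (induction I rule: infinite_finite_induct) (auto intro: conic_lipschitz_const conic_lipschitz_mult)

lemma conic_lipschitz_inverse:
  assumes "conic_lipschitz A \<phi>" "c > 0" "\<And>u. u \<in> A \<Longrightarrow> c \<le> \<phi> u"
  shows "conic_lipschitz A (\<lambda>v. inverse (\<phi> v))"
proof -
  obtain C where C: "C \<ge> 0" "\<And>u v. u \<in> A \<Longrightarrow> v \<in> A \<Longrightarrow> \<bar>\<phi> u\<bar> \<le> C \<and> \<bar>\<phi>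
      u - \<phi> v\<bar> * norm u \<le> C * norm (u - v)"
    using assms unfolding conic_lipschitz_def by metis
  \<comment> \<open>\<open>inverse c\<close> bounds the values and \<open>C / (c * c)\<close> the
    differences.\<close>
  define D where "D = max (inverse c) (C / (c * c))"
  have "\<bar>inverse (\<phi> u) - inverse (\<phi> v)\<bar> * norm u \<le> D * norm (u - v)" if uv: "u \<in> A" "v \<in> A" for u v
  proof -
    have pos: "\<phi> u \<ge> c" "\<phi> v \<ge> c" "\<phi> u > 0" "\<phi> v > 0"
      using assms(2,3) uv by (auto intro: less_le_trans)
    have "\<bar>inverse (\<phi> u) - inverse (\<phi> v)\<bar> * norm u = (\<bar>\<phi> u - \<phi> v\<bar> * norm u) / (\<phi> u * \<phi> v)"
      using pos by (simp add: field_simps abs_if)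
    also have "\<dots> \<le> (C * norm (u - v)) / (c * c)"
      using C uv pos assms(2) mult_mono[of c "\<phi> u" c "\<phi> v"] by (intro frac_le) auto
    also have "\<dots> \<le> D * norm (u - v)"
      by (simp add: D_def mult_right_mono flip: times_divide_eq_left)
    finally show ?thesis .
  qed
  moreover have "\<bar>inverse (\<phi> u)\<bar> \<le> D" if "u \<in> A" for u
  proof -
    have "inverse (\<phi> u) \<le> inverse c"
      using assms(2,3) that by (intro le_imp_inverse_le) auto
    moreover have "\<phi> u > 0"
      using assms(2) assms(3)[OF that] by linarith
    ultimately show ?thesis
      by (simp add: D_def)
  qed
  moreover have "D \<ge> 0"
    using assms(2) by (simp add: D_def le_max_iff_disj)
  ultimately show ?thesis
    unfolding conic_lipschitz_def by (intro exI[of _ D]) auto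
qed

lemma scaleR_eq_vector_scalar_mult: "r *\<^sub>R (v :: complex ^ 'n) = complex_of_real r *s v"
  by (simp add: vec_eq_iff scaleR_conv_of_real[where 'a = complex])

lemma norm_vector_scalar_mult: "norm (c *s (v :: complex ^ 'n)) = cmod c * norm v"
  by (simp add: norm_vec_def L2_set_def norm_mult power_mult_distrib real_sqrt_mult
      flip: sum_distrib_left)

lemma norm_lval_le: "norm (lval a v) \<le> 4 * norm a * norm v"
proof -
  have "norm (lval a v) \<le> (\<Sum>i\<in>(UNIV::4 set). norm (a $ i * v $ i))"
    unfolding lval_def by (rule norm_sum)
  also have "\<dots> \<le> (\<Sum>i\<in>(UNIV::4 set). norm a * norm v)"
    by (intro sum_mono) (auto simp: norm_mult intro!: mult_mono Finite_Cartesian_Product.norm_nth_le)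
  finally show ?thesis
    by simp
qed

lemma conic_lipschitz_lval:
  assumes "0 \<notin> A"
  shows "conic_lipschitz A (\<lambda>v. norm (lval a v) / norm v)"
proof -
  define K where "K = 4 * norm a"
  have K: "norm (lval a v) \<le> K * norm v" "K \<ge> 0" for v
    using norm_lval_le[of a v] by (auto simp: K_def)
  have "\<bar>norm (lval a u) / norm u - norm (lval a v) / norm v\<bar> * norm u \<le> 2 * K * norm (u - v)"
    if "u \<in> A" "v \<in> A" for u v
  proof -
    have nz: "norm u > 0" "norm v > 0"
      using assms that by auto
    have "\<bar>norm (lval a u) / norm u - norm (lval a v) / norm v\<bar> * norm u
        = \<bar>(norm (lval a u) / norm u - norm (lval a v) / norm v) * norm u\<bar>"
      by (simp add: abs_mult)
    \<comment> \<open>A difference of numerators plus a bounded quotient times a difference of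
      norms; each is at most \<open>K * norm (u - v)\<close>.\<close>
    also have "(norm (lval a u) / norm u - norm (lval a v) / norm v) * norm u
        = (norm (lval a u) - norm (lval a v)) + norm (lval a v) / norm v * (norm v - norm u)"
      using nz by (simp add: field_simps)
    also have "\<bar>\<dots>\<bar> \<le> \<bar>norm (lval a u) - norm (lval a v)\<bar> + \<bar>norm (lval a v) / norm v * (norm v - norm u)\<bar>"
      by (rule abs_triangle_ineq)
    also have "\<bar>norm (lval a u) - norm (lval a v)\<bar> \<le> K * norm (u - v)"
      using norm_triangle_ineq3[of "lval a u" "lval a v"] K(1)[of "u - v"] by (simp add: lval_diff_right)
    also have "\<bar>norm (lval a v) / norm v * (norm v - norm u)\<bar> \<le> K * norm (u - v)"
      unfolding abs_mult
    proof (intro mult_mono)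
      show "\<bar>norm (lval a v) / norm v\<bar> \<le> K"
        using K(1)[of v] nz by (simp add: field_simps)
      show "\<bar>norm v - norm u\<bar> \<le> norm (u - v)"
        by (metis norm_minus_commute norm_triangle_ineq3)
    qed (use K in auto)
    finally show ?thesis
      by (simp add: algebra_simps)
  qed
  moreover have "\<bar>norm (lval a u) / norm u\<bar> \<le> 2 * K" if "u \<in> A" for u
  proof -
    have "norm (lval a u) / norm u \<le> K"
      using K(1)[of u] assms that by (cases "u = 0") (auto simp: field_simps)
    then show ?thesis
      using K(2) by simp
  qed
  ultimately show ?thesis
    unfolding conic_lipschitz_def using K(2) by (intro exI[of _ "2 * K"]) auto
qed

text \<open>Solving \<open>v + D v = w\<close> means finding the fixed point of the contraction that
  sends \<open>v\<close> to \<open>w - D v\<close>. The map shrinks distances at most by the factor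
  \<open>1 - L\<close>, so its inverse is Lipschitz.\<close>

lemma homeomorphism_id_plus_contraction:
  fixes D :: "'a::banach \<Rightarrow> 'a"
  assumes "0 \<le> L" "L < 1" "\<And>u v. norm (D u - D v) \<le> L * norm (u - v)"
  shows "\<exists>Q. homeomorphism UNIV UNIV (\<lambda>v. v + D v) Q"
proof -
  have ex: "\<exists>!v. v + D v = w" for w
  proof -
    have "\<exists>!v. w - D v = v"
    proof (rule banach_fix_type)
      show "\<forall>x y. dist (w - D x) (w - D y) \<le> L * dist x y"
        using assms(3) by (simp add: dist_norm norm_minus_commute)
    qed (use assms in auto)
    then show ?thesis
      by (metis add_diff_cancel_right' diff_add_cancel)
  qed
  define Q where "Q w = (THE v. v + D v = w)" for w
  have Q1: "Q w + D (Q w) = w" for w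
    using theI'[OF ex[of w]] by (simp add: Q_def)
  have Q2: "Q (v + D v) = v" for v
    using ex[of "v + D v"] Q1[of "v + D v"] by blast
  have exp: "(1 - L) * norm (u - v) \<le> norm ((u + D u) - (v + D v))" for u v
  proof -
    have "norm (u - v) \<le> norm ((u + D u) - (v + D v)) + norm (D u - D v)"
      using norm_triangle_ineq4[of "(u + D u) - (v + D v)" "D u - D v"] by (simp add: algebra_simps)
    then show ?thesis
      using assms(3)[of u v] by (simp add: algebra_simps)
  qed
  have "(1 / (1 - L))-lipschitz_on UNIV Q"
  proof (rule lipschitz_onI)
    fix x y
    show "dist (Q x) (Q y) \<le> 1 / (1 - L) * dist x y"
      using exp[of "Q x" "Q y"] assms(2) by (simp add: Q1 dist_norm field_simps)
  qed (use assms in auto)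
  moreover have "L-lipschitz_on UNIV D"
    using assms by (intro lipschitz_onI) (auto simp: dist_norm)
  ultimately have "continuous_on UNIV Q" "continuous_on UNIV D"
    using lipschitz_on_continuous_on by blast+
  then have "homeomorphism UNIV UNIV (\<lambda>v. v + D v) Q"
    unfolding homeomorphism_def using Q1 Q2
    by (auto intro!: continuous_intros simp: image_def) metis+
  then show ?thesis
    by (rule exI[of _ Q])
qed


text \<open>Used in two roles: as the covectors of planes through the vertex of the cone, and as a
  copy of C^3 among the points.\<close>

definition hyper0 :: "(complex ^ 4) set"
  where "hyper0 = {v. v $ 4 = 0}"

text \<open>Projection from the vertex. Every plane of a cone contains the vertex, so the
  perturbation is built on \<open>hyper0\<close> and pulled back along this map.\<close>

definition drop4 :: "complex ^ 4 \<Rightarrow> complex ^ 4"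
  where "drop4 v = (\<chi> i. if i = 4 then 0 else v $ i)"

lemma drop4_in_hyper0 [simp]: "drop4 v \<in> hyper0"
  by (simp add: drop4_def hyper0_def)

lemma drop4_diff: "drop4 (u - v) = drop4 u - drop4 v"
  and drop4_scale: "drop4 (c *s v) = c *s drop4 v"
  by (simp_all add: drop4_def vec_eq_iff)

lemma norm_drop4_le: "norm (drop4 v) \<le> norm v"
  unfolding drop4_def by (rule norm_le_componentwise_cart) auto

lemma lval_drop4: "a \<in> hyper0 \<Longrightarrow> lval a (drop4 v) = lval a v"
  unfolding lval_def by (intro sum.cong) (auto simp: drop4_def hyper0_def)

lemma lval_dual_vector:
  assumes "a \<noteq> 0"
  obtains e where "lval a e = 1"
proof -
  obtain k where k: "a $ k \<noteq> 0"
    using assms by (auto simp: vec_eq_iff)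
  have "lval a (axis k (inverse (a $ k))) = (\<Sum>i\<in>UNIV. if i = k then 1 else 0)"
    unfolding lval_def using k by (intro sum.cong) (auto simp: axis_def)
  then show ?thesis
    using that by simp
qed

section \<open>A partition of unity from functions homogeneous of degree 0\<close>

definition incidence :: "'i set \<Rightarrow> ('i \<Rightarrow> complex ^ 4) \<Rightarrow> complex ^ 4 \<Rightarrow> 'i set"
  where "incidence I a v = {i \<in> I. lval (a i) v = 0}"

text \<open>The forms outside \<open>S\<close>, normalised and multiplied. The product is nonzero at
  \<open>v\<close> only if every plane through \<open>v\<close> has its index in \<open>S\<close>,
  that is, where the local move chosen for \<open>S\<close> is usable.\<close>

definition weight :: "'i set \<Rightarrow> ('i \<Rightarrow> complex ^ 4) \<Rightarrow> 'i set \<Rightarrow> complex ^ 4 \<Rightarrow> real"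
  where "weight I a S v = (\<Prod>i\<in>I - S. norm (lval (a i) v) / norm v)"

lemma weight_nonneg: "weight I a S v \<ge> 0"
  by (simp add: weight_def prod_nonneg)

lemma weight_scale: "c \<noteq> 0 \<Longrightarrow> weight I a S (c *s v) = weight I a S v"
  by (simp add: weight_def lval_scale_right norm_mult norm_vector_scalar_mult)

lemma weight_pos_iff:
  assumes "finite I" "v \<noteq> 0"
  shows "weight I a S v > 0 \<longleftrightarrow> incidence I a v \<subseteq> S"
proof -
  have "weight I a S v \<noteq> 0 \<longleftrightarrow> incidence I a v \<subseteq> S"
    using assms by (auto simp: weight_def incidence_def)
  then show ?thesis
    using weight_nonneg[of I a S v] by linarith
qed

lemma continuous_on_weight:
  assumes "0 \<notin> A"
  shows "continuous_on A (weight I a S)"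
  unfolding weight_def lval_def using assms by (intro continuous_intros) auto

text \<open>The weights are divided by their sum. The sum is positive by the covering hypothesis and
  bounded away from zero because it is homogeneous of degree 0 and the unit sphere of
  \<open>hyper0\<close> is compact.\<close>

lemma partition_conic_lipschitz:
  fixes a :: "'i \<Rightarrow> complex ^ 4"
  assumes "finite I" "finite SS"
    and cover: "\<And>v. v \<in> hyper0 - {0} \<Longrightarrow> \<exists>S\<in>SS. incidence I a v \<subseteq> S"
  obtains \<rho> :: "'i set \<Rightarrow> complex ^ 4 \<Rightarrow> real" and C :: real
  where "C \<ge> 0"
    "\<And>S u v. S \<in> SS \<Longrightarrow> u \<in> hyper0 - {0} \<Longrightarrow> v \<in> hyper0 - {0} \<Longrightarrow>
       \<bar>\<rho> S u\<bar> \<le> C \<and> \<bar>\<rho> S u - \<rho> S v\<bar> * norm u \<le> C * norm (u - v)"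
    "\<And>v. v \<in> hyper0 - {0} \<Longrightarrow> (\<Sum>S\<in>SS. \<rho> S v) = 1"
    "\<And>S c v. c \<noteq> 0 \<Longrightarrow> \<rho> S (c *s v) = \<rho> S v"
    "\<And>S v. v \<in> hyper0 - {0} \<Longrightarrow> \<not> incidence I a v \<subseteq> S \<Longrightarrow> \<rho> S v = 0"
proof -
  define w where "w v = (\<Sum>S\<in>SS. weight I a S v)" for v
  define \<rho> where "\<rho> S v = weight I a S v * inverse (w v)" for S v
  have w_pos: "w v > 0" if v: "v \<in> hyper0 - {0}" for v
  proof -
    obtain S where "S \<in> SS" "incidence I a v \<subseteq> S"
      using cover[OF v] by blast
    then show ?thesis
      unfolding w_def using assms v
      by (intro sum_pos2[where i = S]) (auto simp: weight_pos_iff weight_nonneg)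
  qed
  have w_scale: "w (c *s v) = w v" if "c \<noteq> 0" for c v
    using that by (simp add: w_def weight_scale)
  obtain c where c: "c > 0" "\<And>v. v \<in> hyper0 - {0} \<Longrightarrow> c \<le> w v"
  proof (cases "hyper0 \<inter> sphere 0 1 = ({} :: (complex ^ 4) set)")
    case True
    have "v \<notin> hyper0 - {0}" for v :: "complex ^ 4"
    proof
      assume v: "v \<in> hyper0 - {0}"
      then have "complex_of_real (inverse (norm v)) *s v \<in> hyper0 \<inter> sphere 0 1"
        by (simp add: hyper0_def norm_vector_scalar_mult norm_inverse)
      with True show False
        by blast
    qed
    then show ?thesis
      using that[OF zero_less_one] by blast
  next
    case False
    have "closed hyper0"
      unfolding hyper0_def by (intro closed_Collect_eq continuous_intros)
    then have "compact (hyper0 \<inter> sphere 0 1 :: (complex ^ 4) set)"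
      by (intro closed_Int_compact) auto
    moreover have "continuous_on (hyper0 \<inter> sphere 0 1) w"
      unfolding w_def by (intro continuous_on_sum continuous_on_weight) auto
    ultimately obtain u where u: "u \<in> hyper0 \<inter> sphere 0 1" "\<And>v. v \<in> hyper0 \<inter> sphere 0 1 \<Longrightarrow> w u \<le> w v"
      using continuous_attains_inf[OF _ False] by blast
    have "w u \<le> w v" if v: "v \<in> hyper0 - {0}" for v
    proof -
      have "complex_of_real (inverse (norm v)) *s v \<in> hyper0 \<inter> sphere 0 1"
        using v by (simp add: hyper0_def norm_vector_scalar_mult norm_inverse)
      from u(2)[OF this] show ?thesis
        using v by (subst (asm) w_scale) auto
    qed
    moreover have "w u > 0"
      using u(1) by (intro w_pos) auto
    ultimately show ?thesis
      using that by blast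
  qed
  have wt: "conic_lipschitz (hyper0 - {0}) (weight I a S)" for S
    unfolding weight_def by (intro conic_lipschitz_prod conic_lipschitz_lval) auto
  have "conic_lipschitz (hyper0 - {0}) w"
    unfolding w_def by (intro conic_lipschitz_sum wt)
  then have "conic_lipschitz (hyper0 - {0}) (\<lambda>v. inverse (w v))"
    using c by (intro conic_lipschitz_inverse[where c = c]) auto
  then have "conic_lipschitz (hyper0 - {0}) (\<rho> S)" for S
    unfolding \<rho>_def by (intro conic_lipschitz_mult wt)
  then obtain K where K: "\<And>S. K S \<ge> 0"
    "\<And>S u v. u \<in> hyper0 - {0} \<Longrightarrow> v \<in> hyper0 - {0} \<Longrightarrow>
      \<bar>\<rho> S u\<bar> \<le> K S \<and> \<bar>\<rho> S u - \<rho> S v\<bar> * norm u \<le> K S * norm (u - v)"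
    unfolding conic_lipschitz_def by metis
  show ?thesis
  proof (rule that[of "\<Sum>S\<in>SS. K S" \<rho>])
    show "(\<Sum>S\<in>SS. K S) \<ge> 0"
      using K(1) by (simp add: sum_nonneg)
    show "\<bar>\<rho> S u\<bar> \<le> (\<Sum>S\<in>SS. K S) \<and> \<bar>\<rho> S u - \<rho> S v\<bar> * norm u \<le> (\<Sum>S\<in>SS. K S) * norm (u - v)"
      if "S \<in> SS" "u \<in> hyper0 - {0}" "v \<in> hyper0 - {0}" for S u v
    proof -
      have "K S \<le> (\<Sum>S\<in>SS. K S)"
        using that(1) K(1) assms(2) by (intro member_le_sum) auto
      then show ?thesis
        using K(2)[OF that(2,3), of S] mult_right_mono[of "K S" "\<Sum>S\<in>SS. K S" "norm (u - v)"] by auto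
    qed
    show "(\<Sum>S\<in>SS. \<rho> S v) = 1" if "v \<in> hyper0 - {0}" for v
      using w_pos[OF that] by (simp add: \<rho>_def w_def flip: sum_distrib_right)
    show "\<rho> S (c *s v) = \<rho> S v" if "c \<noteq> 0" for S c v
      using that by (simp add: \<rho>_def w_scale weight_scale)
    show "\<rho> S v = 0" if "v \<in> hyper0 - {0}" "\<not> incidence I a v \<subseteq> S" for S v
      using that weight_pos_iff[OF assms(1), of v a S] weight_nonneg[of I a S v] by (auto simp: \<rho>_def)
  qed
qed


text \<open>The map is \<Psi>, the identity plus the average of the local moves \<open>N S\<close>
  with the weights of the partition of unity. On the plane of \<open>a i\<close> only sets
  \<open>S\<close> containing \<open>i\<close> have nonzero weight; for each of them
  \<open>v + N S v\<close> lies on the plane of \<open>a' i\<close>, hence so does the average.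
  Small moves make \<Psi> a homeomorphism and keep each quotient of \<open>a' i\<close> after \<Psi>
  by \<open>a i\<close> close to 1. The product of these quotients therefore has a continuous root,
  and rescaling by its inverse makes the products of the forms agree exactly.\<close>

lemma arrangement_perturbation:
  fixes a :: "'i \<Rightarrow> complex ^ 4"
  assumes "finite I" "I \<noteq> {}" "finite SS"
    and a: "\<And>i. i \<in> I \<Longrightarrow> a i \<in> hyper0 - {0}"
    and cover: "\<And>v. v \<in> hyper0 - {0} \<Longrightarrow> \<exists>S\<in>SS. incidence I a v \<subseteq> S"
  obtains \<epsilon> :: real where "\<epsilon> > 0"
    "\<And>a' N. (\<And>i. i \<in> I \<Longrightarrow> a' i \<in> hyper0 \<and> norm (a' i - a i) \<le> \<epsilon>) \<Longrightarrow>
       (\<And>S v. S \<in> SS \<Longrightarrow> norm (N S v) \<le> \<epsilon> * norm v) \<Longrightarrow>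
       (\<And>S u v. S \<in> SS \<Longrightarrow> N S (u - v) = N S u - N S v) \<Longrightarrow>
       (\<And>S c v. S \<in> SS \<Longrightarrow> N S (c *s v) = c *s N S v) \<Longrightarrow>
       (\<And>S i v. S \<in> SS \<Longrightarrow> i \<in> S \<inter> I \<Longrightarrow> lval (a i) v = 0 \<Longrightarrow> lval (a' i) (v + N S v) = 0) \<Longrightarrow>
       \<exists>\<Phi> \<Phi>'. homeomorphism {v. (\<Prod>i\<in>I. lval (a i) v) \<noteq> 0} {v. (\<Prod>i\<in>I. lval (a' i) v) \<noteq> 0} \<Phi> \<Phi>' \<and>
         (\<forall>v\<in>{v. (\<Prod>i\<in>I. lval (a i) v) \<noteq> 0}. (\<Prod>i\<in>I. lval (a' i) (\<Phi> v)) = (\<Prod>i\<in>I. lval (a i) v)) \<and>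
         (\<forall>c v. c \<noteq> 0 \<longrightarrow> \<Phi> (c *s v) = c *s \<Phi> v)"
proof -
  obtain \<rho> and C where C: "C \<ge> (0::real)"
    and \<rho>: "\<And>S u v. S \<in> SS \<Longrightarrow> u \<in> hyper0 - {0} \<Longrightarrow> v \<in> hyper0 - {0} \<Longrightarrow>
       \<bar>\<rho> S u\<bar> \<le> C \<and> \<bar>\<rho> S u - \<rho> S v\<bar> * norm u \<le> C * norm (u - v)"
    and \<rho>_sum: "\<And>v. v \<in> hyper0 - {0} \<Longrightarrow> (\<Sum>S\<in>SS. \<rho> S v) = 1"
    and \<rho>_scale: "\<And>S c v. c \<noteq> 0 \<Longrightarrow> \<rho> S (c *s v) = \<rho> S v"
    and \<rho>_0: "\<And>S v. v \<in> hyper0 - {0} \<Longrightarrow> \<not> incidence I a v \<subseteq> S \<Longrightarrow> \<rho> S v = 0"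
    by (rule partition_conic_lipschitz[OF assms(1,3) cover], assumption, rule that) assumption+
  have "\<exists>e. lval (a i) e = 1" if "i \<in> I" for i
    using a[OF that] lval_dual_vector[of "a i"] by auto
  then obtain e where e: "\<And>i. i \<in> I \<Longrightarrow> lval (a i) (e i) = 1"
    by metis
  \<comment> \<open>A common bound for the covectors \<open>a i\<close> and for the vectors
    \<open>e i\<close> transversal to their planes.\<close>
  define M where "M = (\<Sum>i\<in>I. norm (e i)) + (\<Sum>i\<in>I. norm (a i))"
  have M: "norm (e i) \<le> M" "norm (a i) \<le> M" "M \<ge> 0" if "i \<in> I" for i
  proof -
    have "norm (e i) \<le> (\<Sum>i\<in>I. norm (e i))" "norm (a i) \<le> (\<Sum>i\<in>I. norm (a i))"
      using that assms(1) by (auto intro!: member_le_sum)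
    moreover have "0 \<le> (\<Sum>i\<in>I. norm (e i))" "0 \<le> (\<Sum>i\<in>I. norm (a i))"
      by (auto intro: sum_nonneg)
    ultimately show "norm (e i) \<le> M" "norm (a i) \<le> M" "M \<ge> 0"
      unfolding M_def by linarith+
  qed
  have M0: "M \<ge> 0"
    unfolding M_def by (intro add_nonneg_nonneg sum_nonneg) auto
  \<comment> \<open>Each \<open>S\<close> contributes one \<open>C\<close> for the variation of its
    weight and one for the variation of \<open>N S\<close>.\<close>
  define K where "K = 2 * C * card SS"
  have K0: "K \<ge> 0"
    using C by (simp add: K_def)
  \<comment> \<open>Collects the factors that multiply \<epsilon> below: \<open>K\<close> in the
    contraction constant, \<open>4 * M + 4 * (M + 1) * K * M\<close> in the relative error of the
    forms. Then \<epsilon> = 1 / (2 B) makes both at most 1/2, and the summand 1 gives \<epsilon> at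
    most 1.\<close>
  define B where "B = 4 * M + 4 * (M + 1) * K * M + K + 1"
  have B0: "B > 0"
    using M0 K0 by (simp add: B_def add_nonneg_pos)
  define \<epsilon> where "\<epsilon> = 1 / (2 * B)"
  have B1: "B \<ge> 1"
    using M0 K0 by (simp add: B_def)
  have eps: "\<epsilon> > 0" "\<epsilon> \<le> 1" "K * \<epsilon> \<le> 1 / 2" "4 * \<epsilon> * M + 4 * (M + 1) * (K * \<epsilon>) * M \<le> 1 / 2"
  proof -
    show "\<epsilon> > 0" "\<epsilon> \<le> 1"
      using B0 B1 by (simp_all add: \<epsilon>_def)
    have "K \<le> B" "4 * M + 4 * (M + 1) * K * M \<le> B"
      using M0 K0 by (simp_all add: B_def)
    then have "K * \<epsilon> \<le> B * \<epsilon>" "(4 * M + 4 * (M + 1) * K * M) * \<epsilon> \<le> B * \<epsilon>"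
      using \<open>\<epsilon> > 0\<close> by (intro mult_right_mono; simp)+
    moreover have "B * \<epsilon> = 1 / 2"
      using B0 by (simp add: \<epsilon>_def)
    ultimately show "K * \<epsilon> \<le> 1 / 2" "4 * \<epsilon> * M + 4 * (M + 1) * (K * \<epsilon>) * M \<le> 1 / 2"
      by (simp_all add: algebra_simps)
  qed
  show ?thesis
  proof (rule that[OF eps(1)], goal_cases)
    case (1 a' N)
    note a' = 1(1) and N_le = 1(2) and N_diff = 1(3) and N_scale = 1(4) and N_ker = 1(5)
    \<comment> \<open>Nothing is known about the weights at the origin; the value 0 is the
      continuous one there.\<close>
    define D where "D v = (if v = 0 then 0 else \<Sum>S\<in>SS. \<rho> S v *\<^sub>R N S v)" for v
    have D_scale: "D (c *s v) = c *s D v" if "c \<noteq> 0" for c v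
      using that by (simp add: D_def \<rho>_scale N_scale scaleR_eq_vector_scalar_mult
          mult.commute sum_cmul vec.scale_sum_right)
    have D_le: "norm (D v) \<le> (K * \<epsilon>) * norm v" if "v \<in> hyper0" for v
    proof (cases "v = 0")
      case False
      have "norm (D v) \<le> (\<Sum>S\<in>SS. norm (\<rho> S v *\<^sub>R N S v))"
        unfolding D_def using False by (simp only: if_False norm_sum)
      also have "\<dots> \<le> (\<Sum>S\<in>SS. C * (\<epsilon> * norm v))"
        using \<rho>[of _ v v] N_le False that C eps by (intro sum_mono) (auto intro!: mult_mono)
      also have "\<dots> \<le> (K * \<epsilon>) * norm v"
        using C eps(1) by (simp add: K_def algebra_simps)
      finally show ?thesis .
    qed (simp add: D_def)
    have D_lip: "norm (D u - D v) \<le> (K * \<epsilon>) * norm (u - v)" if "u \<in> hyper0" "v \<in> hyper0" for u v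
    proof (cases "u = 0 \<or> v = 0")
      case True
      then show ?thesis
        using D_le[of u] D_le[of v] that by (auto simp: D_def)
    next
      case False
      have "norm (D u - D v) = norm (\<Sum>S\<in>SS. (\<rho> S u - \<rho> S v) *\<^sub>R N S u + \<rho> S v *\<^sub>R N S (u - v))"
        unfolding D_def using False
        by (simp add: N_diff algebra_simps flip: sum_subtractf cong: sum.cong)
      also have "\<dots> \<le> (\<Sum>S\<in>SS. norm ((\<rho> S u - \<rho> S v) *\<^sub>R N S u + \<rho> S v *\<^sub>R N S (u - v)))"
        by (rule norm_sum)
      also have "\<dots> \<le> (\<Sum>S\<in>SS. 2 * C * \<epsilon> * norm (u - v))"
      proof (rule sum_mono)
        fix S assume S: "S \<in> SS"
        have "norm ((\<rho> S u - \<rho> S v) *\<^sub>R N S u + \<rho> S v *\<^sub>R N S (u - v))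
            \<le> \<bar>\<rho> S u - \<rho> S v\<bar> * norm (N S u) + \<bar>\<rho> S v\<bar> * norm (N S (u - v))"
          by (rule order_trans[OF norm_triangle_ineq]) simp
        also have "\<dots> \<le> \<bar>\<rho> S u - \<rho> S v\<bar> * (\<epsilon> * norm u) + C * (\<epsilon> * norm (u - v))"
          using N_le[OF S] \<rho>[OF S, of v u] False that C
          by (intro add_mono mult_mono) auto
        also have "\<bar>\<rho> S u - \<rho> S v\<bar> * (\<epsilon> * norm u) = \<epsilon> * (\<bar>\<rho> S u - \<rho> S v\<bar> * norm u)"
          by simp
        also have "\<dots> \<le> \<epsilon> * (C * norm (u - v))"
          using \<rho>[OF S, of u v] False that eps(1) by (intro mult_left_mono) auto
        finally show "norm ((\<rho> S u - \<rho> S v) *\<^sub>R N S u + \<rho> S v *\<^sub>R N S (u - v)) \<le> 2 * C * \<epsilon> * norm (u - v)"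
          by (simp add: algebra_simps)
      qed
      also have "\<dots> = (K * \<epsilon>) * norm (u - v)"
        by (simp add: K_def)
      finally show ?thesis .
    qed
    define E where "E v = D (drop4 v)" for v
    have E_lip: "norm (E u - E v) \<le> (K * \<epsilon>) * norm (u - v)" for u v
    proof -
      have "norm (E u - E v) \<le> (K * \<epsilon>) * norm (drop4 u - drop4 v)"
        unfolding E_def by (rule D_lip) simp_all
      also have "\<dots> \<le> (K * \<epsilon>) * norm (u - v)"
        using norm_drop4_le[of "u - v"] K0 eps(1) by (intro mult_left_mono) (auto simp: drop4_diff)
      finally show ?thesis .
    qed
    have E_scale: "E (c *s v) = c *s E v" if "c \<noteq> 0" for c v
      using that by (simp add: E_def drop4_scale D_scale)
    define \<Psi> where "\<Psi> v = v + E v" for v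
    obtain Q where Q: "homeomorphism UNIV UNIV \<Psi> Q"
      using homeomorphism_id_plus_contraction[of "K * \<epsilon>" E] E_lip eps K0 unfolding \<Psi>_def by fastforce
    have \<Psi>_scale: "\<Psi> (c *s v) = c *s \<Psi> v" if "c \<noteq> 0" for c v
      using that by (simp add: \<Psi>_def E_scale vector_add_ldistrib)
    define F where "F i v = lval (a' i) (\<Psi> v)" for i v
    have F_0: "F i v = 0" if i: "i \<in> I" and 0: "lval (a i) v = 0" for i v
    proof -
      have h: "a i \<in> hyper0" "a' i \<in> hyper0"
        using a a' i by auto
      have F: "F i v = lval (a' i) (drop4 v) + lval (a' i) (D (drop4 v))"
        by (simp add: F_def \<Psi>_def E_def lval_add_right lval_drop4[OF h(2)])
      show ?thesis
      proof (cases "drop4 v = 0")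
        case True
        then show ?thesis
          by (simp add: F D_def)
      next
        case False
        define u where "u = drop4 v"
        have u: "u \<in> hyper0 - {0}" "lval (a i) u = 0"
          using False 0 h by (auto simp: u_def lval_drop4)
        have "lval (a' i) (D u) = (\<Sum>S\<in>SS. complex_of_real (\<rho> S u) * lval (a' i) (N S u))"
          using u(1) by (simp add: D_def lval_sum_right scaleR_eq_vector_scalar_mult lval_scale_right)
        \<comment> \<open>The weights sum to one, so \<open>F i v\<close> becomes the weighted
          average of the values of \<open>a' i\<close> at the points
          \<open>u + N S u\<close>.\<close>
        moreover have "lval (a' i) u = (\<Sum>S\<in>SS. complex_of_real (\<rho> S u) * lval (a' i) u)"
          using \<rho>_sum[OF u(1)] by (simp flip: sum_distrib_right of_real_sum)
        ultimately have "F i v = (\<Sum>S\<in>SS. complex_of_real (\<rho> S u) * lval (a' i) (u + N S u))"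
          by (simp add: F lval_add_right distrib_left sum.distrib flip: u_def)
        also have "\<dots> = 0"
        proof (intro sum.neutral ballI)
          fix S assume S: "S \<in> SS"
          show "complex_of_real (\<rho> S u) * lval (a' i) (u + N S u) = 0"
          proof (cases "i \<in> S")
            case True
            then show ?thesis
              using N_ker[OF S, of i u] i u by simp
          next
            case False
            then have "\<not> incidence I a u \<subseteq> S"
              using u i by (auto simp: incidence_def)
            then show ?thesis
              using \<rho>_0[OF u(1)] by simp
          qed
        qed
        finally show ?thesis .
      qed
    qed
    have F_near: "norm (F i v - lval (a i) v) \<le> norm (lval (a i) v) / 2" if i: "i \<in> I" for i v
    proof -
      define h where "h = lval (a i) v"
      \<comment> \<open>The point of the plane of \<open>a i\<close> reached from \<open>v\<close>
        along \<open>e i\<close>. As \<open>F i\<close> vanishes there, \<open>F i v\<close> is the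
        increment of \<open>F i\<close> along a segment of length at most
        \<open>norm h * M\<close>.\<close>
      define v0 where "v0 = v - h *s e i"
      have v0: "lval (a i) v0 = 0"
        by (simp add: v0_def lval_diff_right lval_scale_right e[OF i] h_def)
      have "F i v - h = F i v - F i v0 - h * lval (a i) (e i)"
        by (simp add: F_0[OF i v0] e[OF i])
      also have "\<dots> = h * lval (a' i - a i) (e i) + lval (a' i) (E v - E v0)"
        by (simp add: F_def \<Psi>_def v0_def lval_add_right lval_diff_right lval_diff_left lval_scale_right algebra_simps)
      also have "norm \<dots> \<le> norm (h * lval (a' i - a i) (e i)) + norm (lval (a' i) (E v - E v0))"
        by (rule norm_triangle_ineq)
      also have "\<dots> \<le> norm h * (4 * \<epsilon> * M) + 4 * (M + 1) * ((K * \<epsilon>) * (norm h * M))"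
      proof (rule add_mono)
        have "norm (lval (a' i - a i) (e i)) \<le> 4 * norm (a' i - a i) * norm (e i)"
          by (rule norm_lval_le)
        also have "\<dots> \<le> 4 * \<epsilon> * M"
          using a'[OF i] M[OF i] eps(1) by (intro mult_mono) auto
        finally show "norm (h * lval (a' i - a i) (e i)) \<le> norm h * (4 * \<epsilon> * M)"
          by (simp add: norm_mult mult_left_mono)
      next
        have "norm (a' i) \<le> norm (a i) + norm (a' i - a i)"
          by (rule norm_triangle_sub)
        then have na': "norm (a' i) \<le> M + 1"
          using a'[OF i] M[OF i] eps(2) by linarith
        have "norm (E v - E v0) \<le> (K * \<epsilon>) * norm (h *s e i)"
          using E_lip[of v v0] by (simp add: v0_def)
        also have "\<dots> \<le> (K * \<epsilon>) * (norm h * M)"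
          using M[OF i] K0 eps(1) by (intro mult_left_mono) (auto simp: norm_vector_scalar_mult mult_left_mono)
        finally have "norm (E v - E v0) \<le> (K * \<epsilon>) * (norm h * M)" .
        then have "4 * norm (a' i) * norm (E v - E v0) \<le> 4 * (M + 1) * ((K * \<epsilon>) * (norm h * M))"
          using na' M0 by (intro mult_mono) auto
        then show "norm (lval (a' i) (E v - E v0)) \<le> 4 * (M + 1) * ((K * \<epsilon>) * (norm h * M))"
          using norm_lval_le order_trans by blast
      qed
      also have "\<dots> = norm h * (4 * \<epsilon> * M + 4 * (M + 1) * (K * \<epsilon>) * M)"
        by (simp add: algebra_simps)
      also have "\<dots> \<le> norm h * (1 / 2)"
        using eps(4) by (intro mult_left_mono) auto
      finally show ?thesis
        by (simp add: h_def)
    qed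
    define U where "U = {v. (\<Prod>i\<in>I. lval (a i) v) \<noteq> 0}"
    define U' where "U' = {v. (\<Prod>i\<in>I. lval (a' i) v) \<noteq> 0}"
    have U_iff: "v \<in> U \<longleftrightarrow> (\<forall>i\<in>I. lval (a i) v \<noteq> 0)" for v
      using assms(1) by (simp add: U_def)
    have U'_iff: "v \<in> U' \<longleftrightarrow> (\<forall>i\<in>I. lval (a' i) v \<noteq> 0)" for v
      using assms(1) by (simp add: U'_def)
    have \<Psi>_U': "\<Psi> v \<in> U' \<longleftrightarrow> v \<in> U" for v
    proof -
      have "lval (a' i) (\<Psi> v) \<noteq> 0 \<longleftrightarrow> lval (a i) v \<noteq> 0" if "i \<in> I" for i
        using F_0[OF that] F_near[OF that, of v] by (auto simp: F_def)
      then show ?thesis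
        by (auto simp: U_iff U'_iff)
    qed
    define q where "q i v = F i v / lval (a i) v" for i v
    \<comment> \<open>The quotient stays in the disc of radius 1/2 around 1, so the principal
      logarithm is continuous on its values.\<close>
    have q: "q i v \<notin> \<real>\<^sub>\<le>\<^sub>0" "q i v \<noteq> 0" if "i \<in> I" "v \<in> U" for i v
    proof -
      have nz: "lval (a i) v \<noteq> 0"
        using that by (simp add: U_iff)
      have "q i v - 1 = (F i v - lval (a i) v) / lval (a i) v"
        using nz by (simp add: q_def field_simps)
      then have "norm (q i v - 1) = norm (F i v - lval (a i) v) / norm (lval (a i) v)"
        by (simp only: norm_divide)
      then have "norm (q i v - 1) \<le> 1 / 2"
        using F_near[OF that(1), of v] nz by (simp add: pos_divide_le_eq)
      then have "\<bar>Re (q i v - 1)\<bar> \<le> 1 / 2"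
        using abs_Re_le_cmod order_trans by blast
      then have "Re (q i v) > 0"
        unfolding minus_complex.sel one_complex.sel by linarith
      then show "q i v \<notin> \<real>\<^sub>\<le>\<^sub>0" "q i v \<noteq> 0"
        by (auto simp: complex_nonpos_Reals_iff)
    qed
    \<comment> \<open>The inverse of a \<open>card I\<close>-th root of the product of the
      quotients; scaling a point by \<open>k v\<close> multiplies the product of the
      \<open>card I\<close> forms by \<open>k v ^ card I\<close>.\<close>
    define k where "k v = exp (- (1 / of_nat (card I)) * (\<Sum>i\<in>I. Ln (q i v)))" for v
    have k_nz: "k v \<noteq> 0" for v
      by (simp add: k_def)
    have k_power: "k v ^ card I * (\<Prod>i\<in>I. F i v) = (\<Prod>i\<in>I. lval (a i) v)" if v: "v \<in> U" for v
    proof -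
      have "card I \<noteq> 0"
        using assms(1,2) by simp
      then have "k v ^ card I = exp (- (\<Sum>i\<in>I. Ln (q i v)))"
        by (simp add: k_def flip: exp_of_nat_mult)
      also have "\<dots> = inverse (\<Prod>i\<in>I. q i v)"
        using assms(1) q v by (simp add: exp_minus exp_sum)
      also have "(\<Prod>i\<in>I. q i v) = (\<Prod>i\<in>I. F i v) / (\<Prod>i\<in>I. lval (a i) v)"
        by (simp add: q_def prod_dividef)
      finally have *: "k v ^ card I = inverse ((\<Prod>i\<in>I. F i v) / (\<Prod>i\<in>I. lval (a i) v))" .
      have "(\<Prod>i\<in>I. F i v) \<noteq> 0"
        using q(2)[OF _ v] assms(1) by (auto simp: q_def)
      then show ?thesis
        unfolding * by (simp add: field_simps)
    qed
    have k_scale: "k (c *s v) = k v" if "c \<noteq> 0" for c v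
      using that by (simp add: k_def q_def F_def \<Psi>_scale lval_scale_right)
    have \<Psi>_cont: "continuous_on A \<Psi>" and Q_cont: "continuous_on A Q" for A
      using Q by (auto simp: homeomorphism_def intro: continuous_on_subset)
    have \<Psi>Q: "\<Psi> (Q w) = w" and Q\<Psi>: "Q (\<Psi> v) = v" for v w
      using Q by (auto simp: homeomorphism_def)
    have k_cont: "continuous_on U k"
    proof -
      have "continuous_on U (q i)" if "i \<in> I" for i
        unfolding q_def F_def lval_def
        using that by (intro continuous_intros \<Psi>_cont) (auto simp: U_iff lval_def)
      then show ?thesis
        unfolding k_def using q(1) by (intro continuous_intros) auto
    qed
    define \<Phi> where "\<Phi> v = k v *s \<Psi> v" for v
    \<comment> \<open>As \<open>k\<close> is constant on punctured lines through the origin, the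
      factor used at a point can be recovered from its image.\<close>
    define \<Phi>' where "\<Phi>' w = inverse (k (Q w)) *s Q w" for w
    have \<Phi>_scale: "\<Phi> (c *s v) = c *s \<Phi> v" if "c \<noteq> 0" for c v
      using that by (simp add: \<Phi>_def k_scale \<Psi>_scale mult.commute)
    have \<Phi>_prod: "(\<Prod>i\<in>I. lval (a' i) (\<Phi> v)) = (\<Prod>i\<in>I. lval (a i) v)" if "v \<in> U" for v
      using k_power[OF that] by (simp add: \<Phi>_def lval_scale_right prod.distrib F_def)
    have \<Phi>_in: "\<Phi> v \<in> U'" if "v \<in> U" for v
      using \<Phi>_prod[OF that] that by (simp add: U'_def U_def)
    have \<Phi>'\<Phi>: "\<Phi>' (\<Phi> v) = v" for v
    proof -
      have "Q (\<Phi> v) = k v *s v"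
        unfolding \<Phi>_def by (metis \<Psi>_scale k_nz Q\<Psi>)
      then show ?thesis
        by (simp add: \<Phi>'_def k_scale k_nz)
    qed
    have \<Phi>\<Phi>': "\<Phi> (\<Phi>' w) = w" for w
      by (simp add: \<Phi>'_def \<Phi>_def k_scale \<Psi>_scale k_nz \<Psi>Q)
    have Q_in: "Q w \<in> U" if "w \<in> U'" for w
      using \<Psi>_U'[of "Q w"] that by (simp add: \<Psi>Q)
    have \<Phi>'_in: "\<Phi>' w \<in> U" if "w \<in> U'" for w
      using Q_in[OF that] k_nz by (simp add: U_iff \<Phi>'_def lval_scale_right)
    have "continuous_on U \<Phi>"
      unfolding \<Phi>_def vector_scalar_mult_def using k_cont \<Psi>_cont[of U]
      by (intro continuous_intros)
    moreover have "continuous_on U' \<Phi>'"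
    proof -
      have "continuous_on U' (\<lambda>w. k (Q w))"
        by (rule continuous_on_compose2[OF k_cont Q_cont]) (auto intro: Q_in)
      then show ?thesis
        unfolding \<Phi>'_def vector_scalar_mult_def using Q_cont[of U'] k_nz
        by (intro continuous_intros) auto
    qed
    ultimately have "homeomorphism U U' \<Phi> \<Phi>'"
      unfolding homeomorphism_def using \<Phi>_in \<Phi>'_in \<Phi>'\<Phi> \<Phi>\<Phi>'
      by (auto simp: image_iff) metis+
    then show ?case
      using \<Phi>_prod \<Phi>_scale unfolding U_def U'_def by blast
  qed
qed


section \<open>From the total space of the Milnor fibration to the complement in projective
  space\<close>

lemma meval_prod_lform: "meval (\<Prod>i\<in>I. lform (a i)) v = (\<Prod>i\<in>I. lval (a i) v)"
  by (simp add: meval_prod)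

lemma proj_point_scale:
  assumes "c \<noteq> 0"
  shows "proj_point (c *s v) = proj_point v"
proof
  show "proj_point (c *s v) \<subseteq> proj_point v"
    using assms unfolding proj_point_def by force
  show "proj_point v \<subseteq> proj_point (c *s v)"
  proof
    fix u assume "u \<in> proj_point v"
    then obtain d where "d \<noteq> 0" "u = d *s v"
      by (auto simp: proj_point_def)
    then have "u = (d / c) *s (c *s v)" "d / c \<noteq> 0"
      using assms by auto
    then show "u \<in> proj_point (c *s v)"
      unfolding proj_point_def by blast
  qed
qed

lemma proj_point_eq_iff: "proj_point u = proj_point v \<longleftrightarrow> (\<exists>c. c \<noteq> 0 \<and> u = c *s v)"
proof
  assume "proj_point u = proj_point v"
  moreover have "u \<in> proj_point u"
    unfolding proj_point_def by (auto intro!: exI[of _ 1])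
  ultimately show "\<exists>c. c \<noteq> 0 \<and> u = c *s v"
    by (auto simp: proj_point_def)
qed (auto simp: proj_point_scale)

text \<open>The complement is open in projective space and its full preimage is
  \<open>milnor_total f\<close>, so the projection restricts to a quotient map. Continuity of maps
  on the complement can then be checked upstairs.\<close>

lemma quotient_map_arrangement_complement:
  assumes "finite I" "I \<noteq> {}" and f: "f = (\<Prod>i\<in>I. lform (a i))"
  shows "quotient_map (top_of_set (milnor_total f)) (arrangement_complement f) proj_point"
proof -
  define V where "V = {proj_point v | v. v \<noteq> 0 \<and> meval f v \<noteq> 0}"
  have scale: "meval f (c *s v) \<noteq> 0 \<longleftrightarrow> meval f v \<noteq> 0" if "c \<noteq> 0" for c v
    using that assms(1) by (simp add: f meval_prod_lform lval_scale_right)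
  have f0: "meval f 0 = 0"
    using assms(1,2) by (auto simp: f meval_prod_lform)
  have in_V: "proj_point v \<in> V \<longleftrightarrow> meval f v \<noteq> 0" for v
  proof
    assume "proj_point v \<in> V"
    then show "meval f v \<noteq> 0"
      using scale by (auto simp: V_def proj_point_eq_iff)
  next
    assume "meval f v \<noteq> 0"
    then show "proj_point v \<in> V"
      using f0 unfolding V_def by blast
  qed
  have U: "{v \<in> topspace (top_of_set (- {0})). proj_point v \<in> V} = milnor_total f"
    using f0 by (auto simp: in_V milnor_total_def)
  have "{v. v \<noteq> 0 \<and> proj_point v \<in> V} = {v. meval f v \<noteq> 0}"
    using f0 by (auto simp: in_V)
  moreover have "open {v. meval f v \<noteq> 0}"
    by (intro open_Collect_neq continuous_intros)
  ultimately have "openin projective_3space V"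
    by (auto simp: openin_projective_3space V_def)
  then have "quotient_map (subtopology (top_of_set (- {0})) (milnor_total f))
      (subtopology projective_3space V) proj_point"
    by (intro quotient_map_restriction[OF quotient_map_proj_point U]) simp
  moreover have "milnor_total f \<subseteq> - {0}"
    using f0 by (auto simp: milnor_total_def)
  ultimately show ?thesis
    by (simp add: arrangement_complement_def V_def subtopology_subtopology Int_absorb1)
qed

text \<open>For the fibrations the homeomorphism of the base is the identity. For the complements,
  equivariance makes the images under \<Phi> and \<Phi>' of punctured lines punctured lines
  again.\<close>

lemma equivariant_homeomorphism_imp:
  assumes "finite I" "I \<noteq> {}" "finite I'" "I' \<noteq> {}"
    and f: "f = (\<Prod>i\<in>I. lform (a i))" and f': "f' = (\<Prod>i\<in>I'. lform (a' i))"
    and hom: "homeomorphism (milnor_total f) (milnor_total f') \<Phi> \<Phi>'"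
    and fib: "\<And>v. v \<in> milnor_total f \<Longrightarrow> meval f' (\<Phi> v) = meval f v"
    and scale: "\<And>c v. c \<noteq> 0 \<Longrightarrow> \<Phi> (c *s v) = c *s \<Phi> v"
  shows "milnor_equivalent f f'" "arrangement_complement f homeomorphic_space arrangement_complement f'"
proof -
  show "milnor_equivalent f f'"
    unfolding milnor_equivalent_def using hom fib
    by (intro exI[of _ \<Phi>] exI[of _ \<Phi>'] exI[of _ "\<lambda>z. z"]) (auto simp: homeomorphism_ident)
next
  note q = quotient_map_arrangement_complement[OF assms(1,2) f]
  note q' = quotient_map_arrangement_complement[OF assms(3,4) f']
  have in_f: "c *s v \<in> milnor_total f \<longleftrightarrow> v \<in> milnor_total f" if "c \<noteq> 0" for c v
    using that assms(1) by (simp add: f meval_prod_lform lval_scale_right milnor_total_def)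
  have in_f': "c *s v \<in> milnor_total f' \<longleftrightarrow> v \<in> milnor_total f'" if "c \<noteq> 0" for c v
    using that assms(3) by (simp add: f' meval_prod_lform lval_scale_right milnor_total_def)
  \<comment> \<open>The inverse is determined only on \<open>milnor_total f'\<close>, so its
    equivariance is available only there.\<close>
  have scale': "\<Phi>' (c *s w) = c *s \<Phi>' w" if "c \<noteq> 0" "w \<in> milnor_total f'" for c w
  proof -
    have "\<Phi>' w \<in> milnor_total f"
      using hom that(2) by (auto simp: homeomorphism_def)
    then have "\<Phi>' (\<Phi> (c *s \<Phi>' w)) = c *s \<Phi>' w"
      using hom that in_f by (auto simp: homeomorphism_def)
    moreover have "\<Phi> (c *s \<Phi>' w) = c *s w"
      using hom that by (auto simp: homeomorphism_def scale)
    ultimately show ?thesis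
      by simp
  qed
  have im: "\<Phi> ` proj_point v = proj_point (\<Phi> v)" for v
    unfolding proj_point_def by (auto simp: scale image_iff) (metis scale)
  have im': "\<Phi>' ` proj_point w = proj_point (\<Phi>' w)" if "w \<in> milnor_total f'" for w
  proof
    show "\<Phi>' ` proj_point w \<subseteq> proj_point (\<Phi>' w)"
      unfolding proj_point_def using scale'[OF _ that] by auto
    show "proj_point (\<Phi>' w) \<subseteq> \<Phi>' ` proj_point w"
      unfolding proj_point_def using scale'[OF _ that] by (auto simp: image_iff) metis
  qed
  have cont: "continuous_map (top_of_set (milnor_total f)) (top_of_set (milnor_total f')) \<Phi>"
    and cont': "continuous_map (top_of_set (milnor_total f')) (top_of_set (milnor_total f)) \<Phi>'"
    using hom by (auto simp: homeomorphism_def)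
  have inv: "\<Phi>' (\<Phi> v) = v" if "v \<in> milnor_total f" for v
    using hom that by (auto simp: homeomorphism_def)
  have inv': "\<Phi> (\<Phi>' w) = w" if "w \<in> milnor_total f'" for w
    using hom that by (auto simp: homeomorphism_def)
  have maps: "\<Phi> v \<in> milnor_total f'" if "v \<in> milnor_total f" for v
    using hom that by (auto simp: homeomorphism_def)
  have maps': "\<Phi>' w \<in> milnor_total f" if "w \<in> milnor_total f'" for w
    using hom that by (auto simp: homeomorphism_def)
  have "continuous_map (top_of_set (milnor_total f)) (arrangement_complement f') (image \<Phi> \<circ> proj_point)"
    by (rule continuous_map_eq[OF continuous_map_compose[OF cont quotient_imp_continuous_map[OF q']]])
      (simp add: im)
  then have c: "continuous_map (arrangement_complement f) (arrangement_complement f') (image \<Phi>)"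
    by (rule continuous_compose_quotient_map[OF q])
  have "continuous_map (top_of_set (milnor_total f')) (arrangement_complement f) (image \<Phi>' \<circ> proj_point)"
    by (rule continuous_map_eq[OF continuous_map_compose[OF cont' quotient_imp_continuous_map[OF q]]])
      (simp add: im')
  then have c': "continuous_map (arrangement_complement f') (arrangement_complement f) (image \<Phi>')"
    by (rule continuous_compose_quotient_map[OF q'])
  have top: "topspace (arrangement_complement f) = proj_point ` milnor_total f"
    using quotient_imp_surjective_map[OF q] by simp
  have top': "topspace (arrangement_complement f') = proj_point ` milnor_total f'"
    using quotient_imp_surjective_map[OF q'] by simp
  have "homeomorphic_maps (arrangement_complement f) (arrangement_complement f') (image \<Phi>) (image \<Phi>')"
    unfolding homeomorphic_maps_def top top' using c c'
    by (auto simp: im im' maps maps' inv inv')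
  then show "arrangement_complement f homeomorphic_space arrangement_complement f'"
    unfolding homeomorphic_space_def by blast
qed

section \<open>Dimensions in the Jacobian algebra\<close>

interpretation mp: vector_space "\<lambda>c (p :: mpoly4). mconst c * p"
  by unfold_locales (simp_all add: mconst_add mconst_mult algebra_simps)

text \<open>Yields representatives of V / U inside V, so that quotient dimensions become dimensions
  of spaces of polynomials. A basis of \<open>U\<close> is extended to one of \<open>V\<close>, and
  \<open>B\<close> consists of the added vectors.\<close>

lemma complement_exists:
  assumes U: "mp.subspace U" and V: "mp.subspace V" and UV: "U \<subseteq> V" and F: "finite F" "V \<subseteq> mp.span F"
  obtains B where "finite B" "B \<subseteq> V" "mp.independent B" "mp.span B \<inter> U \<subseteq> {0}"
    "\<And>p. p \<in> V \<Longrightarrow> \<exists>b\<in>mp.span B. p - b \<in> U" "card B + mp.dim U = mp.dim V"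
proof -
  obtain A where A: "A \<subseteq> U" "mp.independent A" "U \<subseteq> mp.span A" "card A = mp.dim U"
    by (rule mp.basis_exists)
  obtain C where C: "A \<subseteq> C" "C \<subseteq> V" "mp.independent C" "V \<subseteq> mp.span C"
    using mp.maximal_independent_subset_extend[of A V] A UV by blast
  have finC: "finite C"
    using mp.independent_span_bound[OF F(1) C(3)] C(2) F(2) by blast
  then have finA: "finite A"
    using C(1) finite_subset by blast
  have AU: "mp.span A = U"
    using A U mp.span_minimal by blast
  show ?thesis
  proof (rule that[of "C - A"])
    show "finite (C - A)" "C - A \<subseteq> V"
      using finC C by auto
    show "mp.independent (C - A)"
      using C(3) mp.independent_mono by blast
    show "mp.span (C - A) \<inter> U \<subseteq> {0}"
    proof
      fix p assume p: "p \<in> mp.span (C - A) \<inter> U"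
      then obtain u where u: "p = (\<Sum>v\<in>C - A. mconst (u v) * v)"
        using mp.span_finite[of "C - A"] finC by auto
      obtain w where w: "p = (\<Sum>v\<in>A. mconst (w v) * v)"
        using p mp.span_finite[OF finA] AU by auto
      define x where "x v = (if v \<in> A then - w v else u v)" for v
      have "(\<Sum>v\<in>C. mconst (x v) * v) = (\<Sum>v\<in>C - A. mconst (x v) * v) + (\<Sum>v\<in>A. mconst (x v) * v)"
        using sum.subset_diff[OF C(1) finC] by blast
      also have "\<dots> = (\<Sum>v\<in>C - A. mconst (u v) * v) + (\<Sum>v\<in>A. - (mconst (w v) * v))"
        by (intro arg_cong2[of _ _ _ _ "(+)"] sum.cong) (auto simp: x_def mconst_uminus)
      also have "\<dots> = 0"
        using u w by (simp add: sum_negf)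
      finally have "\<forall>v\<in>C. x v = 0"
        using C(3) finC mp.dependent_finite by blast
      then have "u v = 0" if "v \<in> C - A" for v
        using that by (auto simp: x_def split: if_splits)
      then show "p \<in> {0}"
        by (simp add: u)
    qed
    show "\<exists>b\<in>mp.span (C - A). p - b \<in> U" if p: "p \<in> V" for p
    proof -
      obtain u where u: "p = (\<Sum>v\<in>C. mconst (u v) * v)"
        using p C(4) mp.span_finite[OF finC] by auto
      define b where "b = (\<Sum>v\<in>C - A. mconst (u v) * v)"
      have "p - b = (\<Sum>v\<in>A. mconst (u v) * v)"
        unfolding u b_def using sum.subset_diff[OF C(1) finC, of "\<lambda>v. mconst (u v) * v"] by simp
      also have "\<dots> \<in> mp.span A"
        by (intro mp.span_sum mp.span_scale mp.span_base)
      finally have "p - b \<in> U"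
        using AU by simp
      moreover have "b \<in> mp.span (C - A)"
        unfolding b_def by (intro mp.span_sum mp.span_scale mp.span_base)
      ultimately show ?thesis
        by blast
    qed
    have "card C = mp.dim V"
      using C mp.basis_card_eq_dim by blast
    moreover have "card A \<le> card C"
      using C(1) finC card_mono by blast
    ultimately show "card (C - A) + mp.dim U = mp.dim V"
      using A(4) card_Diff_subset[OF finA C(1)] by simp
  qed
qed

subsection \<open>Homogeneous components\<close>

text \<open>The projection onto the span of the monomials satisfying \<open>P\<close>; for a
  condition on the degree it extracts a homogeneous component.\<close>

definition restrict_keys :: "((4 \<Rightarrow>\<^sub>0 nat) \<Rightarrow> bool) \<Rightarrow> mpoly4 \<Rightarrow> mpoly4"
  where "restrict_keys P p = (\<Sum>m\<in>keys p. if P m then single m (lookup p m) else 0)"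

lemma restrict_keys_add: "restrict_keys P (p + q) = restrict_keys P p + restrict_keys P q"
  unfolding restrict_keys_def by (rule sum_keys_add) (simp add: single_add)

lemma restrict_keys_single: "restrict_keys P (single m c) = (if P m then single m c else 0)"
  unfolding restrict_keys_def
  by (rule sum_keys_single[where F = "\<lambda>m c. if P m then single m c else 0"]) simp

lemma lookup_restrict_keys: "lookup (restrict_keys P p) m = (if P m then lookup p m else 0)"
  by (induction p rule: poly_mapping_add_induct)
    (auto simp: restrict_keys_add restrict_keys_single lookup_add lookup_single when_def)

lemma restrict_keys_0 [simp]: "restrict_keys P 0 = 0"
  by (intro poly_mapping_eqI) (simp add: lookup_restrict_keys)

lemma keys_restrict_keys: "keys (restrict_keys P p) = {m \<in> keys p. P m}"
  by (auto simp: in_keys_iff lookup_restrict_keys split: if_splits)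

lemma restrict_keys_sum: "restrict_keys P (sum f I) = (\<Sum>i\<in>I. restrict_keys P (f i))"
  by (induction I rule: infinite_finite_induct) (auto simp: restrict_keys_add)

lemma restrict_keys_id: "(\<And>m. m \<in> keys p \<Longrightarrow> P m) \<Longrightarrow> restrict_keys P p = p"
  by (intro poly_mapping_eqI) (auto simp: lookup_restrict_keys in_keys_iff)

text \<open>For homogeneous \<open>h\<close> this is the usual shift: a component of
  \<open>q * h\<close> is \<open>h\<close> times the component of \<open>q\<close> in the degree
  lowered by that of \<open>h\<close>. It replaces arbitrary coefficients by homogeneous
  ones.\<close>

lemma restrict_keys_mult:
  assumes "\<And>m n. n \<in> keys h \<Longrightarrow> P (m + n) \<longleftrightarrow> Q m"
  shows "restrict_keys P (q * h) = restrict_keys Q q * h"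
proof (induction q rule: poly_mapping_add_induct)
  case (single m c)
  have "single m c * h = (\<Sum>n\<in>keys h. single (m + n) (c * lookup h n))"
    by (subst sum_single_keys[of h, symmetric]) (simp add: sum_distrib_left mult_single)
  then have "restrict_keys P (single m c * h) = (\<Sum>n\<in>keys h. if Q m then single (m + n) (c * lookup h n) else 0)"
    by (simp add: restrict_keys_sum restrict_keys_single assms cong: sum.cong)
  also have "\<dots> = (if Q m then single m c * h else 0)"
    using \<open>single m c * h = _\<close> by simp
  finally show ?case
    by (simp add: restrict_keys_single)
qed (simp add: restrict_keys_add distrib_right)

definition wfree :: "mpoly4 set"
  where "wfree = {p. \<forall>m\<in>keys p. lookup m 4 = 0}"

definition form3 :: "nat \<Rightarrow> mpoly4 set"
  where "form3 j = homog j \<inter> wfree"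

lemma subspace_keys: "mp.subspace {p. \<forall>m\<in>keys p. P m}"
proof -
  have "(\<forall>m\<in>keys p. P m) \<longleftrightarrow> (\<forall>m. lookup p m \<noteq> 0 \<longrightarrow> P m)" for p :: mpoly4
    by (auto simp: in_keys_iff)
  then show ?thesis
    unfolding mp.subspace_def by (auto simp: lookup_add lookup_mconst_mult) (metis add_0)
qed

lemma subspace_homog: "mp.subspace (homog k)"
  unfolding homog_def by (rule subspace_keys)

lemma subspace_wfree: "mp.subspace wfree"
  unfolding wfree_def by (rule subspace_keys)

lemma subspace_form3: "mp.subspace (form3 k)"
  unfolding form3_def by (intro mp.subspace_inter subspace_homog subspace_wfree)

lemma homog_mult: "p \<in> homog j \<Longrightarrow> q \<in> homog k \<Longrightarrow> p * q \<in> homog (j + k)"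
  using keys_mult[of p q] unfolding homog_def by (fastforce simp: lookup_add sum.distrib)

lemma wfree_mult: "p \<in> wfree \<Longrightarrow> q \<in> wfree \<Longrightarrow> p * q \<in> wfree"
  using keys_mult[of p q] unfolding wfree_def by (fastforce simp: lookup_add)

lemma form3_mult: "p \<in> form3 j \<Longrightarrow> q \<in> form3 k \<Longrightarrow> p * q \<in> form3 (j + k)"
  by (simp add: form3_def homog_mult wfree_mult)

lemma mconst_form3: "mconst c \<in> form3 0"
  by (auto simp: form3_def homog_def wfree_def mconst_def)

lemma sum_lookup_single: "(\<Sum>i\<in>UNIV. lookup (single (j :: 4) c) i) = (c :: nat)"
  by (simp add: lookup_single when_def sum.delta')

lemma var_homog: "var i \<in> homog 1"
  by (auto simp: homog_def var_def sum_lookup_single)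

lemma var_form3: "i \<noteq> 4 \<Longrightarrow> var i \<in> form3 1"
  using var_homog by (auto simp: form3_def wfree_def var_def lookup_single when_def)

lemma lform_homog: "lform a \<in> homog 1"
  unfolding lform_def
  by (intro mp.subspace_sum[OF subspace_homog] mp.subspace_scale[OF subspace_homog] var_homog)

lemma lform_form3: "a \<in> hyper0 \<Longrightarrow> lform a \<in> form3 1"
proof -
  assume a: "a \<in> hyper0"
  have "mconst (a $ i) * var i \<in> form3 1" for i
    using a var_form3[of i] mp.subspace_scale[OF subspace_form3] mp.subspace_0[OF subspace_form3]
    by (cases "i = 4") (auto simp: hyper0_def)
  then show ?thesis
    unfolding lform_def by (intro mp.subspace_sum[OF subspace_form3])
qed

lemma prod_form3:
  assumes "\<And>i. i \<in> I \<Longrightarrow> p i \<in> form3 1" "finite I"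
  shows "(\<Prod>i\<in>I. p i) \<in> form3 (card I)"
  using assms(2,1)
proof (induction I rule: finite_induct)
  case (insert i I)
  then show ?case
    using form3_mult[of "p i" 1 "\<Prod>i\<in>I. p i" "card I"] by simp
qed (use mconst_form3[of 1] in simp)

lemma finite_monomials: "finite {m :: 4 \<Rightarrow>\<^sub>0 nat. (\<Sum>i\<in>UNIV. lookup m i) = k}"
proof (rule finite_imageD)
  let ?M = "{m :: 4 \<Rightarrow>\<^sub>0 nat. (\<Sum>i\<in>UNIV. lookup m i) = k}"
  have "lookup m i \<le> k" if "m \<in> ?M" for m i
    using that member_le_sum[of i UNIV "lookup m"] by auto
  then have "lookup ` ?M \<subseteq> {g. \<forall>i. g i \<in> {..k}}"
    by blast
  moreover have "finite {g :: 4 \<Rightarrow> nat. \<forall>i. g i \<in> {..k}}"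
    using finite_set_of_finite_funs[of "UNIV :: 4 set" "{..k}" 0] by simp
  ultimately show "finite (lookup ` ?M)"
    by (rule finite_subset)
  show "inj_on lookup ?M"
    by (rule inj_onI) (simp only: poly_mapping_eq_iff)
qed

lemma homog_finite_span: "\<exists>F. finite F \<and> homog k \<subseteq> mp.span F"
proof (intro exI conjI subsetI)
  let ?F = "(\<lambda>m. single m 1) ` {m :: 4 \<Rightarrow>\<^sub>0 nat. (\<Sum>i\<in>UNIV. lookup m i) = k}"
  show "finite ?F"
    using finite_monomials by blast
  fix p assume p: "p \<in> homog k"
  have "(\<Sum>m\<in>keys p. mconst (lookup p m) * single m 1) \<in> mp.span ?F"
    using p by (intro mp.span_sum mp.span_scale mp.span_base) (auto simp: homog_def)
  then show "p \<in> mp.span ?F"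
    by (simp add: sum_single_keys flip: single_eq_mconst)
qed

lemma keys_var_mult: "keys (var i * p) = (\<lambda>m. single i 1 + m) ` keys p"
proof -
  have *: "lookup (var i * p) (single i 1 + m) = lookup p m" for m
    by (induction p rule: poly_mapping_add_induct)
      (auto simp: var_mult_single lookup_single when_def distrib_left lookup_add)
  have "keys (var i * p) \<subseteq> (\<lambda>m. single i 1 + m) ` keys p"
  proof
    fix m assume "m \<in> keys (var i * p)"
    then obtain a b where "m = a + b" "a \<in> keys (var i)" "b \<in> keys p"
      using keys_mult[of "var i" p] by blast
    then show "m \<in> (\<lambda>m. single i 1 + m) ` keys p"
      by (simp add: var_def)
  qed
  moreover have "single i 1 + m \<in> keys (var i * p)" if "m \<in> keys p" for m
    using that * by (auto simp: in_keys_iff)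
  ultimately show ?thesis
    by blast
qed

text \<open>Division by w with remainder: S is the direct sum of w S and C[x, y, z], compatibly with
  degrees. Iterated, this splits a degree \<open>k\<close> piece into ternary pieces of all degrees
  up to \<open>k\<close>.\<close>

lemma split_wfree:
  obtains q t where "p = var 4 * q + t" "t \<in> wfree" "\<And>k. p \<in> homog (Suc k) \<Longrightarrow> q \<in> homog k \<and> t \<in> form3 (Suc k)"
proof -
  define t where "t = restrict_keys (\<lambda>m. lookup m 4 = 0) p"
  have "\<exists>q. restrict_keys (\<lambda>m. lookup m 4 \<noteq> 0) p = var 4 * q"
  proof (induction p rule: poly_mapping_add_induct)
    case (single m c)
    have "m = single 4 1 + (m - single 4 1)" if "lookup m 4 \<noteq> 0"
      using that by (intro poly_mapping_eqI) (auto simp: lookup_add lookup_minus lookup_single when_def)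
    then have *: "single m c = var 4 * single (m - single 4 1) c" if "lookup m 4 \<noteq> 0"
      using that by (metis var_mult_single)
    show ?case
    proof (cases "lookup m 4 = 0")
      case True
      then show ?thesis
        by (intro exI[of _ 0]) (simp add: restrict_keys_single)
    next
      case False
      then show ?thesis
        using *[OF False] unfolding restrict_keys_single by auto
    qed
  next
    case (add p q)
    then show ?case
      by (auto simp: restrict_keys_add simp flip: distrib_left)
  qed
  then obtain q where q: "restrict_keys (\<lambda>m. lookup m 4 \<noteq> 0) p = var 4 * q"
    by blast
  have p: "p = var 4 * q + t"
    unfolding q[symmetric] t_def by (intro poly_mapping_eqI) (simp add: lookup_add lookup_restrict_keys)
  show ?thesis
  proof (rule that[OF p])
    show "t \<in> wfree"
      by (auto simp: wfree_def t_def keys_restrict_keys)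
    fix k assume k: "p \<in> homog (Suc k)"
    have "t \<in> form3 (Suc k)"
      using k \<open>t \<in> wfree\<close> by (auto simp: form3_def homog_def t_def keys_restrict_keys)
    moreover have "q \<in> homog k"
      unfolding homog_def
    proof safe
      fix m assume "m \<in> keys q"
      then have "single 4 1 + m \<in> keys (restrict_keys (\<lambda>m. lookup m 4 \<noteq> 0) p)"
        unfolding q keys_var_mult by blast
      then have "(\<Sum>i\<in>UNIV. lookup (single 4 1 + m) i) = Suc k"
        using k by (auto simp: keys_restrict_keys homog_def)
      then show "(\<Sum>i\<in>UNIV. lookup m i) = k"
        by (simp add: lookup_add sum.distrib sum_lookup_single)
    qed
    ultimately show "q \<in> homog k \<and> t \<in> form3 (Suc k)"
      by blast
  qed
qed

lemma restrict_wfree_var4: "restrict_keys (\<lambda>m. lookup m 4 = 0) (var 4 * q) = 0"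
proof (rule poly_mapping_eqI)
  fix m
  have "m \<notin> keys (var 4 * q)" if "lookup m 4 = 0"
    using that by (auto simp: keys_var_mult lookup_add)
  then show "lookup (restrict_keys (\<lambda>m. lookup m 4 = 0) (var 4 * q)) m = lookup 0 m"
    by (auto simp: lookup_restrict_keys in_keys_iff)
qed

lemma var_mult_eq_0: "var i * q = 0 \<Longrightarrow> q = 0"
  using keys_var_mult[of i q] by (metis image_is_empty keys_eq_empty)

lemma var_neq_0: "var i \<noteq> 0"
  using lookup_single_eq[of "single i 1" "1 :: complex"] unfolding var_def
  by (metis lookup_zero zero_neq_one)

lemma wfree_split_unique:
  assumes "var 4 * q + t = 0" "t \<in> wfree"
  shows "q = 0" "t = 0"
proof -
  have "restrict_keys (\<lambda>m. lookup m 4 = 0) (var 4 * q + t) = t"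
    using assms(2) by (simp add: restrict_keys_add restrict_wfree_var4 restrict_keys_id wfree_def)
  then show "t = 0"
    using assms(1) by simp
  then show "q = 0"
    using assms(1) by (intro var_mult_eq_0[of 4 q]) simp
qed


subsection \<open>The Jacobian ideal\<close>

lemma mpoly4_ring_simps [simp]:
  "carrier mpoly4_ring = UNIV" "x \<otimes>\<^bsub>mpoly4_ring\<^esub> y = x * y" "x \<oplus>\<^bsub>mpoly4_ring\<^esub> y = x + y"
  "\<zero>\<^bsub>mpoly4_ring\<^esub> = 0" "\<one>\<^bsub>mpoly4_ring\<^esub> = 1"
  by (simp_all add: ring_of_type_algebra_def)

lemma ring_mpoly4: "ring mpoly4_ring"
  by (rule ring_from_type_algebra)

lemma jacobian_ideal_ideal: "ideal (jacobian_ideal f) mpoly4_ring"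
  unfolding jacobian_ideal_def by (rule ring.genideal_ideal[OF ring_mpoly4]) simp

lemma jacobian_ideal_mult: "p \<in> jacobian_ideal f \<Longrightarrow> q * p \<in> jacobian_ideal f"
  using ideal.I_l_closed[OF jacobian_ideal_ideal, of p f q] by simp

lemma jacobian_ideal_add: "p \<in> jacobian_ideal f \<Longrightarrow> q \<in> jacobian_ideal f \<Longrightarrow> p + q \<in> jacobian_ideal f"
  using additive_subgroup.a_closed[OF ideal.axioms(1)[OF jacobian_ideal_ideal], of p f q] by simp

lemma jacobian_ideal_0: "0 \<in> jacobian_ideal f"
  using additive_subgroup.zero_closed[OF ideal.axioms(1)[OF jacobian_ideal_ideal], of f] by simp

lemma subspace_jacobian_ideal: "mp.subspace (jacobian_ideal f)"
  unfolding mp.subspace_def using jacobian_ideal_mult jacobian_ideal_add jacobian_ideal_0 by blast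

lemma mpderiv_in_jacobian_ideal: "mpderiv i f \<in> jacobian_ideal f"
proof -
  have "{mpderiv i f | i. True} \<subseteq> jacobian_ideal f"
    unfolding jacobian_ideal_def by (rule ring.genideal_self[OF ring_mpoly4]) simp
  then show ?thesis
    by blast
qed

lemma jacobian_ideal_eq: "jacobian_ideal f = {\<Sum>i\<in>UNIV. q i * mpderiv i f | q. True}" (is "_ = ?J")
proof
  show "?J \<subseteq> jacobian_ideal f"
    by (auto intro!: mp.subspace_sum[OF subspace_jacobian_ideal] jacobian_ideal_mult mpderiv_in_jacobian_ideal)
  have add: "p + q \<in> ?J" if pq: "p \<in> ?J" "q \<in> ?J" for p q
  proof -
    from pq obtain r s where "p = (\<Sum>i\<in>UNIV. r i * mpderiv i f)" "q = (\<Sum>i\<in>UNIV. s i * mpderiv i f)"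
      by auto
    then have "p + q = (\<Sum>i\<in>UNIV. (r i + s i) * mpderiv i f)"
      by (simp add: distrib_right sum.distrib)
    then show ?thesis
      by auto
  qed
  have mult: "x * p \<in> ?J" if p: "p \<in> ?J" for p x
  proof -
    from p obtain r where "p = (\<Sum>i\<in>UNIV. r i * mpderiv i f)"
      by auto
    then have "x * p = (\<Sum>i\<in>UNIV. (x * r i) * mpderiv i f)"
      by (simp add: sum_distrib_left mult.assoc)
    then show ?thesis
      by auto
  qed
  have zero: "0 \<in> ?J"
    by (auto intro!: exI[of _ "\<lambda>_. 0"])
  interpret ring mpoly4_ring
    by (rule ring_mpoly4)
  have "ideal ?J mpoly4_ring"
  proof (rule idealI[OF ring_mpoly4])
    show "subgroup ?J (add_monoid mpoly4_ring)"
    proof (rule add.subgroupI)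
      fix p assume p: "p \<in> ?J"
      have "\<ominus>\<^bsub>mpoly4_ring\<^esub> p = - p"
        by (rule minus_equality[symmetric, OF _ _ , of "- p" p, symmetric]) simp_all
      then show "\<ominus>\<^bsub>mpoly4_ring\<^esub> p \<in> ?J"
        using mult[OF p, of "- 1"] by simp
    qed (use add zero in auto)
  qed (use mult in \<open>simp_all add: mult.commute\<close>)
  moreover have "{mpderiv i f | i. True} \<subseteq> ?J"
  proof safe
    fix i
    have "(\<Sum>j\<in>UNIV. (if j = i then 1 else 0) * mpderiv j f) = (\<Sum>j\<in>UNIV. if j = i then mpderiv j f else 0)"
      by (rule sum.cong) auto
    then show "\<exists>q. mpderiv i f = (\<Sum>j\<in>UNIV. q j * mpderiv j f) \<and> True"
      by (intro exI[of _ "\<lambda>j. if j = i then 1 else 0"]) simp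
  qed
  ultimately show "jacobian_ideal f \<subseteq> ?J"
    unfolding jacobian_ideal_def genideal_def by blast
qed

lemma jacobian_class_eq_iff: "jacobian_class f p = jacobian_class f q \<longleftrightarrow> p - q \<in> jacobian_ideal f"
proof -
  interpret ring mpoly4_ring
    by (rule ring_mpoly4)
  have "\<ominus>\<^bsub>mpoly4_ring\<^esub> q = - q"
    by (rule minus_equality[symmetric, OF _ _ , of "- q" q, symmetric]) simp_all
  then have "p \<ominus>\<^bsub>mpoly4_ring\<^esub> q = p - q"
    by (simp add: a_minus_def)
  then show ?thesis
    using quotient_eq_iff_same_a_r_cos[OF jacobian_ideal_ideal[of f], of p q]
    by (simp add: jacobian_class_def)
qed

lemma ring_hom_jacobian_class: "ring_hom_ring mpoly4_ring (jacobian_algebra f) (jacobian_class f)"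
  unfolding jacobian_algebra_def
  using ideal.rcos_ring_hom_ring[OF jacobian_ideal_ideal] by (simp add: jacobian_class_def[abs_def])

text \<open>A homomorphism from the field of complex numbers to a nonzero ring has a subfield as its
  image; the dimension theory of \<open>ring.dim\<close> is stated over subfields.\<close>

lemma subfield_jacobian_scalars:
  assumes "1 \<notin> jacobian_ideal f"
  shows "subfield (jacobian_class f ` {mconst c | c. True}) (jacobian_algebra f)"
proof -
  interpret h: ring_hom_ring mpoly4_ring "jacobian_algebra f" "jacobian_class f"
    by (rule ring_hom_jacobian_class)
  interpret C: field "ring_of_type_algebra :: complex ring"
    by (rule field_from_type_algebra)
  have one: "\<one>\<^bsub>jacobian_algebra f\<^esub> \<noteq> \<zero>\<^bsub>jacobian_algebra f\<^esub>"
    using assms jacobian_class_eq_iff[of f 1 0] h.hom_one h.hom_zero by auto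
  have "ring_hom_ring (ring_of_type_algebra :: complex ring) (jacobian_algebra f) (\<lambda>c. jacobian_class f (mconst c))"
  proof (rule ring_hom_ringI)
    show "ring (ring_of_type_algebra :: complex ring)" "ring (jacobian_algebra f)"
      by unfold_locales
    show "jacobian_class f (mconst c) \<in> carrier (jacobian_algebra f)" for c
      by (rule h.hom_closed) simp
    show "jacobian_class f (mconst (x \<otimes>\<^bsub>ring_of_type_algebra\<^esub> y)) =
        jacobian_class f (mconst x) \<otimes>\<^bsub>jacobian_algebra f\<^esub> jacobian_class f (mconst y)" for x y
      using h.hom_mult[of "mconst x" "mconst y"] by (simp add: ring_of_type_algebra_def mconst_mult)
    show "jacobian_class f (mconst (x \<oplus>\<^bsub>ring_of_type_algebra\<^esub> y)) =
        jacobian_class f (mconst x) \<oplus>\<^bsub>jacobian_algebra f\<^esub> jacobian_class f (mconst y)" for x y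
      using h.hom_add[of "mconst x" "mconst y"] by (simp add: ring_of_type_algebra_def mconst_add)
    show "jacobian_class f (mconst \<one>\<^bsub>ring_of_type_algebra\<^esub>) = \<one>\<^bsub>jacobian_algebra f\<^esub>"
      using h.hom_one by (simp add: ring_of_type_algebra_def)
  qed
  then have "subfield ((\<lambda>c. jacobian_class f (mconst c)) ` carrier ring_of_type_algebra) (jacobian_algebra f)"
    using ring_hom_ring.img_is_subfield(2) C.carrier_is_subfield one by blast
  also have "(\<lambda>c. jacobian_class f (mconst c)) ` carrier ring_of_type_algebra = jacobian_class f ` {mconst c | c. True}"
    by (auto simp: ring_of_type_algebra_def)
  finally show ?thesis .
qed

text \<open>Bridges two notions of dimension: \<open>ring.dim\<close> in the quotient ring over the
  classes of constants, and linear algebra among polynomials. The classes of the elements of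
  \<open>B\<close> form the required basis.\<close>

lemma jacobian_dimI:
  assumes "finite B" "B \<subseteq> homog k" "mp.independent B" "mp.span B \<inter> jacobian_ideal f \<subseteq> {0}"
    and gen: "\<And>p. p \<in> homog k \<Longrightarrow> \<exists>b\<in>mp.span B. p - b \<in> jacobian_ideal f"
    and one: "1 \<notin> jacobian_ideal f"
  shows "jacobian_dim f k = card B"
proof -
  interpret h: ring_hom_ring mpoly4_ring "jacobian_algebra f" "jacobian_class f"
    by (rule ring_hom_jacobian_class)
  define K where "K = jacobian_class f ` {mconst c | c. True}"
  have K: "subfield K (jacobian_algebra f)"
    unfolding K_def by (rule subfield_jacobian_scalars[OF one])
  \<comment> \<open>The classes span the image of the span; the recursion of \<open>Span\<close>
    adds one multiple of a vector at a time, as \<open>mp.span_insert\<close> does.\<close>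
  have Span: "h.S.Span K (map (jacobian_class f) us) = jacobian_class f ` mp.span (set us)" for us
  proof (induction us)
    case Nil
    show ?case
      using h.hom_zero by simp
  next
    case (Cons u us)
    have "h.S.Span K (map (jacobian_class f) (u # us)) =
        h.S.line_extension K (jacobian_class f u) (jacobian_class f ` mp.span (set us))"
      using Cons by simp
    also have "\<dots> = jacobian_class f ` {mconst c * u + v | c v. v \<in> mp.span (set us)}"
    proof (intro Set.set_eqI iffI)
      fix x assume "x \<in> h.S.line_extension K (jacobian_class f u) (jacobian_class f ` mp.span (set us))"
      then obtain c v where "v \<in> mp.span (set us)"
        "x = jacobian_class f (mconst c) \<otimes>\<^bsub>jacobian_algebra f\<^esub> jacobian_class f u \<oplus>\<^bsub>jacobian_algebra f\<^esub> jacobian_class f v"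
        unfolding h.S.line_extension_mem_iff K_def by blast
      then have "x = jacobian_class f (mconst c * u + v)"
        using h.hom_add[of "mconst c * u" v] h.hom_mult[of "mconst c" u] by simp
      with \<open>v \<in> _\<close> show "x \<in> jacobian_class f ` {mconst c * u + v | c v. v \<in> mp.span (set us)}"
        by blast
    next
      fix x assume "x \<in> jacobian_class f ` {mconst c * u + v | c v. v \<in> mp.span (set us)}"
      then obtain c v where v: "v \<in> mp.span (set us)" "x = jacobian_class f (mconst c * u + v)"
        by blast
      then have "x = jacobian_class f (mconst c) \<otimes>\<^bsub>jacobian_algebra f\<^esub> jacobian_class f u \<oplus>\<^bsub>jacobian_algebra f\<^esub> jacobian_class f v"
        using h.hom_add[of "mconst c * u" v] h.hom_mult[of "mconst c" u] by simp
      with v(1) show "x \<in> h.S.line_extension K (jacobian_class f u) (jacobian_class f ` mp.span (set us))"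
        unfolding h.S.line_extension_mem_iff K_def by blast
    qed
    also have "{mconst c * u + v | c v. v \<in> mp.span (set us)} = mp.span (set (u # us))"
    proof (intro Set.set_eqI iffI)
      fix x assume "x \<in> {mconst c * u + v | c v. v \<in> mp.span (set us)}"
      then obtain c v where "x = mconst c * u + v" "v \<in> mp.span (set us)"
        by blast
      then have "x - mconst c * u \<in> mp.span (set us)"
        by simp
      then show "x \<in> mp.span (set (u # us))"
        unfolding list.set mp.span_insert by blast
    next
      fix x assume "x \<in> mp.span (set (u # us))"
      then obtain c where "x - mconst c * u \<in> mp.span (set us)"
        unfolding list.set mp.span_insert by blast
      then show "x \<in> {mconst c * u + v | c v. v \<in> mp.span (set us)}"
        by (intro CollectI exI[of _ c] exI[of _ "x - mconst c * u"]) simp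
    qed
    finally show ?case .
  qed
  have ind: "h.S.independent K (map (jacobian_class f) us)"
    if "distinct us" "set us \<subseteq> B" for us
    using that
  proof (induction us)
    case (Cons u us)
    have sub: "mp.span (insert u (set us)) \<subseteq> mp.span B"
      using Cons.prems by (intro mp.span_mono) auto
    \<comment> \<open>A dependence between classes lifts to an element of \<open>mp.span B\<close>
      inside the ideal, which must be zero.\<close>
    have "jacobian_class f u \<notin> jacobian_class f ` mp.span (set us)"
    proof
      assume "jacobian_class f u \<in> jacobian_class f ` mp.span (set us)"
      then obtain v where v: "v \<in> mp.span (set us)" "u - v \<in> jacobian_ideal f"
        by (auto simp: jacobian_class_eq_iff)
      have "v \<in> mp.span (insert u (set us))"
        using v(1) mp.span_mono[of "set us" "insert u (set us)"] by blast
      then have "u - v \<in> mp.span B"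
        using sub mp.span_base[of u "insert u (set us)"] by (blast intro: mp.span_diff)
      with v(2) assms(4) have "u = v"
        by auto
      then have "u \<in> mp.span (B - {u})"
        using v(1) mp.span_mono[of "set us" "B - {u}"] Cons.prems by auto
      then show False
        using assms(3) Cons.prems unfolding mp.dependent_def by auto
    qed
    then show ?case
      using Cons Span[of us] by (auto intro!: h.S.independent.li_Cons h.hom_closed)
  qed simp
  obtain us where us: "set us = B" "distinct us"
    using finite_distinct_list[OF assms(1)] by blast
  have "h.S.dimension (length (map (jacobian_class f) us)) K (h.S.Span K (map (jacobian_class f) us))"
    using ind[OF us(2)] us(1) by (intro h.S.dimension_independent) simp
  then have "h.S.dimension (card B) K (jacobian_class f ` mp.span B)"
    using us distinct_card[OF us(2)] unfolding Span by simp
  moreover have "jacobian_class f ` mp.span B = jacobian_class f ` homog k"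
  proof
    show "jacobian_class f ` mp.span B \<subseteq> jacobian_class f ` homog k"
      using mp.span_minimal[OF assms(2) subspace_homog] by blast
    show "jacobian_class f ` homog k \<subseteq> jacobian_class f ` mp.span B"
      using gen jacobian_class_eq_iff by (fastforce simp: image_iff)
  qed
  ultimately show ?thesis
    using h.S.dimI[OF K, of "card B"] unfolding jacobian_dim_def K_def over_def by simp
qed


section \<open>Ternary graded pieces and the growth of the Jacobian algebra\<close>

definition codim3 :: "mpoly4 \<Rightarrow> nat \<Rightarrow> nat"
  where "codim3 f j = mp.dim (form3 j) - mp.dim (jacobian_ideal f \<inter> form3 j)"

text \<open>The last conclusion shows that the subtraction of natural numbers in
  \<open>codim3\<close> is never truncated.\<close>

lemma form3_complement:
  obtains B where "finite B" "B \<subseteq> form3 j" "mp.independent B" "mp.span B \<inter> jacobian_ideal f \<subseteq> {0}"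
    "\<And>p. p \<in> form3 j \<Longrightarrow> \<exists>b\<in>mp.span B. p - b \<in> jacobian_ideal f"
    "card B = codim3 f j" "card B + mp.dim (jacobian_ideal f \<inter> form3 j) = mp.dim (form3 j)"
proof -
  obtain F where F: "finite F" "form3 j \<subseteq> mp.span F"
    using homog_finite_span[of j] by (auto simp: form3_def)
  obtain B where B: "finite B" "B \<subseteq> form3 j" "mp.independent B" "mp.span B \<inter> (jacobian_ideal f \<inter> form3 j) \<subseteq> {0}"
    "\<And>p. p \<in> form3 j \<Longrightarrow> \<exists>b\<in>mp.span B. p - b \<in> jacobian_ideal f \<inter> form3 j"
    "card B + mp.dim (jacobian_ideal f \<inter> form3 j) = mp.dim (form3 j)"
    using complement_exists[OF mp.subspace_inter[OF subspace_jacobian_ideal subspace_form3] subspace_form3 _ F, of f j]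
    by blast
  have "mp.span B \<subseteq> form3 j"
    using B(2) subspace_form3 by (rule mp.span_minimal)
  show ?thesis
  proof (rule that[of B])
    show "mp.span B \<inter> jacobian_ideal f \<subseteq> {0}"
      using B(4) \<open>mp.span B \<subseteq> form3 j\<close> by blast
    show "\<exists>b\<in>mp.span B. p - b \<in> jacobian_ideal f" if "p \<in> form3 j" for p
      using B(5)[OF that] by blast
    show "card B = codim3 f j"
      using B(6) by (simp add: codim3_def)
  qed (use B in blast)+
qed

text \<open>The hypothesis makes multiplication by \<open>l\<close> surjective from degree
  \<open>j\<close> of the quotient to degree \<open>j + 1\<close>. Thus \<open>l\<close> times
  representatives in degree \<open>j\<close>, with a basis of the ideal in degree
  \<open>j + 1\<close>, span all forms.\<close>

lemma codim3_Suc_le: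
  assumes "\<And>p. p \<in> form3 (Suc j) \<Longrightarrow> \<exists>q\<in>form3 j. p - l * q \<in> jacobian_ideal f" and l: "l \<in> form3 1"
  shows "codim3 f (Suc j) \<le> codim3 f j"
proof -
  obtain B where B: "finite B" "B \<subseteq> form3 j"
    "\<And>p. p \<in> form3 j \<Longrightarrow> \<exists>b\<in>mp.span B. p - b \<in> jacobian_ideal f" "card B = codim3 f j"
    by (rule form3_complement[of j f]) (rule that; assumption)
  obtain F where F: "finite F" "form3 (Suc j) \<subseteq> mp.span F"
    using homog_finite_span[of "Suc j"] by (auto simp: form3_def)
  obtain A where A: "A \<subseteq> jacobian_ideal f \<inter> form3 (Suc j)" "mp.independent A"
    "jacobian_ideal f \<inter> form3 (Suc j) \<subseteq> mp.span A" "card A = mp.dim (jacobian_ideal f \<inter> form3 (Suc j))"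
    by (rule mp.basis_exists)
  have finA: "finite A"
    using mp.independent_span_bound[OF F(1) A(2)] A(1) F(2) by blast
  have lB: "l * b \<in> mp.span ((*) l ` B)" if "b \<in> mp.span B" for b
    using that
  proof (induction b rule: mp.span_induct_alt)
    case (step c x y)
    have "l * (mconst c * x + y) = mconst c * (l * x) + l * y"
      by (simp add: algebra_simps)
    also have "\<dots> \<in> mp.span ((*) l ` B)"
      using step by (intro mp.span_add mp.span_scale) (auto intro: mp.span_base)
    finally show ?case .
  qed (simp add: mp.span_zero)
  have "form3 (Suc j) \<subseteq> mp.span ((*) l ` B \<union> A)"
  proof
    fix p assume p: "p \<in> form3 (Suc j)"
    then obtain q where q: "q \<in> form3 j" "p - l * q \<in> jacobian_ideal f"
      using assms(1) by blast
    then obtain b where b: "b \<in> mp.span B" "q - b \<in> jacobian_ideal f"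
      using B(3) by blast
    have "b \<in> form3 j"
      using b(1) B(2) mp.span_minimal[OF _ subspace_form3] by blast
    have eq: "p - l * b = (p - l * q) + l * (q - b)"
      by (simp add: algebra_simps)
    have "p - l * b \<in> jacobian_ideal f"
      unfolding eq using q b by (intro jacobian_ideal_add jacobian_ideal_mult)
    moreover have "p - l * b \<in> form3 (Suc j)"
      using form3_mult[OF l \<open>b \<in> form3 j\<close>] p by (intro mp.subspace_diff[OF subspace_form3]) auto
    ultimately have "p - l * b \<in> mp.span ((*) l ` B \<union> A)"
      using A(3) mp.span_mono[of A "(*) l ` B \<union> A"] by blast
    moreover have "l * b \<in> mp.span ((*) l ` B \<union> A)"
      using lB[OF b(1)] mp.span_mono[of "(*) l ` B" "(*) l ` B \<union> A"] by blast
    ultimately have "(p - l * b) + l * b \<in> mp.span ((*) l ` B \<union> A)"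
      by (rule mp.span_add)
    then show "p \<in> mp.span ((*) l ` B \<union> A)"
      by simp
  qed
  then have "mp.dim (form3 (Suc j)) \<le> card ((*) l ` B \<union> A)"
    using B(1) finA by (intro mp.dim_le_card) auto
  also have "\<dots> \<le> card B + card A"
    by (rule order_trans[OF card_Un_le]) (simp add: card_image_le B(1))
  finally show ?thesis
    using B(4) A(4) by (simp add: codim3_def)
qed

context
  fixes f :: mpoly4 and d :: nat
  assumes f_wfree: "f \<in> wfree"
begin

lemma mpderiv_wfree: "mpderiv i f \<in> wfree"
  unfolding mpderiv_def
proof (intro mp.subspace_sum[OF subspace_wfree])
  fix m assume m: "m \<in> keys f"
  then show "single (m - single i 1) (of_nat (lookup m i) * lookup f m) \<in> wfree"
    using f_wfree by (auto simp: wfree_def lookup_minus)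
qed

text \<open>The partial derivatives are free of w, so the ideal is extended from C[x, y, z]:
  splitting the coefficients of a combination into a multiple of w and a w-free part splits the
  combination.\<close>

lemma jacobian_ideal_split:
  assumes "var 4 * q + t \<in> jacobian_ideal f" "t \<in> wfree"
  shows "q \<in> jacobian_ideal f" "t \<in> jacobian_ideal f"
proof -
  obtain r where r: "var 4 * q + t = (\<Sum>i\<in>UNIV. r i * mpderiv i f)"
    using assms(1) by (auto simp: jacobian_ideal_eq)
  have "\<exists>q t. p = var 4 * q + t \<and> t \<in> wfree" for p
    by (rule split_wfree[of p]) blast
  then have "\<forall>i. \<exists>q t. r i = var 4 * q + t \<and> t \<in> wfree"
    by blast
  then obtain r1 r2 where r12: "\<And>i. r i = var 4 * r1 i + r2 i" "\<And>i. r2 i \<in> wfree"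
    by metis
  have "var 4 * (q - (\<Sum>i\<in>UNIV. r1 i * mpderiv i f)) + (t - (\<Sum>i\<in>UNIV. r2 i * mpderiv i f)) = 0"
    using r by (simp add: r12(1) algebra_simps sum.distrib sum_distrib_left)
  moreover have "t - (\<Sum>i\<in>UNIV. r2 i * mpderiv i f) \<in> wfree"
    using assms(2) r12(2) mpderiv_wfree
    by (intro mp.subspace_diff[OF subspace_wfree] mp.subspace_sum[OF subspace_wfree] wfree_mult)
  ultimately have "q - (\<Sum>i\<in>UNIV. r1 i * mpderiv i f) = 0" "t - (\<Sum>i\<in>UNIV. r2 i * mpderiv i f) = 0"
    by (rule wfree_split_unique)+
  then show "q \<in> jacobian_ideal f" "t \<in> jacobian_ideal f"
    by (auto simp: jacobian_ideal_eq)
qed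

text \<open>In degree \<open>k + 1\<close> the basis consists of w times the basis in degree
  \<open>k\<close>, together with ternary forms complementing the ideal in degree
  \<open>k + 1\<close>.\<close>

lemma jacobian_basis_exists:
  "\<exists>B. finite B \<and> B \<subseteq> homog k \<and> mp.independent B \<and> mp.span B \<inter> jacobian_ideal f \<subseteq> {0} \<and>
    (\<forall>p\<in>homog k. \<exists>b\<in>mp.span B. p - b \<in> jacobian_ideal f) \<and> card B = (\<Sum>j\<le>k. codim3 f j)"
proof (induction k)
  case 0
  have "homog 0 = form3 0"
    by (auto simp: form3_def homog_def wfree_def)
  moreover obtain B where "finite B" "B \<subseteq> form3 0" "mp.independent B" "mp.span B \<inter> jacobian_ideal f \<subseteq> {0}"
    "\<And>p. p \<in> form3 0 \<Longrightarrow> \<exists>b\<in>mp.span B. p - b \<in> jacobian_ideal f" "card B = codim3 f 0"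
    by (rule form3_complement[of 0 f]) (rule that; assumption)
  ultimately show ?case
    by (intro exI[of _ B]) simp
next
  case (Suc k)
  then obtain B where B: "finite B" "B \<subseteq> homog k" "mp.independent B" "mp.span B \<inter> jacobian_ideal f \<subseteq> {0}"
    "\<And>p. p \<in> homog k \<Longrightarrow> \<exists>b\<in>mp.span B. p - b \<in> jacobian_ideal f" "card B = (\<Sum>j\<le>k. codim3 f j)"
    by blast
  obtain C where C: "finite C" "C \<subseteq> form3 (Suc k)" "mp.independent C" "mp.span C \<inter> jacobian_ideal f \<subseteq> {0}"
    "\<And>p. p \<in> form3 (Suc k) \<Longrightarrow> \<exists>b\<in>mp.span C. p - b \<in> jacobian_ideal f" "card C = codim3 f (Suc k)"
    by (rule form3_complement[of "Suc k" f]) (rule that; assumption)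
  define WB where "WB = (*) (var 4) ` B"
  have C_wfree: "mp.span C \<subseteq> wfree"
    using C(2) by (intro mp.span_minimal subspace_wfree) (auto simp: form3_def)
  have inj: "inj_on ((*) (var 4)) B"
    using var_neq_0[of 4] by (simp add: inj_on_def)
  have disj: "WB \<inter> C = {}"
  proof -
    have False if "b \<in> B" "var 4 * b \<in> C" for b
    proof -
      have "var 4 * b + (- (var 4 * b)) = 0" "- (var 4 * b) \<in> wfree"
        using that(2) C(2) mp.subspace_neg[OF subspace_wfree] by (auto simp: form3_def)
      then have "b = 0"
        by (rule wfree_split_unique)
      then show False
        using that(1) B(3) mp.dependent_zero by blast
    qed
    then show ?thesis
      by (auto simp: WB_def)
  qed
  have sum_eq: "(\<Sum>v\<in>WB \<union> C. mconst (u v) * v) =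
      var 4 * (\<Sum>b\<in>B. mconst (u (var 4 * b)) * b) + (\<Sum>c\<in>C. mconst (u c) * c)" for u
  proof -
    have "(\<Sum>v\<in>WB. mconst (u v) * v) = (\<Sum>b\<in>B. mconst (u (var 4 * b)) * (var 4 * b))"
      unfolding WB_def using inj by (simp add: sum.reindex)
    then show ?thesis
      using disj B(1) C(1) by (simp add: WB_def sum.union_disjoint sum_distrib_left mult_ac)
  qed
  have sum_in: "(\<Sum>c\<in>C. mconst (u c) * c) \<in> mp.span C" "(\<Sum>b\<in>B. mconst (u b) * b) \<in> mp.span B" for u
    by (intro mp.span_sum mp.span_scale mp.span_base; assumption)+
  have fin: "finite (WB \<union> C)"
    using B(1) C(1) by (simp add: WB_def)
  have WB_span: "var 4 * b \<in> mp.span (WB \<union> C)" if "b \<in> mp.span B" for b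
    using that
  proof (induction b rule: mp.span_induct_alt)
    case (step c x y)
    have "var 4 * (mconst c * x + y) = mconst c * (var 4 * x) + var 4 * y"
      by (simp add: algebra_simps)
    also have "\<dots> \<in> mp.span (WB \<union> C)"
      using step by (intro mp.span_add mp.span_scale) (auto intro: mp.span_base simp: WB_def)
    finally show ?case .
  qed (simp add: mp.span_zero)
  show ?case
  proof (intro exI[of _ "WB \<union> C"] conjI ballI)
    show "finite (WB \<union> C)"
      by (rule fin)
    show "WB \<union> C \<subseteq> homog (Suc k)"
      using homog_mult[OF var_homog, of _ k 4] B(2) C(2) by (auto simp: WB_def form3_def)
    show "mp.independent (WB \<union> C)"
      unfolding mp.dependent_finite[OF fin]
    proof safe
      fix u v assume 0: "(\<Sum>v\<in>WB \<union> C. mconst (u v) * v) = 0"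
      have eq: "(\<Sum>b\<in>B. mconst (u (var 4 * b)) * b) = 0" "(\<Sum>c\<in>C. mconst (u c) * c) = 0"
        using wfree_split_unique[OF 0[unfolded sum_eq]] sum_in(1)[of u] C_wfree by blast+
      have "\<forall>b\<in>B. u (var 4 * b) = 0" "\<forall>c\<in>C. u c = 0"
        using mp.independentD[OF B(3,1) subset_refl eq(1)] mp.independentD[OF C(3,1) subset_refl eq(2)] by blast+
      moreover assume "u v \<noteq> 0"
      ultimately show "v \<in> WB \<Longrightarrow> False" "v \<in> C \<Longrightarrow> False"
        by (auto simp: WB_def)
    qed
    show "mp.span (WB \<union> C) \<inter> jacobian_ideal f \<subseteq> {0}"
    proof
      fix x assume x: "x \<in> mp.span (WB \<union> C) \<inter> jacobian_ideal f"
      then obtain u where u: "x = (\<Sum>v\<in>WB \<union> C. mconst (u v) * v)"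
        using mp.span_finite[OF fin] by auto
      have "(\<Sum>b\<in>B. mconst (u (var 4 * b)) * b) \<in> jacobian_ideal f" "(\<Sum>c\<in>C. mconst (u c) * c) \<in> jacobian_ideal f"
        using jacobian_ideal_split[OF x[THEN IntD2, unfolded u sum_eq]] sum_in(1)[of u] C_wfree by blast+
      then have "(\<Sum>b\<in>B. mconst (u (var 4 * b)) * b) = 0" "(\<Sum>c\<in>C. mconst (u c) * c) = 0"
        using B(4) C(4) sum_in(1)[of u] sum_in(2)[of "\<lambda>b. u (var 4 * b)"] by auto
      then show "x \<in> {0}"
        by (simp add: u sum_eq)
    qed
    show "card (WB \<union> C) = (\<Sum>j\<le>Suc k. codim3 f j)"
    proof -
      have "card WB = card B"
        unfolding WB_def using inj by (rule card_image)
      then show ?thesis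
        using disj B(1,6) C(1,6) by (simp add: WB_def card_Un_disjoint)
    qed
    fix p assume p: "p \<in> homog (Suc k)"
    obtain q t where qt: "p = var 4 * q + t" "q \<in> homog k" "t \<in> form3 (Suc k)"
      using split_wfree[of p] p by metis
    obtain b where b: "b \<in> mp.span B" "q - b \<in> jacobian_ideal f"
      using B(5)[OF qt(2)] by blast
    obtain c where c: "c \<in> mp.span C" "t - c \<in> jacobian_ideal f"
      using C(5)[OF qt(3)] by blast
    have "p - (var 4 * b + c) = var 4 * (q - b) + (t - c)"
      by (simp add: qt(1) algebra_simps)
    also have "\<dots> \<in> jacobian_ideal f"
      using b c by (intro jacobian_ideal_add jacobian_ideal_mult)
    finally have "p - (var 4 * b + c) \<in> jacobian_ideal f" .
    moreover have "var 4 * b + c \<in> mp.span (WB \<union> C)"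
      using WB_span[OF b(1)] c(1) mp.span_mono[of C "WB \<union> C"] by (intro mp.span_add) auto
    ultimately show "\<exists>b\<in>mp.span (WB \<union> C). p - b \<in> jacobian_ideal f"
      by blast
  qed
qed

lemma jacobian_dim_eq_sum:
  assumes "1 \<notin> jacobian_ideal f"
  shows "jacobian_dim f k = (\<Sum>j\<le>k. codim3 f j)"
  using jacobian_basis_exists[of k] jacobian_dimI[of _ k f] assms by metis

end

text \<open>The sequence \<open>codim3 f\<close> is eventually non-increasing, hence eventually constant.\<close>

lemma hilbert_polynomial_eventually:
  assumes f: "f \<in> wfree" "1 \<notin> jacobian_ideal f" and dec: "\<And>j. j \<ge> N \<Longrightarrow> codim3 f (Suc j) \<le> codim3 f j"
  shows "\<exists>k0. \<forall>k\<ge>k0. poly (hilbert_polynomial f) (of_nat k) = of_nat (jacobian_dim f k)"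
proof -
  define c where "c = (LEAST c. \<exists>j\<ge>N. codim3 f j = c)"
  have "\<exists>j\<ge>N. codim3 f j = c"
    unfolding c_def by (rule LeastI_ex) auto
  then obtain M where M: "M \<ge> N" "codim3 f M = c"
    by blast
  have const: "codim3 f j = c" if "j \<ge> M" for j
  proof -
    have "codim3 f j \<le> c"
      using that
    proof (induction j rule: dec_induct)
      case (step n)
      then show ?case
        using dec[of n] M(1) by simp
    qed (simp add: M)
    moreover have "c \<le> codim3 f j"
      unfolding c_def using that M(1) by (intro Least_le exI[of _ j]) auto
    ultimately show ?thesis
      by simp
  qed
  have sum_eq: "jacobian_dim f k = jacobian_dim f M + (k - M) * c" if "k \<ge> M" for k
    using that
  proof (induction k rule: dec_induct)
    case (step k)
    have "jacobian_dim f (Suc k) = jacobian_dim f k + codim3 f (Suc k)"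
      by (simp add: jacobian_dim_eq_sum[OF f])
    then show ?case
      using step const[of "Suc k"] by (simp add: Suc_diff_le)
  qed simp
  define P where "P = [:of_nat (jacobian_dim f M) - of_nat M * of_nat c, of_nat c :: rat:]"
  have P: "poly P (of_nat k) = of_nat (jacobian_dim f k)" if "k \<ge> M" for k
    unfolding P_def sum_eq[OF that] of_nat_add of_nat_mult of_nat_diff[OF that]
    by (simp add: algebra_simps)
  \<comment> \<open>The definite description needs uniqueness: two candidates agree at infinitely
    many integers.\<close>
  have "Q = P" if ex: "\<exists>k0. \<forall>k\<ge>k0. poly Q (of_nat k) = of_nat (jacobian_dim f k)" for Q
  proof -
    obtain k0 where k0: "\<forall>k\<ge>k0. poly Q (of_nat k) = of_nat (jacobian_dim f k)"
      using ex by blast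
    have "of_nat ` {max k0 M..} \<subseteq> {x. poly (Q - P) x = 0}"
      using k0 P by auto
    moreover have "infinite (of_nat ` {max k0 M..} :: rat set)"
      by (subst finite_image_iff) (auto intro: inj_onI simp: infinite_Ici)
    ultimately have "infinite {x. poly (Q - P) x = 0}"
      using finite_subset by blast
    then show ?thesis
      using poly_roots_finite[of "Q - P"] by auto
  qed
  then have "hilbert_polynomial f = P"
    unfolding hilbert_polynomial_def using P by (intro the_equality) blast+
  then show ?thesis
    using P by blast
qed

section \<open>Cones over line arrangements\<close>

abbreviation xc :: "complex ^ 4 \<Rightarrow> complex" where "xc v \<equiv> v $ 1"
abbreviation yc :: "complex ^ 4 \<Rightarrow> complex" where "yc v \<equiv> v $ 2"
abbreviation zc :: "complex ^ 4 \<Rightarrow> complex" where "zc v \<equiv> v $ 3"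

definition det3 :: "complex ^ 4 \<Rightarrow> complex ^ 4 \<Rightarrow> complex ^ 4 \<Rightarrow> complex"
  where "det3 u v w =
    xc u * (yc v * zc w - zc v * yc w) + yc u * (zc v * xc w - xc v * zc w) +
    zc u * (xc v * yc w - yc v * xc w)"

text \<open>The three expressions are the coordinates of the cross product, so this says that the
  two lines of the projective plane are distinct.\<close>

definition indep3 :: "complex ^ 4 \<Rightarrow> complex ^ 4 \<Rightarrow> bool"
  where "indep3 v w \<longleftrightarrow> yc v * zc w - zc v * yc w \<noteq> 0 \<or> zc v * xc w - xc v * zc w \<noteq> 0 \<or>
    xc v * yc w - yc v * xc w \<noteq> 0"

lemma cramer3:
  assumes "u \<in> hyper0" "v \<in> hyper0" "w \<in> hyper0" "x \<in> hyper0" "det3 u v w \<noteq> 0"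
  shows "x = (det3 x v w / det3 u v w) *s u + (det3 u x w / det3 u v w) *s v + (det3 u v x / det3 u v w) *s w"
proof -
  have "x $ i * det3 u v w = det3 x v w * u $ i + det3 u x w * v $ i + det3 u v x * w $ i" for i
  proof -
    have "xc x * det3 u v w = det3 x v w * xc u + det3 u x w * xc v + det3 u v x * xc w"
      "yc x * det3 u v w = det3 x v w * yc u + det3 u x w * yc v + det3 u v x * yc w"
      "zc x * det3 u v w = det3 x v w * zc u + det3 u x w * zc v + det3 u v x * zc w"
      by (simp_all add: det3_def algebra_simps)
    then show ?thesis
      using assms(1-4) exhaust_4[of i] by (auto simp: hyper0_def)
  qed
  then have "x $ i = (det3 x v w / det3 u v w) * u $ i + (det3 u x w / det3 u v w) * v $ i + (det3 u v x / det3 u v w) * w $ i" for i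
    using assms(5) by (simp add: field_simps)
  then show ?thesis
    by (simp add: vec_eq_iff)
qed

lemma lform_add: "lform (a + b) = lform a + lform b"
  and lform_scale: "lform (c *s a) = mconst c * lform a"
  by (simp_all add: lform_def mconst_add mconst_mult sum.distrib sum_distrib_left algebra_simps)

lemma lform_axis: "lform (axis i 1) = var i"
proof -
  have "lform (axis i 1) = (\<Sum>j\<in>UNIV. if j = i then var j else 0)"
    unfolding lform_def by (rule sum.cong) (auto simp: axis_def)
  then show ?thesis
    by simp
qed

lemma lform_eq_iff: "lform a = lform b \<longleftrightarrow> a = b"
proof
  assume "lform a = lform b"
  then have "meval (mpderiv i (lform a)) 0 = meval (mpderiv i (lform b)) 0" for i
    by simp
  then show "a = b"
    by (simp add: vec_eq_iff)
qed simp

lemma lform_0: "lform 0 = 0"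
  by (simp add: lform_def)

section \<open>Ternary forms modulo two independent linear forms\<close>

lemma form3_0E:
  assumes "p \<in> form3 0"
  obtains c where "p = mconst c"
proof -
  have "m = 0" if "m \<in> keys p" for m
    using assms that by (intro poly_mapping_eqI) (auto simp: form3_def homog_def)
  then have "p = mconst (lookup p 0)"
    unfolding mconst_def by (intro poly_mapping_eqI) (auto simp: lookup_single when_def in_keys_iff)
  then show ?thesis
    by (rule that)
qed

lemma form3_Suc_split:
  assumes "p \<in> form3 (Suc s)"
  obtains q1 q2 q3 where "q1 \<in> form3 s" "q2 \<in> form3 s" "q3 \<in> form3 s" "p = var 1 * q1 + var 2 * q2 + var 3 * q3"
proof -
  have single: "\<exists>q1 q2 q3. q1 \<in> form3 s \<and> q2 \<in> form3 s \<and> q3 \<in> form3 s \<and>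
      single m c = var 1 * q1 + var 2 * q2 + var 3 * q3" if m: "single m c \<in> form3 (Suc s)" for m c
  proof (cases "c = 0")
    case True
    then show ?thesis
      using mp.subspace_0[OF subspace_form3] by (intro exI[of _ 0]) simp
  next
    case False
    then have deg: "(\<Sum>i\<in>UNIV. lookup m i) = Suc s" "lookup m 4 = 0"
      using m by (auto simp: form3_def homog_def wfree_def)
    then obtain i where i: "lookup m i \<noteq> 0"
      by (metis (no_types, lifting) nat.distinct(1) sum.neutral)
    define m' where "m' = m - single i 1"
    have m_eq: "m = single i 1 + m'"
      using i by (intro poly_mapping_eqI) (auto simp: m'_def lookup_add lookup_minus lookup_single when_def)
    have eq: "single m c = var i * single m' c"
      unfolding m_eq var_mult_single ..
    have "(\<Sum>j\<in>UNIV. lookup m' j) = s" "lookup m' 4 = 0"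
      using deg by (simp_all add: m_eq lookup_add sum.distrib sum_lookup_single)
    then have in_form: "single m' c \<in> form3 s"
      by (auto simp: form3_def homog_def wfree_def)
    have zero: "0 \<in> form3 s"
      by (rule mp.subspace_0[OF subspace_form3])
    have "i \<noteq> 4"
      using i deg(2) by auto
    then consider "i = 1" | "i = 2" | "i = 3"
      using exhaust_4[of i] by blast
    then show ?thesis
    proof cases
      case 1
      then show ?thesis
        using in_form zero eq by (intro exI[of _ "single m' c"] exI[of _ 0]) simp
    next
      case 2
      then show ?thesis
        using in_form zero eq by (intro exI[of _ 0] exI[of _ "single m' c"] exI[of _ 0]) simp
    next
      case 3
      then show ?thesis
        using in_form zero eq by (intro exI[of _ 0] exI[of _ "single m' c"]) simp
    qed
  qed
  have "\<exists>q1 q2 q3. q1 \<in> form3 s \<and> q2 \<in> form3 s \<and> q3 \<in> form3 s \<and>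
      (\<Sum>m\<in>A. single m (lookup p m)) = var 1 * q1 + var 2 * q2 + var 3 * q3" if "finite A" "A \<subseteq> keys p" for A
    using that
  proof (induction A rule: finite_induct)
    case empty
    then show ?case
      using mp.subspace_0[OF subspace_form3] by (intro exI[of _ 0]) simp
  next
    case (insert m A)
    then obtain q1 q2 q3 where q: "q1 \<in> form3 s" "q2 \<in> form3 s" "q3 \<in> form3 s"
      "(\<Sum>m\<in>A. single m (lookup p m)) = var 1 * q1 + var 2 * q2 + var 3 * q3"
      by auto
    have "single m (lookup p m) \<in> form3 (Suc s)"
      using insert.prems assms by (auto simp: form3_def homog_def wfree_def)
    then obtain r1 r2 r3 where r: "r1 \<in> form3 s" "r2 \<in> form3 s" "r3 \<in> form3 s"
      "single m (lookup p m) = var 1 * r1 + var 2 * r2 + var 3 * r3"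
      using single by blast
    have "r1 + q1 \<in> form3 s" "r2 + q2 \<in> form3 s" "r3 + q3 \<in> form3 s"
      using q r mp.subspace_add[OF subspace_form3] by blast+
    moreover have "(\<Sum>m\<in>insert m A. single m (lookup p m)) = var 1 * (r1 + q1) + var 2 * (r2 + q2) + var 3 * (r3 + q3)"
      using insert.hyps q(4) r(4) by (simp add: algebra_simps)
    ultimately show ?case
      by blast
  qed
  from this[OF finite_keys order_refl] show ?thesis
    unfolding sum_single_keys using that by blast
qed

lemma form3_split_basis:
  assumes uvw: "u \<in> hyper0" "v \<in> hyper0" "w \<in> hyper0" "det3 u v w \<noteq> 0" and p: "p \<in> form3 (Suc s)"
  obtains q1 q2 q3 where "q1 \<in> form3 s" "q2 \<in> form3 s" "q3 \<in> form3 s"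
    "p = lform u * q1 + lform v * q2 + lform w * q3"
proof -
  have var: "\<exists>b c d. var i = mconst b * lform u + mconst c * lform v + mconst d * lform w" if "i \<noteq> 4" for i
  proof -
    have "axis i 1 \<in> hyper0"
      using that by (simp add: hyper0_def axis_def)
    from cramer3[OF uvw(1-3) this uvw(4)]
    obtain b c d where "axis i 1 = b *s u + c *s v + d *s w"
      by blast
    then have "lform (axis i 1) = mconst b * lform u + mconst c * lform v + mconst d * lform w"
      by (simp add: lform_add lform_scale)
    then show ?thesis
      unfolding lform_axis by blast
  qed
  obtain r1 r2 r3 where r: "r1 \<in> form3 s" "r2 \<in> form3 s" "r3 \<in> form3 s" "p = var 1 * r1 + var 2 * r2 + var 3 * r3"
    by (rule form3_Suc_split[OF p])
  obtain b1 c1 d1 where 1: "var 1 = mconst b1 * lform u + mconst c1 * lform v + mconst d1 * lform w"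
    using var[of 1] by auto
  obtain b2 c2 d2 where 2: "var 2 = mconst b2 * lform u + mconst c2 * lform v + mconst d2 * lform w"
    using var[of 2] by auto
  obtain b3 c3 d3 where 3: "var 3 = mconst b3 * lform u + mconst c3 * lform v + mconst d3 * lform w"
    using var[of 3] by auto
  have "mconst x * r1 + mconst y * r2 + mconst z * r3 \<in> form3 s" for x y z
    using r by (intro mp.subspace_add[OF subspace_form3] mp.subspace_scale[OF subspace_form3])
  moreover have "p = lform u * (mconst b1 * r1 + mconst b2 * r2 + mconst b3 * r3) +
      lform v * (mconst c1 * r1 + mconst c2 * r2 + mconst c3 * r3) +
      lform w * (mconst d1 * r1 + mconst d2 * r2 + mconst d3 * r3)"
    unfolding r(4) 1 2 3 by (simp add: algebra_simps)
  ultimately show ?thesis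
    by (intro that)
qed

lemma form3_power: "q \<in> form3 1 \<Longrightarrow> q ^ s \<in> form3 s"
  using prod_form3[of "{..<s}" "\<lambda>_. q"] by simp

text \<open>Modulo \<open>lform u\<close> and \<open>lform v\<close> one is at a single point of the
  projective plane, where only the powers of the third coordinate survive.\<close>

lemma form3_split_power:
  assumes uvw: "u \<in> hyper0" "v \<in> hyper0" "w \<in> hyper0" "det3 u v w \<noteq> 0" and p: "p \<in> form3 (Suc s)"
  shows "\<exists>q1\<in>form3 s. \<exists>q2\<in>form3 s. \<exists>c. p = lform u * q1 + lform v * q2 + mconst c * lform w ^ Suc s"
  using p
proof (induction s arbitrary: p)
  case 0
  then obtain q1 q2 q3 where q: "q1 \<in> form3 0" "q2 \<in> form3 0" "q3 \<in> form3 0"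
    "p = lform u * q1 + lform v * q2 + lform w * q3"
    using form3_split_basis[OF uvw] by metis
  obtain c where "q3 = mconst c"
    by (rule form3_0E[OF q(3)])
  then show ?case
    using q by (intro bexI[of _ q1] bexI[of _ q2] exI[of _ c]) (simp_all add: mult.commute)
next
  case (Suc s)
  then obtain q1 q2 q3 where q: "q1 \<in> form3 (Suc s)" "q2 \<in> form3 (Suc s)" "q3 \<in> form3 (Suc s)"
    "p = lform u * q1 + lform v * q2 + lform w * q3"
    using form3_split_basis[OF uvw] by metis
  obtain r1 r2 c where r: "r1 \<in> form3 s" "r2 \<in> form3 s" "q3 = lform u * r1 + lform v * r2 + mconst c * lform w ^ Suc s"
    using Suc.IH[OF q(3)] by blast
  have "q1 + lform w * r1 \<in> form3 (Suc s)" "q2 + lform w * r2 \<in> form3 (Suc s)"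
    using q r form3_mult[OF lform_form3[OF uvw(3)], of _ s] by (auto intro: mp.subspace_add[OF subspace_form3])
  moreover have "p = lform u * (q1 + lform w * r1) + lform v * (q2 + lform w * r2) + mconst c * lform w ^ Suc (Suc s)"
    unfolding q(4) r(3) by (simp add: algebra_simps)
  ultimately show ?case
    by blast
qed

text \<open>Modulo \<open>lform u\<close> and \<open>lform v\<close> each factor is a multiple of
  \<open>lform w\<close>, and the multiple is nonzero because \<open>det3 u v (a i)\<close>
  is.\<close>

lemma prod_lform_split:
  assumes uvw: "u \<in> hyper0" "v \<in> hyper0" "w \<in> hyper0" "det3 u v w \<noteq> 0"
    and "finite I" "I \<noteq> {}" and a: "\<And>i. i \<in> I \<Longrightarrow> a i \<in> hyper0" "\<And>i. i \<in> I \<Longrightarrow> det3 u v (a i) \<noteq> 0"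
  shows "\<exists>q1\<in>form3 (card I - 1). \<exists>q2\<in>form3 (card I - 1). \<exists>c. c \<noteq> 0 \<and>
    (\<Prod>i\<in>I. lform (a i)) = lform u * q1 + lform v * q2 + mconst c * lform w ^ card I"
proof -
  have lin: "\<exists>b1 b2 c. c \<noteq> 0 \<and> lform (a i) = lform u * mconst b1 + lform v * mconst b2 + mconst c * lform w" if "i \<in> I" for i
  proof (intro exI conjI)
    show "det3 u v (a i) / det3 u v w \<noteq> 0"
      using a(2)[OF that] uvw(4) by simp
    show "lform (a i) = lform u * mconst (det3 (a i) v w / det3 u v w) + lform v * mconst (det3 u (a i) w / det3 u v w) +
        mconst (det3 u v (a i) / det3 u v w) * lform w"
      by (subst cramer3[OF uvw(1-3) a(1)[OF that] uvw(4)]) (simp add: lform_add lform_scale mult.commute)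
  qed
  show ?thesis
    using assms(5,6,7,8) lin
  proof (induction I rule: finite_ne_induct)
    case (singleton i)
    then obtain b1 b2 c where "c \<noteq> 0" "lform (a i) = lform u * mconst b1 + lform v * mconst b2 + mconst c * lform w"
      by auto
    then show ?case
      using mconst_form3[of b1] mconst_form3[of b2] by (intro bexI[of _ "mconst b1"] bexI[of _ "mconst b2"] exI[of _ c]) auto
  next
    case (insert i I)
    obtain s where s: "card I = Suc s"
      using insert.hyps(1,2) by (metis card_gt_0_iff gr0_implies_Suc)
    obtain q1 q2 c where q: "q1 \<in> form3 s" "q2 \<in> form3 s" "c \<noteq> 0"
      "(\<Prod>i\<in>I. lform (a i)) = lform u * q1 + lform v * q2 + mconst c * lform w ^ Suc s"
      using insert.IH insert.prems by (auto simp: s)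
    obtain b1 b2 d where b: "d \<noteq> 0" "lform (a i) = lform u * mconst b1 + lform v * mconst b2 + mconst d * lform w"
      using insert.prems(3)[OF insertI1] by blast
    have ai: "lform (a i) \<in> form3 1" and w: "lform w ^ Suc s \<in> form3 (Suc s)"
      using lform_form3[OF insert.prems(1)[OF insertI1]] form3_power[OF lform_form3[OF uvw(3)]] by blast+
    have mem: "lform (a i) * q + mconst b * (mconst c * lform w ^ Suc s) \<in> form3 (Suc s)" if "q \<in> form3 s" for q b
      using form3_mult[OF ai that] w
      by (intro mp.subspace_add[OF subspace_form3] mp.subspace_scale[OF subspace_form3]) auto
    have "(\<Prod>i\<in>insert i I. lform (a i)) = lform (a i) * (lform u * q1 + lform v * q2) + lform (a i) * (mconst c * lform w ^ Suc s)"
      using insert.hyps q(4) by (simp add: algebra_simps)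
    also have "lform (a i) * (mconst c * lform w ^ Suc s) =
        lform u * (mconst b1 * (mconst c * lform w ^ Suc s)) + lform v * (mconst b2 * (mconst c * lform w ^ Suc s)) +
        mconst (d * c) * lform w ^ Suc (Suc s)"
      unfolding b(2) power_Suc[of _ "Suc s"] mconst_mult by (simp only: distrib_left distrib_right mult_ac)
    finally have "(\<Prod>i\<in>insert i I. lform (a i)) =
        lform u * (lform (a i) * q1 + mconst b1 * (mconst c * lform w ^ Suc s)) +
        lform v * (lform (a i) * q2 + mconst b2 * (mconst c * lform w ^ Suc s)) + mconst (d * c) * lform w ^ Suc (Suc s)"
      by (simp add: algebra_simps)
    moreover have "card (insert i I) = Suc (Suc s)"
      using insert.hyps s by simp
    ultimately show ?case
      using mem[OF q(1), of b1] mem[OF q(2), of b2] q(3) b(1)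
      by (metis diff_Suc_1 mult_eq_0_iff)
  qed
qed

section \<open>Cofactors restricted to a generic line\<close>

definition cofactor :: "('i \<Rightarrow> complex ^ 4) \<Rightarrow> 'i set \<Rightarrow> 'i \<Rightarrow> mpoly4"
  where "cofactor a I n = (\<Prod>m\<in>I - {n}. lform (a m))"

lemma cofactor_insert:
  assumes "finite I" "k \<notin> I" "n \<in> I"
  shows "cofactor a (insert k I) n = lform (a k) * cofactor a I n"
proof -
  have "insert k I - {n} = insert k (I - {n})"
    using assms by auto
  then show ?thesis
    using assms by (simp add: cofactor_def)
qed

text \<open>On the generic line \<open>l = 0\<close>, the cofactors of a product of \<open>d\<close> distinct points form a basis
  of the binary forms of degree \<open>d - 1\<close> (Lagrange interpolation).\<close>

lemma cofactors_span:
  assumes l: "l \<in> hyper0" and "finite I" "I \<noteq> {}"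
    and a: "\<And>i. i \<in> I \<Longrightarrow> a i \<in> hyper0"
    and gen: "\<And>i j. i \<in> I \<Longrightarrow> j \<in> I \<Longrightarrow> i \<noteq> j \<Longrightarrow> det3 l (a i) (a j) \<noteq> 0"
    and p: "p \<in> form3 (card I - 1)"
  shows "\<exists>c. \<exists>q\<in>form3 (card I - 2). p = (\<Sum>n\<in>I. mconst (c n) * cofactor a I n) + lform l * q"
  using assms(2,3,4,5,6)
proof (induction I arbitrary: p rule: finite_ne_induct)
  case (singleton k)
  then obtain b where "p = mconst b"
    using form3_0E by auto
  then show ?case
    using mp.subspace_0[OF subspace_form3] by (intro exI[of _ "\<lambda>_. b"] bexI[of _ 0]) (auto simp: cofactor_def)
next
  case (insert k I)
  obtain s where s: "card I = Suc s"
    using insert.hyps(1,2) by (metis card_gt_0_iff gr0_implies_Suc)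
  obtain i0 where i0: "i0 \<in> I"
    using insert.hyps(2) by blast
  have uvw: "a k \<in> hyper0" "l \<in> hyper0" "a i0 \<in> hyper0" "det3 (a k) l (a i0) \<noteq> 0"
  proof -
    have "det3 (a k) l (a i0) = - det3 l (a k) (a i0)"
      by (simp add: det3_def algebra_simps)
    then show "det3 (a k) l (a i0) \<noteq> 0"
      using insert.prems(2)[of k i0] i0 insert.hyps(3) by auto
  qed (use insert.prems i0 l in auto)
  have nz: "det3 (a k) l (a i) \<noteq> 0" if "i \<in> I" for i
  proof -
    have "det3 (a k) l (a i) = - det3 l (a k) (a i)"
      by (simp add: det3_def algebra_simps)
    then show ?thesis
      using insert.prems(2)[of k i] that insert.hyps(3) by auto
  qed
  have "p \<in> form3 (Suc s)"
    using insert.prems(3) insert.hyps s by simp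
  then obtain r1 r2 b where r: "r1 \<in> form3 s" "r2 \<in> form3 s"
    "p = lform (a k) * r1 + lform l * r2 + mconst b * lform (a i0) ^ Suc s"
    using form3_split_power[OF uvw] by blast
  obtain q1 q2 c where q: "q1 \<in> form3 s" "q2 \<in> form3 s" "c \<noteq> 0"
    "(\<Prod>i\<in>I. lform (a i)) = lform (a k) * q1 + lform l * q2 + mconst c * lform (a i0) ^ Suc s"
    using prod_lform_split[OF uvw insert.hyps(1,2), of a] insert.prems(1) nz by (auto simp: s)
  \<comment> \<open>The product over \<open>I\<close>, which is the cofactor of the new index
    \<open>k\<close>, does not vanish at the point where \<open>l\<close> and \<open>a k\<close>
    meet. Subtracting \<open>b'\<close> times it leaves a multiple of \<open>lform (a k)\<close>
    modulo \<open>lform l\<close>, to which the induction hypothesis applies.\<close>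
  define b' where "b' = b / c"
  define r where "r = r1 - mconst b' * q1"
  have "r \<in> form3 (card I - 1)"
    using r(1) q(1) unfolding r_def s
    by (intro mp.subspace_diff[OF subspace_form3] mp.subspace_scale[OF subspace_form3]) auto
  then obtain d q' where q': "q' \<in> form3 (card I - 2)" "r = (\<Sum>n\<in>I. mconst (d n) * cofactor a I n) + lform l * q'"
    using insert.IH insert.prems by blast
  define e where "e n = (if n = k then b' else d n)" for n
  have "lform (a k) * q' \<in> form3 s \<or> s = 0"
    using form3_mult[OF lform_form3[OF uvw(1)] q'(1)] s by (cases s) auto
  have p_eq: "p = lform (a k) * r + lform l * (r2 - mconst b' * q2) + mconst b' * (\<Prod>i\<in>I. lform (a i))"
  proof -
    have "mconst b' * mconst c = mconst b"
      using q(3) by (simp add: b'_def flip: mconst_mult)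
    then have eq: "mconst b' * (mconst c * lform (a i0) ^ Suc s) = mconst b * lform (a i0) ^ Suc s"
      by (simp only: mult.assoc[symmetric])
    show ?thesis
      unfolding r(3) eq[symmetric] q(4) r_def by (simp only: algebra_simps)
  qed
  have sum: "(\<Sum>n\<in>insert k I. mconst (e n) * cofactor a (insert k I) n) =
      mconst b' * (\<Prod>i\<in>I. lform (a i)) + lform (a k) * (\<Sum>n\<in>I. mconst (d n) * cofactor a I n)"
  proof -
    have "insert k I - {k} = I"
      using insert.hyps by auto
    then have "cofactor a (insert k I) k = (\<Prod>i\<in>I. lform (a i))"
      by (simp add: cofactor_def)
    moreover have "(\<Sum>n\<in>I. mconst (e n) * cofactor a (insert k I) n) = (\<Sum>n\<in>I. lform (a k) * (mconst (d n) * cofactor a I n))"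
      using insert.hyps by (intro sum.cong) (auto simp: e_def cofactor_insert)
    ultimately show ?thesis
      using insert.hyps by (simp add: e_def sum_distrib_left)
  qed
  show ?case
  proof (cases s)
    \<comment> \<open>For a single index in \<open>I\<close> the bound \<open>card I - 2\<close> is
      truncated to 0, so \<open>lform (a k) * q'\<close> would have the wrong degree. Here
      \<open>r\<close> is a constant and the only cofactor is 1, so no multiple of \<open>l\<close>
      is needed.\<close>
    case 0
    obtain k' where I: "I = {k'}"
      using s 0 by (metis One_nat_def card_1_singletonE)
    obtain x where x: "r = mconst x"
      using form3_0E \<open>r \<in> form3 (card I - 1)\<close> s 0 by auto
    have "mconst x = (\<Sum>n\<in>I. mconst x * cofactor a I n)"
      by (simp add: I cofactor_def)
    then have p2: "p = lform (a k) * (\<Sum>n\<in>I. mconst x * cofactor a I n) + lform l * (r2 - mconst b' * q2) + mconst b' * (\<Prod>i\<in>I. lform (a i))"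
      using p_eq x by simp
    have "k' \<noteq> k"
      using I insert.hyps by auto
    then have "p = (\<Sum>n\<in>insert k I. mconst (if n = k then b' else x) * cofactor a (insert k I) n) + lform l * (r2 - mconst b' * q2)"
      unfolding p2 using insert.hyps by (simp add: I cofactor_insert) (simp add: cofactor_def insert_Diff_if algebra_simps)
    moreover have "r2 - mconst b' * q2 \<in> form3 (card (insert k I) - 2)"
      using r(2) q(2) insert.hyps s 0
      by (simp, intro mp.subspace_diff[OF subspace_form3] mp.subspace_scale[OF subspace_form3])
    ultimately show ?thesis
      by (intro exI[of _ "\<lambda>n. if n = k then b' else x"] bexI)
  next
    case (Suc s')
    have "p = (\<Sum>n\<in>insert k I. mconst (e n) * cofactor a (insert k I) n) + lform l * (lform (a k) * q' + (r2 - mconst b' * q2))"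
      unfolding sum p_eq q'(2) by (simp add: algebra_simps)
    moreover have "lform (a k) * q' + (r2 - mconst b' * q2) \<in> form3 (card (insert k I) - 2)"
      using r(2) q(2) insert.hyps s Suc form3_mult[OF lform_form3[OF uvw(1)] q'(1)]
      by (simp, intro mp.subspace_add[OF subspace_form3] mp.subspace_diff[OF subspace_form3] mp.subspace_scale[OF subspace_form3])
    ultimately show ?thesis
      by (intro exI[of _ e] bexI)
  qed
qed


text \<open>With at least two planes, independence makes every \<open>a i\<close> nonzero and the
  partial derivatives vanish at the origin, so the Jacobian ideal is proper.\<close>

definition cone_arrangement :: "('i \<Rightarrow> complex ^ 4) \<Rightarrow> 'i set \<Rightarrow> bool"
  where "cone_arrangement a I \<longleftrightarrow> finite I \<and> card I \<ge> 2 \<and> (\<forall>i\<in>I. a i \<in> hyper0) \<and>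
    (\<forall>i\<in>I. \<forall>j\<in>I. i \<noteq> j \<longrightarrow> indep3 (a i) (a j))"

text \<open>The covector is sought on the curve (1, s, s^2). The coefficients of each determinant as
  a polynomial in \<open>s\<close> are the coordinates of a nonzero cross product, so finitely many
  values of \<open>s\<close> are excluded.\<close>

lemma generic_line_exists:
  assumes "finite I" "\<And>i j. i \<in> I \<Longrightarrow> j \<in> I \<Longrightarrow> i \<noteq> j \<Longrightarrow> indep3 (a i) (a j)"
  obtains l where "l \<in> hyper0" "\<And>i j. i \<in> I \<Longrightarrow> j \<in> I \<Longrightarrow> i \<noteq> j \<Longrightarrow> det3 l (a i) (a j) \<noteq> 0"
proof -
  define P where "P u v = [:yc u * zc v - zc u * yc v, zc u * xc v - xc u * zc v, xc u * yc v - yc u * xc v:]" for u v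
  define l :: "complex \<Rightarrow> complex ^ 4" where "l s = (\<chi> i. if i = 1 then 1 else if i = 2 then s else if i = 3 then s * s else (0 :: complex))" for s
  have det: "det3 (l s) u v = poly (P u v) s" for s u v
    by (simp add: det3_def l_def P_def algebra_simps)
  have "finite (\<Union>i\<in>I. \<Union>j\<in>I - {i}. {s. poly (P (a i) (a j)) s = 0})"
    using assms by (intro finite_UN_I poly_roots_finite) (auto simp: P_def indep3_def)
  then obtain s where "s \<notin> (\<Union>i\<in>I. \<Union>j\<in>I - {i}. {s. poly (P (a i) (a j)) s = 0})"
    using ex_new_if_finite infinite_UNIV_char_0 by blast
  then have "det3 (l s) (a i) (a j) \<noteq> 0" if "i \<in> I" "j \<in> I" "i \<noteq> j" for i j
    using that by (auto simp: det)
  moreover have "l s \<in> hyper0"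
    by (simp add: l_def hyper0_def)
  ultimately show ?thesis
    using that by blast
qed

context
  fixes a :: "'i \<Rightarrow> complex ^ 4" and I :: "'i set" and f :: mpoly4
  assumes cone: "cone_arrangement a I" and f: "f = (\<Prod>i\<in>I. lform (a i))"
begin

lemma cone_finite: "finite I" and cone_hyper0: "i \<in> I \<Longrightarrow> a i \<in> hyper0"
  and cone_card: "card I \<ge> 2"
  using cone by (auto simp: cone_arrangement_def)

lemma cone_nonzero:
  assumes "i \<in> I"
  shows "a i \<noteq> 0"
proof -
  have "I \<noteq> {i}"
    using cone_card by auto
  then obtain j where "j \<in> I" "j \<noteq> i"
    using assms by blast
  then show ?thesis
    using cone assms by (auto simp: cone_arrangement_def indep3_def)
qed

lemma plane_arrangement_cone: "plane_arrangement f"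
  unfolding plane_arrangement_def
proof (intro exI[of _ "(\<lambda>i. lform (a i)) ` I"] conjI)
  have not_prop: "\<nexists>c. lform (a j) = mconst c * lform (a i)" if "i \<in> I" "j \<in> I" "i \<noteq> j" for i j
  proof
    assume "\<exists>c. lform (a j) = mconst c * lform (a i)"
    then obtain c where "a j = c *s a i"
      by (auto simp: lform_eq_iff simp flip: lform_scale)
    then have "\<not> indep3 (a i) (a j)"
      by (simp add: indep3_def)
    then show False
      using cone that by (auto simp: cone_arrangement_def)
  qed
  then have inj: "inj_on (\<lambda>i. lform (a i)) I"
    by (intro inj_onI) (metis mconst_1 mult_1)
  show "finite ((\<lambda>i. lform (a i)) ` I)"
    using cone_finite by simp
  show "(\<lambda>i. lform (a i)) ` I \<noteq> {}"
    using cone_card by auto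
  have "lform (a i) \<noteq> 0" if "i \<in> I" for i
    using cone_nonzero[OF that] lform_0 lform_eq_iff by metis
  then show "\<forall>L\<in>(\<lambda>i. lform (a i)) ` I. linear_form L"
    using lform_homog by (auto simp: linear_form_def simp del: One_nat_def)
  show "pairwise (\<lambda>L L'. \<nexists>c. L' = mconst c * L) ((\<lambda>i. lform (a i)) ` I)"
    using not_prop by (auto simp: pairwise_def)
  show "f = \<Prod>((\<lambda>i. lform (a i)) ` I)"
    using inj by (simp add: f prod.reindex)
qed

lemma cone_wfree: "f \<in> wfree"
  using prod_form3[of I "\<lambda>i. lform (a i)"] lform_form3 cone_hyper0 cone_finite by (auto simp: f form3_def)

lemma cone_mpderiv: "mpderiv i f = (\<Sum>n\<in>I. mconst (a n $ i) * cofactor a I n)"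
  unfolding f cofactor_def by (rule mpderiv_prod_lform[OF cone_finite])

lemma cone_one_notin: "1 \<notin> jacobian_ideal f"
proof
  assume "1 \<in> jacobian_ideal f"
  then obtain q where q: "1 = (\<Sum>i\<in>UNIV. q i * mpderiv i f)"
    by (auto simp: jacobian_ideal_eq)
  have "meval (cofactor a I n) 0 = 0" if "n \<in> I" for n
  proof -
    have "I \<noteq> {n}"
      using cone_card by auto
    then have "I - {n} \<noteq> {}"
      using that by blast
    then show ?thesis
      using cone_finite by (auto simp: cofactor_def meval_prod)
  qed
  then have "meval (mpderiv i f) 0 = 0" for i
    by (simp add: cone_mpderiv meval_sum meval_mult)
  then have "meval (\<Sum>i\<in>UNIV. q i * mpderiv i f) 0 = 0"
    by (simp add: meval_sum meval_mult)
  then show False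
    using q by (metis meval_1 zero_neq_one)
qed

lemma lform_cofactor: "n \<in> I \<Longrightarrow> lform (a n) * cofactor a I n = f"
  using cone_finite by (simp add: f cofactor_def prod.remove)

lemma cone_euler: "(\<Sum>i\<in>UNIV. var i * mpderiv i f) = mconst (of_nat (card I)) * f"
proof -
  have "(\<Sum>i\<in>UNIV. var i * mpderiv i f) = (\<Sum>n\<in>I. \<Sum>i\<in>UNIV. mconst (a n $ i) * var i * cofactor a I n)"
    unfolding cone_mpderiv sum_distrib_left by (subst sum.swap) (simp add: mult_ac)
  also have "\<dots> = (\<Sum>n\<in>I. f)"
    by (intro sum.cong) (auto simp: lform_def simp flip: lform_cofactor sum_distrib_right)
  finally show ?thesis
    by (simp add: mconst_of_nat)
qed

lemma cone_in_jacobian_ideal: "f \<in> jacobian_ideal f"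
proof -
  have "mconst (of_nat (card I)) * f \<in> jacobian_ideal f"
    unfolding cone_euler[symmetric] by (auto simp: jacobian_ideal_eq)
  then have "mconst (inverse (of_nat (card I))) * (mconst (of_nat (card I)) * f) \<in> jacobian_ideal f"
    by (rule jacobian_ideal_mult)
  then show ?thesis
    using cone_card by (subst (asm) mconst_inverse_mult) auto
qed

text \<open>The product of two different cofactors is a multiple of \<open>f\<close>, which lies in
  the ideal by Euler's formula. For a square, a partial derivative is multiplied by the cofactor:
  all other terms are such mixed products.\<close>

lemma cofactor_mult_in_jacobian_ideal:
  assumes "n \<in> I" "m \<in> I"
  shows "cofactor a I n * cofactor a I m \<in> jacobian_ideal f"
proof -
  have neq: "cofactor a I n * cofactor a I m \<in> jacobian_ideal f" if "n \<in> I" "m \<in> I" "n \<noteq> m" for n m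
  proof -
    have "cofactor a I m = lform (a n) * (\<Prod>k\<in>I - {m} - {n}. lform (a k))"
      unfolding cofactor_def using that cone_finite by (intro prod.remove) auto
    then have "cofactor a I n * cofactor a I m = (\<Prod>k\<in>I - {m} - {n}. lform (a k)) * f"
      using lform_cofactor[OF that(1)] by (simp add: mult_ac)
    then show ?thesis
      using cone_in_jacobian_ideal jacobian_ideal_mult by simp
  qed
  have sq: "cofactor a I n * cofactor a I n \<in> jacobian_ideal f"
  proof -
    obtain i where i: "a n $ i \<noteq> 0"
      using cone_nonzero[OF assms(1)] by (auto simp: vec_eq_iff)
    have "mpderiv i f * cofactor a I n = mconst (a n $ i) * (cofactor a I n * cofactor a I n) +
        (\<Sum>m\<in>I - {n}. mconst (a m $ i) * (cofactor a I m * cofactor a I n))"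
      unfolding cone_mpderiv sum_distrib_right by (subst sum.remove[OF cone_finite assms(1)]) (simp add: mult.assoc)
    then have "mconst (a n $ i) * (cofactor a I n * cofactor a I n) = cofactor a I n * mpderiv i f -
        (\<Sum>m\<in>I - {n}. mconst (a m $ i) * (cofactor a I m * cofactor a I n))"
      by (simp add: mult.commute)
    also have "\<dots> \<in> jacobian_ideal f"
    proof (intro mp.subspace_diff[OF subspace_jacobian_ideal] mp.subspace_sum[OF subspace_jacobian_ideal])
      show "cofactor a I n * mpderiv i f \<in> jacobian_ideal f"
        by (intro jacobian_ideal_mult mpderiv_in_jacobian_ideal)
      show "mconst (a m $ i) * (cofactor a I m * cofactor a I n) \<in> jacobian_ideal f" if "m \<in> I - {n}" for m
        using that assms(1) neq[of m n] by (intro jacobian_ideal_mult[of "cofactor a I m * cofactor a I n"]) auto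
    qed
    finally have "mconst (inverse (a n $ i)) * (mconst (a n $ i) * (cofactor a I n * cofactor a I n)) \<in> jacobian_ideal f"
      by (rule jacobian_ideal_mult)
    then show ?thesis
      using i by (subst (asm) mconst_inverse_mult)
  qed
  show ?thesis
    using neq sq assms by (cases "n = m") auto
qed

lemma form3_add_span: "form3 (m + n) \<subseteq> mp.span {q * r | q r. q \<in> form3 m \<and> r \<in> form3 n}"
proof (induction m)
  case 0
  have "p = 1 * p" for p :: mpoly4
    by simp
  then show ?case
    using mconst_form3[of 1] by (force intro: mp.span_base)
next
  case (Suc m)
  have step: "var i * p \<in> mp.span {q * r | q r. q \<in> form3 (Suc m) \<and> r \<in> form3 n}"
    if "p \<in> form3 (m + n)" "i \<noteq> 4" for p i
    using subsetD[OF Suc that(1)]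
  proof (induction p rule: mp.span_induct_alt)
    case (step c x y)
    then obtain q r where qr: "x = q * r" "q \<in> form3 m" "r \<in> form3 n"
      by blast
    have "var i * q \<in> form3 (Suc m)"
      using form3_mult[OF var_form3[OF that(2)] qr(2)] by simp
    then have "var i * x \<in> mp.span {q * r | q r. q \<in> form3 (Suc m) \<and> r \<in> form3 n}"
      using qr by (intro mp.span_base) (auto simp flip: mult.assoc)
    moreover have "var i * (mconst c * x + y) = mconst c * (var i * x) + var i * y"
      by (simp add: algebra_simps)
    ultimately show ?case
      using step(2) by (simp only: mp.span_add mp.span_scale)
  qed (simp add: mp.span_zero)
  show ?case
  proof
    fix p assume "p \<in> form3 (Suc m + n)"
    then obtain q1 q2 q3 where "q1 \<in> form3 (m + n)" "q2 \<in> form3 (m + n)" "q3 \<in> form3 (m + n)"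
      "p = var 1 * q1 + var 2 * q2 + var 3 * q3"
      using form3_Suc_split[of p "m + n"] by auto
    then show "p \<in> mp.span {q * r | q r. q \<in> form3 (Suc m) \<and> r \<in> form3 n}"
      using step by (auto intro!: mp.span_add)
  qed
qed

text \<open>With d planes, forms of degree d - 1 are combinations of cofactors modulo a generic
  \<open>l\<close>, and products of two cofactors lie in the ideal. Hence every form of degree at
  least 2d - 2 lies in the ideal plus the multiples of \<open>l\<close>, so multiplication by
  \<open>l\<close> is onto in these degrees.\<close>

lemma codim3_eventually_decreasing:
  assumes "j \<ge> 2 * card I"
  shows "codim3 f (Suc j) \<le> codim3 f j"
proof -
  obtain l where l: "l \<in> hyper0" "\<And>i j. i \<in> I \<Longrightarrow> j \<in> I \<Longrightarrow> i \<noteq> j \<Longrightarrow> det3 l (a i) (a j) \<noteq> 0"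
    using generic_line_exists[of I a] cone by (auto simp: cone_arrangement_def)
  define d where "d = card I"
  obtain d' where d': "d = Suc (Suc d')"
    using cone_card by (auto simp: d_def dest!: le_Suc_ex)
  have span: "\<exists>c. \<exists>q\<in>form3 d'. p = (\<Sum>n\<in>I. mconst (c n) * cofactor a I n) + lform l * q" if "p \<in> form3 (Suc d')" for p
  proof -
    have "I \<noteq> {}" "card I - 1 = Suc d'" "card I - 2 = d'"
      using d' cone_card by (auto simp: d_def)
    then show ?thesis
      using cofactors_span[OF l(1) cone_finite, of a p] cone_hyper0 l(2) that by simp
  qed
  have prod: "\<exists>q\<in>form3 (d' + Suc d'). p1 * p2 - lform l * q \<in> jacobian_ideal f"
    if p12: "p1 \<in> form3 (Suc d')" "p2 \<in> form3 (Suc d')" for p1 p2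
  proof -
    obtain c1 q1 where 1: "q1 \<in> form3 d'" "p1 = (\<Sum>n\<in>I. mconst (c1 n) * cofactor a I n) + lform l * q1"
      using span[OF p12(1)] by blast
    obtain c2 q2 where 2: "q2 \<in> form3 d'" "p2 = (\<Sum>n\<in>I. mconst (c2 n) * cofactor a I n) + lform l * q2"
      using span[OF p12(2)] by blast
    define s1 s2 where "s1 = (\<Sum>n\<in>I. mconst (c1 n) * cofactor a I n)" and "s2 = (\<Sum>n\<in>I. mconst (c2 n) * cofactor a I n)"
    have s1: "s1 = p1 - lform l * q1"
      unfolding s1_def using 1(2) by simp
    have "s1 \<in> form3 (Suc d')"
      unfolding s1 using form3_mult[OF lform_form3[OF l(1)] 1(1)] p12(1)
      by (intro mp.subspace_diff[OF subspace_form3]) auto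
    then have "q1 * p2 + s1 * q2 \<in> form3 (d' + Suc d')"
      using form3_mult[OF 1(1) p12(2)] form3_mult[of s1 "Suc d'" q2 d'] 2(1)
      by (intro mp.subspace_add[OF subspace_form3]) (auto simp: add.commute)
    moreover have "p1 * p2 - lform l * (q1 * p2 + s1 * q2) = s1 * s2"
      using 1(2) 2(2) unfolding s1_def[symmetric] s2_def[symmetric] by (simp add: algebra_simps)
    moreover have "s1 * s2 \<in> jacobian_ideal f"
    proof -
      have "s1 * s2 = (\<Sum>n\<in>I. \<Sum>m\<in>I. (mconst (c1 n) * mconst (c2 m)) * (cofactor a I n * cofactor a I m))"
        unfolding s1_def s2_def sum_product by (simp add: mult_ac)
      moreover have "(mconst (c1 n) * mconst (c2 m)) * (cofactor a I n * cofactor a I m) \<in> jacobian_ideal f"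
        if "n \<in> I" "m \<in> I" for n m
        by (rule jacobian_ideal_mult[OF cofactor_mult_in_jacobian_ideal[OF that]])
      ultimately show ?thesis
        by (auto intro!: mp.subspace_sum[OF subspace_jacobian_ideal])
    qed
    ultimately show ?thesis
      by metis
  qed
  \<comment> \<open>\<open>Suc d'\<close> is d - 1, so \<open>e\<close> is the excess of the degree
    over 2d - 2.\<close>
  obtain e where e: "Suc j = (Suc d' + Suc d') + e"
    using assms d' by (metis d_def add_Suc_right le_Suc_ex le_SucI mult_2 add_Suc add.assoc)
  have j: "j = (d' + Suc d') + e"
    using e by simp
  show ?thesis
  proof (rule codim3_Suc_le[where l = "lform l"])
    show "lform l \<in> form3 1"
      using l(1) by (rule lform_form3)
    fix p assume p: "p \<in> form3 (Suc j)"
    let ?P = "\<lambda>p. \<exists>q\<in>form3 j. p - lform l * q \<in> jacobian_ideal f"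
    have lin: "?P (mconst c * x + y)" if xy: "?P x" "?P y" for c x y
    proof -
      obtain q r where q: "q \<in> form3 j" "x - lform l * q \<in> jacobian_ideal f"
        and r: "r \<in> form3 j" "y - lform l * r \<in> jacobian_ideal f"
        using xy by blast
      have "mconst c * x + y - lform l * (mconst c * q + r) = mconst c * (x - lform l * q) + (y - lform l * r)"
        by (simp add: algebra_simps)
      also have "\<dots> \<in> jacobian_ideal f"
        using q r by (intro jacobian_ideal_add jacobian_ideal_mult)
      finally show ?thesis
        using q(1) r(1) by (intro bexI[of _ "mconst c * q + r"] mp.subspace_add[OF subspace_form3]
          mp.subspace_scale[OF subspace_form3])
    qed
    have zero: "?P 0"
      using mp.subspace_0[OF subspace_form3] jacobian_ideal_0 by (intro bexI[of _ 0]) auto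
    have mult: "?P (x * r)" if x: "x \<in> form3 (Suc d' + Suc d')" and r: "r \<in> form3 e" for x r
    proof -
      have "x \<in> mp.span {q * r | q r. q \<in> form3 (Suc d') \<and> r \<in> form3 (Suc d')}"
        using form3_add_span x by blast
      then show ?thesis
      proof (induction x rule: mp.span_induct_alt)
        case base
        then show ?case
          using zero by simp
      next
        case (step c x y)
        then obtain p1 p2 where "p1 \<in> form3 (Suc d')" "p2 \<in> form3 (Suc d')" "x = p1 * p2"
          by blast
        then obtain q where q: "q \<in> form3 (d' + Suc d')" "x - lform l * q \<in> jacobian_ideal f"
          using prod by blast
        have "x * r - lform l * (q * r) = r * (x - lform l * q)"
          by (simp add: algebra_simps)
        also have "\<dots> \<in> jacobian_ideal f"
          using q(2) by (rule jacobian_ideal_mult)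
        finally have "?P (x * r)"
          using form3_mult[OF q(1) r] unfolding j by blast
        then show ?case
          using lin[of "x * r" "y * r" c] step by (simp add: algebra_simps)
      qed
    qed
    have "p \<in> mp.span {q * r | q r. q \<in> form3 (Suc d' + Suc d') \<and> r \<in> form3 e}"
      using form3_add_span[of "Suc d' + Suc d'" e] p unfolding e by blast
    then show "?P p"
    proof (induction p rule: mp.span_induct_alt)
      case base
      then show ?case
        by (rule zero)
    next
      case (step c x y)
      then show ?case
        using mult lin by blast
    qed
  qed
qed

lemma cone_jacobian_dim: "jacobian_dim f k = (\<Sum>j\<le>k. codim3 f j)"
  by (rule jacobian_dim_eq_sum[OF cone_wfree cone_one_notin])

lemma cone_hilbert_polynomial:
  "\<exists>k0. \<forall>k\<ge>k0. poly (hilbert_polynomial f) (of_nat k) = of_nat (jacobian_dim f k)"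
  using cone_wfree cone_one_notin codim3_eventually_decreasing by (rule hilbert_polynomial_eventually)

end

text \<open>A strict inequality in one degree survives in all later partial sums, because no other
  degree can compensate for it.\<close>

lemma hilbert_polynomial_neqI:
  assumes "cone_arrangement a I" "f = (\<Prod>i\<in>I. lform (a i))"
    and "cone_arrangement a' I'" "f' = (\<Prod>i\<in>I'. lform (a' i))"
    and le: "\<And>j. codim3 f' j \<le> codim3 f j" and less: "codim3 f' j0 < codim3 f j0"
  shows "hilbert_polynomial f \<noteq> hilbert_polynomial f'"
proof
  assume eq: "hilbert_polynomial f = hilbert_polynomial f'"
  obtain k1 k2 where k1: "\<forall>k\<ge>k1. poly (hilbert_polynomial f) (of_nat k) = of_nat (jacobian_dim f k)"
    and k2: "\<forall>k\<ge>k2. poly (hilbert_polynomial f') (of_nat k) = of_nat (jacobian_dim f' k)"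
    using cone_hilbert_polynomial[OF assms(1,2)] cone_hilbert_polynomial[OF assms(3,4)] by blast
  define k where "k = Max {k1, k2, j0}"
  have k: "k \<ge> k1" "k \<ge> k2" "k \<ge> j0"
    by (auto simp: k_def)
  have "jacobian_dim f' k < jacobian_dim f k"
    unfolding cone_jacobian_dim[OF assms(1,2)] cone_jacobian_dim[OF assms(3,4)]
    using k(3) le less by (intro sum_strict_mono_ex1) auto
  moreover have "(of_nat (jacobian_dim f k) :: rat) = of_nat (jacobian_dim f' k)"
    using k1 k2 k eq by metis
  ultimately show False
    by simp
qed

section \<open>Semicontinuity\<close>

text \<open>Independence of an indexed family: members that coincide for some parameter count as
  dependent, whereas in the image set they would merge.\<close>

definition indep_family :: "'k set \<Rightarrow> ('k \<Rightarrow> mpoly4) \<Rightarrow> bool"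
  where "indep_family K w \<longleftrightarrow> (\<forall>c. (\<Sum>k\<in>K. mconst (c k) * w k) = 0 \<longrightarrow> (\<forall>k\<in>K. c k = 0))"

lemma indep_family_iff_lookup:
  "indep_family K w \<longleftrightarrow> (\<forall>c. (\<forall>n. (\<Sum>k\<in>K. c k * lookup (w k) n) = 0) \<longrightarrow> (\<forall>k\<in>K. c k = 0))"
proof -
  have "(\<Sum>k\<in>K. mconst (c k) * w k) = 0 \<longleftrightarrow> (\<forall>n. (\<Sum>k\<in>K. c k * lookup (w k) n) = 0)" for c
    by (simp add: poly_mapping_eq_iff fun_eq_iff lookup_sum lookup_mconst_mult)
  then show ?thesis
    by (simp add: indep_family_def)
qed

lemma indep_family_independent:
  assumes "finite K" "indep_family K w"
  shows "inj_on w K" "mp.independent (w ` K)"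
proof -
  show inj: "inj_on w K"
  proof (rule inj_onI, rule ccontr)
    fix k l assume kl: "k \<in> K" "l \<in> K" "w k = w l" "k \<noteq> l"
    define c where "c m = (if m = k then 1 else if m = l then - 1 else (0 :: complex))" for m
    have "(\<Sum>m\<in>K. mconst (c m) * w m) = (\<Sum>m\<in>{k, l}. mconst (c m) * w m)"
      using kl assms(1) by (intro sum.mono_neutral_right) (auto simp: c_def)
    also have "\<dots> = 0"
      using kl by (simp add: c_def mconst_uminus)
    finally have "c k = 0"
      using assms(2) kl unfolding indep_family_def by blast
    then show False
      by (simp add: c_def)
  qed
  have "u v = 0" if u: "(\<Sum>v\<in>w ` K. mconst (u v) * v) = 0" "v \<in> w ` K" for u v
  proof -
    have "(\<Sum>k\<in>K. mconst (u (w k)) * w k) = 0"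
      using u(1) by (simp add: sum.reindex[OF inj])
    then have "\<forall>k\<in>K. u (w k) = 0"
      using assms(2)[unfolded indep_family_def, rule_format, of "\<lambda>k. u (w k)"] by blast
    then show ?thesis
      using u(2) by blast
  qed
  then show "mp.independent (w ` K)"
    using assms(1) by (auto simp: mp.dependent_finite)
qed

lemma indep_family_dim:
  assumes "finite K" "indep_family K w"
  shows "mp.dim (mp.span (w ` K)) = card K"
  using mp.dim_eq_card_independent[OF indep_family_independent(2)[OF assms]]
    card_image[OF indep_family_independent(1)[OF assms]] by simp

lemma indep_subfamily_exists:
  assumes "finite K"
  obtains L where "L \<subseteq> K" "indep_family L w" "card L = mp.dim (mp.span (w ` K))"
proof -
  obtain B where B: "B \<subseteq> w ` K" "mp.independent B" "w ` K \<subseteq> mp.span B" "card B = mp.dim (w ` K)"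
    by (rule mp.basis_exists)
  obtain L where L: "L \<subseteq> K" "inj_on w L" "B = w ` L"
    using B(1) by (auto simp: subset_image_inj)
  have finL: "finite L"
    using L(1) assms finite_subset by blast
  have "indep_family L w"
    unfolding indep_family_def
  proof (intro allI impI ballI)
    fix c k assume c: "(\<Sum>k\<in>L. mconst (c k) * w k) = 0" and k: "k \<in> L"
    have "(\<Sum>v\<in>w ` L. mconst (c (the_inv_into L w v)) * v) = 0"
      using c by (simp add: sum.reindex[OF L(2)] the_inv_into_f_f[OF L(2)] cong: sum.cong)
    moreover have "w k \<in> w ` L" "finite (w ` L)"
      using k finL by auto
    ultimately have "c (the_inv_into L w (w k)) = 0"
      using B(2) mp.independentD[of B B "\<lambda>v. c (the_inv_into L w v)" "w k"] L(3) by blast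
    then show "c k = 0"
      using the_inv_into_f_f[OF L(2) k] by simp
  qed
  moreover have "card L = mp.dim (mp.span (w ` K))"
    using card_image[OF L(2)] B(4) L(3) by simp
  ultimately show ?thesis
    using L(1) that by blast
qed

lemma dim_ge_indep_subfamily:
  assumes "finite K" "L \<subseteq> K" "indep_family L w"
  shows "card L \<le> mp.dim (mp.span (w ` K))"
proof -
  obtain B where B: "B \<subseteq> w ` K" "mp.independent B" "w ` K \<subseteq> mp.span B" "card B = mp.dim (w ` K)"
    by (rule mp.basis_exists)
  have finL: "finite L"
    using assms finite_subset by blast
  have "finite B"
    using B(1) assms(1) finite_subset by blast
  then have "card (w ` L) \<le> card B"
    using mp.independent_span_bound[OF _ indep_family_independent(2)[OF finL assms(3)], of B] assms(2) B(3) by blast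
  then show ?thesis
    using B(4) card_image[OF indep_family_independent(1)[OF finL assms(3)]] by simp
qed

lemma dim_less_card:
  assumes "finite K" "\<not> indep_family K w"
  shows "mp.dim (mp.span (w ` K)) < card K"
proof -
  obtain L where L: "L \<subseteq> K" "indep_family L w" "card L = mp.dim (mp.span (w ` K))"
    by (rule indep_subfamily_exists[OF assms(1)])
  then have "L \<subset> K"
    using assms(2) by blast
  then show ?thesis
    using L(3) psubset_card_mono[OF assms(1), of L] by (simp del: mp.dim_span)
qed

text \<open>One step of Gaussian elimination clears the coordinate \<open>j\<close> with the pivot \<open>p\<close>, without
  dividing by it.\<close>

lemma indep_polynomial_family_cofinite:
  fixes v :: "'k \<Rightarrow> 'n \<Rightarrow> complex poly"
  assumes "finite K"
    and "\<And>c. (\<And>n. (\<Sum>k\<in>K. c k * poly (v k n) t0) = 0) \<Longrightarrow> \<forall>k\<in>K. c k = 0"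
  shows "finite {t. \<not> (\<forall>c. (\<forall>n. (\<Sum>k\<in>K. c k * poly (v k n) t) = 0) \<longrightarrow> (\<forall>k\<in>K. c k = 0))}"
  using assms
proof (induction K arbitrary: v rule: finite_induct)
  case (insert k K)
  have "\<exists>j. poly (v k j) t0 \<noteq> 0"
  proof (rule ccontr)
    assume "\<not> ?thesis"
    then have "(\<Sum>i\<in>insert k K. (if i = k then 1 else 0) * poly (v i n) t0) = 0" for n
      by (intro sum.neutral) auto
    from insert.prems[OF this] show False
      by simp
  qed
  then obtain j where j: "poly (v k j) t0 \<noteq> 0"
    by blast
  define p where "p = v k j"
  define v' where "v' i n = p * v i n - v i j * v k n" for i n
  have indep': "\<forall>i\<in>K. c i = 0" if c: "\<And>n. (\<Sum>i\<in>K. c i * poly (v' i n) t0) = 0" for c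
  proof -
    \<comment> \<open>A relation between the eliminated rows lifts to the original ones: its
      coefficients are multiplied by the pivot, and the coefficient of the pivot row is chosen to
      compensate.\<close>
    define c' where "c' i = (if i = k then - (\<Sum>i\<in>K. c i * poly (v i j) t0) else c i * poly p t0)" for i
    have "(\<Sum>i\<in>insert k K. c' i * poly (v i n) t0) = 0" for n
    proof -
      have "(\<Sum>i\<in>K. c' i * poly (v i n) t0) = (\<Sum>i\<in>K. c i * poly p t0 * poly (v i n) t0)"
        using insert.hyps by (intro sum.cong) (auto simp: c'_def)
      then have "(\<Sum>i\<in>insert k K. c' i * poly (v i n) t0) =
          (\<Sum>i\<in>K. c i * poly p t0 * poly (v i n) t0) - (\<Sum>i\<in>K. c i * poly (v i j) t0) * poly (v k n) t0"
        using insert.hyps by (simp add: c'_def)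
      also have "\<dots> = (\<Sum>i\<in>K. c i * poly (v' i n) t0)"
        by (simp add: v'_def sum_distrib_left sum_distrib_right sum_subtractf algebra_simps)
      finally show ?thesis
        using c by simp
    qed
    from insert.prems[OF this] have "\<forall>i\<in>K. c' i = 0"
      by simp
    then show ?thesis
      using insert.hyps j by (auto simp: c'_def p_def split: if_splits)
  qed
  let ?E = "{t. \<not> (\<forall>c. (\<forall>n. (\<Sum>i\<in>K. c i * poly (v' i n) t) = 0) \<longrightarrow> (\<forall>i\<in>K. c i = 0))}"
  have "p \<noteq> 0"
    using j by (auto simp: p_def)
  then have "finite (?E \<union> {t. poly p t = 0})"
    using insert.IH[of v', OF indep'] poly_roots_finite by blast
  moreover have "\<forall>i\<in>insert k K. c i = 0"
    if t: "t \<notin> ?E" "poly p t \<noteq> 0" and c: "\<forall>n. (\<Sum>i\<in>insert k K. c i * poly (v i n) t) = 0" for c t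
  proof -
    have eq: "(\<Sum>i\<in>K. c i * poly (v i n) t) = - (c k * poly (v k n) t)" for n
      using c insert.hyps by (simp add: eq_neg_iff_add_eq_0 add.commute)
    have "(\<Sum>i\<in>K. c i * poly (v' i n) t) =
        poly p t * (\<Sum>i\<in>K. c i * poly (v i n) t) - (\<Sum>i\<in>K. c i * poly (v i j) t) * poly (v k n) t" for n
      by (simp add: v'_def sum_distrib_left sum_distrib_right sum_subtractf algebra_simps)
    then have "(\<Sum>i\<in>K. c i * poly (v' i n) t) = 0" for n
      unfolding eq by (simp add: p_def)
    then have 0: "\<forall>i\<in>K. c i = 0"
      using t(1) by blast
    then have "c k * poly p t = 0"
      using eq[of j] by (simp add: p_def)
    then show ?thesis
      using 0 t(2) by simp
  qed
  ultimately show ?case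
    by (elim finite_subset[rotated]) blast
qed simp

text \<open>A maximal independent subfamily at \<open>t0\<close> stays independent for all but
  finitely many parameters, and its size bounds the dimension from below.\<close>

lemma dim_semicontinuous:
  fixes w :: "complex \<Rightarrow> 'k \<Rightarrow> mpoly4"
  assumes "finite K" and poly: "\<And>k n. \<exists>q. \<forall>t. lookup (w t k) n = poly q t"
  shows "finite {t. mp.dim (mp.span (w t ` K)) < mp.dim (mp.span (w t0 ` K))}"
proof -
  obtain v where v: "\<And>k n t. lookup (w t k) n = poly (v k n) t"
    using poly by metis
  obtain L where L: "L \<subseteq> K" "indep_family L (w t0)" "card L = mp.dim (mp.span (w t0 ` K))"
    by (rule indep_subfamily_exists[OF assms(1)])
  have "finite L"
    using L(1) assms(1) finite_subset by blast
  moreover have "\<forall>k\<in>L. c k = 0" if "\<And>n. (\<Sum>k\<in>L. c k * poly (v k n) t0) = 0" for c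
    using L(2) that unfolding indep_family_iff_lookup v by blast
  ultimately have "finite {t. \<not> indep_family L (w t)}"
    unfolding indep_family_iff_lookup v by (rule indep_polynomial_family_cofinite)
  moreover have "indep_family L (w t) \<Longrightarrow> mp.dim (mp.span (w t0 ` K)) \<le> mp.dim (mp.span (w t ` K))" for t
    using dim_ge_indep_subfamily[OF assms(1) L(1)] L(3) by metis
  ultimately show ?thesis
    by (elim finite_subset[rotated]) (use leD in blast)
qed

section \<open>The Jacobian ideal in one degree, as the span of an explicit family\<close>

definition monomials3 :: "nat \<Rightarrow> (4 \<Rightarrow>\<^sub>0 nat) set"
  where "monomials3 s = {m. (\<Sum>i\<in>UNIV. lookup m i) = s \<and> lookup m 4 = 0}"

lemma finite_monomials3: "finite (monomials3 s)"
  unfolding monomials3_def by (rule finite_subset[OF _ finite_monomials[of s]]) auto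

lemma keys_form3: "p \<in> form3 s \<longleftrightarrow> keys p \<subseteq> monomials3 s"
  by (auto simp: form3_def homog_def wfree_def monomials3_def)

lemma form3_eq_sum:
  assumes "p \<in> form3 s"
  shows "p = (\<Sum>m\<in>monomials3 s. mconst (lookup p m) * single m 1)"
proof -
  have "(\<Sum>m\<in>keys p. single m (lookup p m)) = (\<Sum>m\<in>monomials3 s. single m (lookup p m))"
    using assms by (intro sum.mono_neutral_left finite_monomials3) (auto simp: keys_form3 in_keys_iff)
  then show ?thesis
    by (simp add: sum_single_keys flip: single_eq_mconst)
qed

lemma mpderiv_form3:
  assumes "f \<in> form3 (Suc d)"
  shows "mpderiv i f \<in> form3 d"
  unfolding mpderiv_def
proof (intro mp.subspace_sum[OF subspace_form3])
  fix m assume m: "m \<in> keys f"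
  show "single (m - single i 1) (of_nat (lookup m i) * lookup f m) \<in> form3 d"
  proof (cases "lookup m i = 0")
    case True
    then show ?thesis
      by (simp add: mp.subspace_0[OF subspace_form3])
  next
    case False
    have m_eq: "m = (m - single i 1) + single i 1"
      using False by (intro poly_mapping_eqI) (auto simp: lookup_add lookup_minus lookup_single when_def)
    have "m \<in> monomials3 (Suc d)"
      using m assms by (auto simp: keys_form3)
    then have "m - single i 1 \<in> monomials3 d"
      unfolding monomials3_def
      by (subst (asm) m_eq) (simp add: lookup_add sum.distrib sum_lookup_single)
    then show ?thesis
      by (simp add: keys_form3)
  qed
qed

lemma mpderiv_4_wfree: "f \<in> wfree \<Longrightarrow> mpderiv 4 f = 0"
  unfolding mpderiv_def wfree_def by (intro sum.neutral) simp

lemma sum_UNIV_123: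
  assumes "h 4 = 0"
  shows "(\<Sum>i\<in>UNIV. h i) = (\<Sum>i\<in>{1, 2, 3 :: 4}. h i)"
  using assms by (simp add: sum_4 add.assoc)

lemma restrict_mult_form3:
  assumes "h \<in> form3 d"
  shows "restrict_keys (\<lambda>m. m \<in> monomials3 (d + s)) (q * h) = restrict_keys (\<lambda>m. m \<in> monomials3 s) q * h"
proof (rule restrict_keys_mult)
  fix m n assume "n \<in> keys h"
  then have "n \<in> monomials3 d"
    using assms by (auto simp: keys_form3)
  then show "m + n \<in> monomials3 (d + s) \<longleftrightarrow> m \<in> monomials3 s"
    by (auto simp: monomials3_def lookup_add sum.distrib)
qed

lemma restrict_monomials3_in: "restrict_keys (\<lambda>m. m \<in> monomials3 s) q \<in> form3 s"
  by (auto simp: keys_form3 keys_restrict_keys)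

definition jac_gen :: "mpoly4 \<Rightarrow> (4 \<Rightarrow>\<^sub>0 nat) \<times> 4 \<Rightarrow> mpoly4"
  where "jac_gen f k = single (fst k) 1 * mpderiv (snd k) f"

text \<open>In a combination of the partial derivatives the coefficients may be replaced by their
  ternary components of degree \<open>s\<close>, as the derivatives are ternary of degree
  \<open>d\<close>; the derivative by w is zero. The index set is then independent of
  \<open>f\<close>, as semicontinuity requires.\<close>

lemma jacobian_form3_eq_span:
  assumes f: "f \<in> form3 (Suc d)"
  shows "jacobian_ideal f \<inter> form3 (d + s) = mp.span (jac_gen f ` (monomials3 s \<times> {1, 2, 3}))"
proof
  show "mp.span (jac_gen f ` (monomials3 s \<times> {1, 2, 3})) \<subseteq> jacobian_ideal f \<inter> form3 (d + s)"
  proof (intro mp.span_minimal mp.subspace_inter subspace_jacobian_ideal subspace_form3 image_subsetI)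
    fix k assume "k \<in> monomials3 s \<times> {1, 2, 3 :: 4}"
    then have "single (fst k) 1 \<in> form3 s"
      by (auto simp: keys_form3)
    then show "jac_gen f k \<in> jacobian_ideal f \<inter> form3 (d + s)"
      using form3_mult[OF _ mpderiv_form3[OF f], of "single (fst k) 1" s] mpderiv_in_jacobian_ideal
      by (auto simp: jac_gen_def add.commute intro: jacobian_ideal_mult)
  qed
  show "jacobian_ideal f \<inter> form3 (d + s) \<subseteq> mp.span (jac_gen f ` (monomials3 s \<times> {1, 2, 3}))"
  proof
    fix p assume p: "p \<in> jacobian_ideal f \<inter> form3 (d + s)"
    then obtain q where q: "p = (\<Sum>i\<in>UNIV. q i * mpderiv i f)"
      by (auto simp: jacobian_ideal_eq)
    have "restrict_keys (\<lambda>m. m \<in> monomials3 (d + s)) p = p"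
      using p by (intro restrict_keys_id) (auto simp: keys_form3)
    then have "p = (\<Sum>i\<in>UNIV. restrict_keys (\<lambda>m. m \<in> monomials3 s) (q i) * mpderiv i f)"
      by (metis (no_types, lifting) q restrict_keys_sum restrict_mult_form3[OF mpderiv_form3[OF f]] sum.cong)
    also have "\<dots> = (\<Sum>i\<in>{1, 2, 3}. restrict_keys (\<lambda>m. m \<in> monomials3 s) (q i) * mpderiv i f)"
      using f by (intro sum_UNIV_123) (simp add: mpderiv_4_wfree form3_def)
    also have "\<dots> \<in> mp.span (jac_gen f ` (monomials3 s \<times> {1, 2, 3}))"
    proof (intro mp.span_sum)
      fix i :: 4 assume i: "i \<in> {1, 2, 3}"
      define r where "r = restrict_keys (\<lambda>m. m \<in> monomials3 s) (q i)"
      have "r = (\<Sum>m\<in>monomials3 s. mconst (lookup r m) * single m 1)"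
        unfolding r_def by (rule form3_eq_sum[OF restrict_monomials3_in])
      then have "r * mpderiv i f = (\<Sum>m\<in>monomials3 s. mconst (lookup r m) * single m 1) * mpderiv i f"
        by (rule arg_cong)
      also have "\<dots> = (\<Sum>m\<in>monomials3 s. mconst (lookup r m) * jac_gen f (m, i))"
        by (simp add: jac_gen_def sum_distrib_right mult.assoc)
      also have "\<dots> \<in> mp.span (jac_gen f ` (monomials3 s \<times> {1, 2, 3}))"
        using i by (intro mp.span_sum mp.span_scale mp.span_base) auto
      finally show "restrict_keys (\<lambda>m. m \<in> monomials3 s) (q i) * mpderiv i f \<in> mp.span (jac_gen f ` (monomials3 s \<times> {1, 2, 3}))"
        unfolding r_def .
    qed
    finally show "p \<in> mp.span (jac_gen f ` (monomials3 s \<times> {1, 2, 3}))" .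
  qed
qed

lemma jacobian_form3_low_degree:
  assumes f: "f \<in> form3 (Suc d)" and "j < d"
  shows "jacobian_ideal f \<inter> form3 j \<subseteq> {0}"
proof
  fix p assume p: "p \<in> jacobian_ideal f \<inter> form3 j"
  then obtain q where q: "p = (\<Sum>i\<in>UNIV. q i * mpderiv i f)"
    by (auto simp: jacobian_ideal_eq)
  have "restrict_keys (\<lambda>m. m \<in> monomials3 j) (q i * mpderiv i f) = 0" for i
  proof -
    have "restrict_keys (\<lambda>m. m \<in> monomials3 j) (q i * mpderiv i f) = restrict_keys (\<lambda>_. False) (q i) * mpderiv i f"
    proof (rule restrict_keys_mult)
      fix m n assume "n \<in> keys (mpderiv i f)"
      then have "n \<in> monomials3 d"
        using mpderiv_form3[OF f] by (auto simp: keys_form3)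
      then show "m + n \<in> monomials3 j \<longleftrightarrow> False"
        using assms(2) by (auto simp: monomials3_def lookup_add sum.distrib)
    qed
    also have "restrict_keys (\<lambda>_. False) (q i) = 0"
      by (simp add: restrict_keys_def)
    finally show ?thesis
      by simp
  qed
  then have "restrict_keys (\<lambda>m. m \<in> monomials3 j) p = 0"
    by (simp add: q restrict_keys_sum)
  moreover have "restrict_keys (\<lambda>m. m \<in> monomials3 j) p = p"
    using p by (intro restrict_keys_id) (auto simp: keys_form3)
  ultimately show "p \<in> {0}"
    by simp
qed

text \<open>Collecting the coefficients of a linear relation by derivative turns it into a syzygy
  with coefficients of degree \<open>s\<close>.\<close>

lemma indep_family_jac_gen_iff:
  assumes "f \<in> wfree"
  shows "indep_family (monomials3 s \<times> {1, 2, 3}) (jac_gen f) \<longleftrightarrow>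
    (\<forall>A\<in>form3 s. \<forall>B\<in>form3 s. \<forall>C\<in>form3 s.
      A * mpderiv 1 f + B * mpderiv 2 f + C * mpderiv 3 f = 0 \<longrightarrow> A = 0 \<and> B = 0 \<and> C = 0)"
proof -
  have sum_eq: "(\<Sum>k\<in>monomials3 s \<times> {1, 2, 3}. mconst (c k) * jac_gen f k) =
      (\<Sum>m\<in>monomials3 s. mconst (c (m, 1)) * single m 1) * mpderiv 1 f +
      (\<Sum>m\<in>monomials3 s. mconst (c (m, 2)) * single m 1) * mpderiv 2 f +
      (\<Sum>m\<in>monomials3 s. mconst (c (m, 3)) * single m 1) * mpderiv 3 f" for c
  proof -
    have "(\<Sum>k\<in>monomials3 s \<times> {1, 2, 3}. mconst (c k) * jac_gen f k) =
        (\<Sum>m\<in>monomials3 s. \<Sum>i\<in>{1, 2, 3}. mconst (c (m, i)) * jac_gen f (m, i))"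
      by (subst sum.cartesian_product) (simp add: case_prod_unfold)
    then show ?thesis
      by (simp add: jac_gen_def sum.distrib sum_distrib_right mult.assoc add.assoc)
  qed
  have sum_form3: "(\<Sum>m\<in>monomials3 s. mconst (c m) * single m 1) \<in> form3 s" for c
    by (intro mp.subspace_sum[OF subspace_form3] mp.subspace_scale[OF subspace_form3]) (simp add: keys_form3)
  have lookup_sum: "lookup (\<Sum>m\<in>monomials3 s. mconst (c m) * single m 1) n = c n" if "n \<in> monomials3 s" for c n
    using that by (simp add: lookup_sum lookup_mconst_mult lookup_single when_def sum.delta finite_monomials3 flip: single_eq_mconst)
  show ?thesis
  proof
    assume ind: "indep_family (monomials3 s \<times> {1, 2, 3}) (jac_gen f)"
    show "\<forall>A\<in>form3 s. \<forall>B\<in>form3 s. \<forall>C\<in>form3 s.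
      A * mpderiv 1 f + B * mpderiv 2 f + C * mpderiv 3 f = 0 \<longrightarrow> A = 0 \<and> B = 0 \<and> C = 0"
    proof (intro ballI impI)
      fix A B C assume ABC: "A \<in> form3 s" "B \<in> form3 s" "C \<in> form3 s"
        and 0: "A * mpderiv 1 f + B * mpderiv 2 f + C * mpderiv 3 f = 0"
      define c where "c k = lookup (if snd k = 1 then A else if snd k = 2 then B else C) (fst k)" for k :: "(4 \<Rightarrow>\<^sub>0 nat) \<times> 4"
      have "(\<Sum>k\<in>monomials3 s \<times> {1, 2, 3}. mconst (c k) * jac_gen f k) = 0"
        unfolding sum_eq using 0 form3_eq_sum[OF ABC(1)] form3_eq_sum[OF ABC(2)] form3_eq_sum[OF ABC(3)]
        by (simp add: c_def)
      then have c: "\<forall>k\<in>monomials3 s \<times> {1, 2, 3}. c k = 0"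
        using ind[unfolded indep_family_def, rule_format, of c] by blast
      have "c (m, 1) = 0" "c (m, 2) = 0" "c (m, 3) = 0" if "m \<in> monomials3 s" for m
        using c that by auto
      then have "lookup A m = 0" "lookup B m = 0" "lookup C m = 0" if "m \<in> monomials3 s" for m
        using that by (auto simp: c_def)
      then show "A = 0 \<and> B = 0 \<and> C = 0"
        using form3_eq_sum[OF ABC(1)] form3_eq_sum[OF ABC(2)] form3_eq_sum[OF ABC(3)] by simp
    qed
  next
    assume no_syz: "\<forall>A\<in>form3 s. \<forall>B\<in>form3 s. \<forall>C\<in>form3 s.
      A * mpderiv 1 f + B * mpderiv 2 f + C * mpderiv 3 f = 0 \<longrightarrow> A = 0 \<and> B = 0 \<and> C = 0"
    show "indep_family (monomials3 s \<times> {1, 2, 3}) (jac_gen f)"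
      unfolding indep_family_def
    proof (intro allI impI ballI)
      fix c and k :: "(4 \<Rightarrow>\<^sub>0 nat) \<times> 4"
      assume 0: "(\<Sum>k\<in>monomials3 s \<times> {1, 2, 3}. mconst (c k) * jac_gen f k) = 0"
        and k: "k \<in> monomials3 s \<times> {1, 2, 3}"
      have "(\<Sum>m\<in>monomials3 s. mconst (c (m, 1)) * single m 1) = 0 \<and>
        (\<Sum>m\<in>monomials3 s. mconst (c (m, 2)) * single m 1) = 0 \<and>
        (\<Sum>m\<in>monomials3 s. mconst (c (m, 3)) * single m 1) = 0"
        using no_syz[rule_format, OF sum_form3 sum_form3 sum_form3 0[unfolded sum_eq]] by blast
      moreover obtain m i where "k = (m, i)" "m \<in> monomials3 s" "i = 1 \<or> i = 2 \<or> i = 3"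
        using k by auto
      ultimately show "c k = 0"
        using lookup_sum[of m "\<lambda>m. c (m, i)"] by auto
    qed
  qed
qed

section \<open>Divisibility by linear forms\<close>

definition vanishes_on :: "complex ^ 4 \<Rightarrow> mpoly4 \<Rightarrow> bool"
  where "vanishes_on a p \<longleftrightarrow> (\<forall>v. lval a v = 0 \<longrightarrow> meval p v = 0)"

lemma meval_cong_varfree:
  fixes u v :: "complex ^ 4"
  assumes "\<forall>m\<in>keys r. lookup m i = 0" "\<And>j. j \<noteq> i \<Longrightarrow> u $ j = v $ j"
  shows "meval r u = meval r v"
proof -
  have "(\<Prod>j\<in>UNIV. (u $ j) ^ lookup m j) = (\<Prod>j\<in>UNIV. (v $ j) ^ lookup m j)" if "m \<in> keys r" for m
  proof (intro prod.cong refl)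
    fix j show "(u $ j) ^ lookup m j = (v $ j) ^ lookup m j"
      using assms that by (cases "j = i") auto
  qed
  then show ?thesis
    unfolding meval_def by (intro sum.cong) auto
qed

text \<open>Division by \<open>lform a\<close> eliminates a variable \<open>i\<close> with
  \<open>a $ i\<close> nonzero. The remainder is free of that variable and vanishes on the plane,
  hence everywhere.\<close>

lemma lform_dvd_if_vanishes:
  assumes "a \<noteq> 0" "vanishes_on a p"
  obtains q where "p = lform a * q"
proof -
  obtain i where i: "a $ i \<noteq> 0"
    using assms(1) by (auto simp: vec_eq_iff)
  define V where "V = {r :: mpoly4. \<forall>m\<in>keys r. lookup m i = 0}"
  have V: "mp.subspace V"
    unfolding V_def by (rule subspace_keys)
  have var_V: "var j * r \<in> V" if "j \<noteq> i" "r \<in> V" for j r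
    using that by (auto simp: V_def keys_var_mult lookup_add lookup_single when_def)
  have var_i: "var i = mconst (inverse (a $ i)) * lform a - (\<Sum>j\<in>UNIV - {i}. mconst (inverse (a $ i) * a $ j) * var j)"
  proof -
    have "lform a = mconst (a $ i) * var i + (\<Sum>j\<in>UNIV - {i}. mconst (a $ j) * var j)"
      unfolding lform_def by (intro sum.remove) auto
    then have "mconst (inverse (a $ i)) * lform a =
        var i + mconst (inverse (a $ i)) * (\<Sum>j\<in>UNIV - {i}. mconst (a $ j) * var j)"
      by (simp only: distrib_left mconst_inverse_mult[OF i])
    also have "mconst (inverse (a $ i)) * (\<Sum>j\<in>UNIV - {i}. mconst (a $ j) * var j) =
        (\<Sum>j\<in>UNIV - {i}. mconst (inverse (a $ i) * a $ j) * var j)"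
      unfolding sum_distrib_left mconst_mult by (simp only: mult.assoc)
    finally show ?thesis
      by simp
  qed
  have "\<exists>q. \<exists>r\<in>V. p = lform a * q + r"
  proof (induction p rule: mpoly_var_induct)
    case (mconst c)
    have "mconst c \<in> V"
      by (auto simp: V_def mconst_def)
    then show ?case
      by (intro exI[of _ 0] bexI[of _ "mconst c"]) auto
  next
    case (add p q)
    then obtain q1 r1 q2 r2 where "p = lform a * q1 + r1" "r1 \<in> V" "q = lform a * q2 + r2" "r2 \<in> V"
      by blast
    then show ?case
      using mp.subspace_add[OF V] by (intro exI[of _ "q1 + q2"] bexI[of _ "r1 + r2"]) (auto simp: algebra_simps)
  next
    case (var j p)
    then obtain q r where qr: "p = lform a * q + r" "r \<in> V"
      by blast
    show ?case
    proof (cases "j = i")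
      case False
      then show ?thesis
        using qr var_V by (intro exI[of _ "var j * q"] bexI[of _ "var j * r"]) (auto simp: algebra_simps)
    next
      case True
      define r' where "r' = - (\<Sum>j\<in>UNIV - {i}. mconst (inverse (a $ i) * a $ j) * (var j * r))"
      have "r' \<in> V"
        unfolding r'_def using qr(2) var_V
        by (intro mp.subspace_neg[OF V] mp.subspace_sum[OF V] mp.subspace_scale[OF V]) auto
      moreover have "var j * p = lform a * (var i * q + mconst (inverse (a $ i)) * r) + r'"
      proof -
        have "var i * r = lform a * (mconst (inverse (a $ i)) * r) + r'"
          by (subst var_i) (simp add: r'_def algebra_simps sum_distrib_left)
        then show ?thesis
          by (simp add: True qr(1) algebra_simps)
      qed
      ultimately show ?thesis
        by blast
    qed
  qed
  then obtain q r where qr: "p = lform a * q + r" "r \<in> V"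
    by blast
  have "meval r v = 0" for v
  proof -
    \<comment> \<open>Moves \<open>v\<close> along the axis \<open>i\<close> onto the plane, which
      does not change the value of the remainder.\<close>
    define u where "u = v - (lval a v / a $ i) *s axis i 1"
    have "lval a (axis i 1) = a $ i"
      using arg_cong[OF lform_axis, of "\<lambda>p. meval p a" i] by (simp add: lval_def mult.commute)
    then have "lval a u = 0"
      using i by (simp add: u_def lval_diff_right lval_scale_right)
    then have "meval r u = 0"
      using assms(2) qr(1) by (auto simp: vanishes_on_def meval_add meval_mult)
    moreover have "meval r u = meval r v"
      using qr(2) by (intro meval_cong_varfree[of r i]) (auto simp: V_def u_def axis_def)
    ultimately show ?thesis
      by simp
  qed
  then have "r = 0"
    by (rule mpoly_eq_0I)
  then have "p = lform a * q"
    using qr(1) by simp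
  then show ?thesis
    by (rule that)
qed

text \<open>On the plane of \<open>a\<close>, the points with nonzero \<open>b\<close> are dense: a
  point where \<open>b\<close> vanishes is approached in the direction \<open>u\<close>, and
  continuity gives the value there.\<close>

lemma vanishes_on_cancel:
  assumes van: "vanishes_on a (lform b * p)" and u: "lval a u = 0" "lval b u \<noteq> 0"
  shows "vanishes_on a p"
  unfolding vanishes_on_def
proof (intro allI impI)
  fix v assume v: "lval a v = 0"
  show "meval p v = 0"
  proof (cases "lval b v = 0")
    case False
    then show ?thesis
      using van v by (auto simp: vanishes_on_def meval_mult)
  next
    case True
    define g where "g s = meval p (v + s *s u)" for s
    have g: "g s = 0" if "s \<noteq> 0" for s
    proof -
      have "lval a (v + s *s u) = 0" "lval b (v + s *s u) \<noteq> 0"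
        using v u True that by (simp_all add: lval_add_right lval_scale_right)
      then show ?thesis
        using van by (auto simp: g_def vanishes_on_def meval_mult)
    qed
    have "continuous_on UNIV g"
      unfolding g_def vector_scalar_mult_def by (intro continuous_intros)
    then have "(g \<longlongrightarrow> g 0) (at 0)"
      by (simp add: continuous_on_def)
    moreover have "(g \<longlongrightarrow> 0) (at 0)"
      by (rule tendsto_eventually) (auto simp: eventually_at_filter g)
    ultimately have "g 0 = 0"
      using tendsto_unique[OF trivial_limit_at] by blast
    then show ?thesis
      by (simp add: g_def)
  qed
qed

lemma indep3_witness:
  assumes "indep3 a b"
  obtains u where "lval a u = 0" "lval b u = 1" "u \<in> hyper0"
proof -
  have lval3: "lval c v = xc c * xc v + yc c * yc v + zc c * zc v" if "v \<in> hyper0" for c v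
    using that by (simp add: lval_def sum_4 hyper0_def)
  consider (x) "yc a * zc b - zc a * yc b \<noteq> 0" | (y) "zc a * xc b - xc a * zc b \<noteq> 0" | (z) "xc a * yc b - yc a * xc b \<noteq> 0"
    using assms unfolding indep3_def by blast
  then show ?thesis
  proof cases
    case x
    define m where "m = yc a * zc b - zc a * yc b"
    define u :: "complex ^ 4" where "u = (\<chi> i. if i = 2 then - zc a / m else if i = 3 then yc a / m else 0)"
    have "u \<in> hyper0"
      by (simp add: hyper0_def u_def)
    moreover have "lval a u = 0" "lval b u = (yc a * zc b - zc a * yc b) / m"
      unfolding lval3[OF calculation] by (simp_all add: u_def diff_divide_distrib mult.commute)
    moreover have "(yc a * zc b - zc a * yc b) / m = 1"
      using x by (simp add: m_def)
    ultimately show ?thesis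
      using that by simp
  next
    case y
    define m where "m = zc a * xc b - xc a * zc b"
    define u :: "complex ^ 4" where "u = (\<chi> i. if i = 3 then - xc a / m else if i = 1 then zc a / m else 0)"
    have "u \<in> hyper0"
      by (simp add: hyper0_def u_def)
    moreover have "lval a u = 0" "lval b u = (zc a * xc b - xc a * zc b) / m"
      unfolding lval3[OF calculation] by (simp_all add: u_def diff_divide_distrib mult.commute)
    moreover have "(zc a * xc b - xc a * zc b) / m = 1"
      using y by (simp add: m_def)
    ultimately show ?thesis
      using that by simp
  next
    case z
    define m where "m = xc a * yc b - yc a * xc b"
    define u :: "complex ^ 4" where "u = (\<chi> i. if i = 1 then - yc a / m else if i = 2 then xc a / m else 0)"
    have "u \<in> hyper0"
      by (simp add: hyper0_def u_def)
    moreover have "lval a u = 0" "lval b u = (xc a * yc b - yc a * xc b) / m"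
      unfolding lval3[OF calculation] by (simp_all add: u_def diff_divide_distrib mult.commute)
    moreover have "(xc a * yc b - yc a * xc b) / m = 1"
      using z by (simp add: m_def)
    ultimately show ?thesis
      using that by simp
  qed
qed

lemma vanishes_on_cancel_prod:
  assumes "finite J" "\<And>n. n \<in> J \<Longrightarrow> indep3 a (b n)" "vanishes_on a ((\<Prod>n\<in>J. lform (b n)) * p)"
  shows "vanishes_on a p"
  using assms
proof (induction J rule: finite_induct)
  case (insert k J)
  obtain u where u: "lval a u = 0" "lval (b k) u = 1"
    using indep3_witness[OF insert.prems(1)[OF insertI1]] by blast
  have "vanishes_on a (lform (b k) * ((\<Prod>n\<in>J. lform (b n)) * p))"
    using insert.prems(2) unfolding prod.insert[OF insert.hyps] mult.assoc .
  then have "vanishes_on a ((\<Prod>n\<in>J. lform (b n)) * p)"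
    by (rule vanishes_on_cancel[OF _ u(1)]) (simp add: u(2))
  then show ?case
    using insert.IH insert.prems(1) by blast
qed simp

text \<open>Division alone does not control the quotient; its ternary component of degree
  \<open>s\<close> is also a quotient, because multiplying by a linear form shifts degrees.\<close>

lemma lform_dvd_form3:
  assumes "a \<in> hyper0" "a \<noteq> 0" "vanishes_on a p" "p \<in> form3 (Suc s)"
  obtains q where "p = lform a * q" "q \<in> form3 s"
proof -
  obtain q where q: "p = lform a * q"
    by (rule lform_dvd_if_vanishes[OF assms(2,3)])
  have "restrict_keys (\<lambda>m. m \<in> monomials3 (1 + s)) (q * lform a) = restrict_keys (\<lambda>m. m \<in> monomials3 s) q * lform a"
    by (rule restrict_mult_form3[OF lform_form3[OF assms(1)]])
  moreover have "restrict_keys (\<lambda>m. m \<in> monomials3 (1 + s)) p = p"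
    using assms(4) by (intro restrict_keys_id) (auto simp: keys_form3)
  moreover have "p = q * lform a"
    unfolding q by (rule mult.commute)
  ultimately have "p = restrict_keys (\<lambda>m. m \<in> monomials3 s) q * lform a"
    by argo
  then have "p = lform a * restrict_keys (\<lambda>m. m \<in> monomials3 s) q"
    by (simp only: mult.commute)
  then show ?thesis
    using that restrict_monomials3_in by blast
qed

lemma prod_lform_dvd_form3:
  assumes "finite J" "\<And>n. n \<in> J \<Longrightarrow> b n \<in> hyper0 \<and> b n \<noteq> 0"
    and "\<And>n m. n \<in> J \<Longrightarrow> m \<in> J \<Longrightarrow> n \<noteq> m \<Longrightarrow> indep3 (b n) (b m)"
    and "\<And>n. n \<in> J \<Longrightarrow> vanishes_on (b n) p" "p \<in> form3 (card J + s)"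
  shows "\<exists>q\<in>form3 s. p = (\<Prod>n\<in>J. lform (b n)) * q"
  using assms
proof (induction J arbitrary: s rule: finite_induct)
  case (insert k J)
  have "p \<in> form3 (card J + Suc s)"
    using insert.prems(4) insert.hyps by simp
  then obtain q where q: "q \<in> form3 (Suc s)" "p = (\<Prod>n\<in>J. lform (b n)) * q"
    using insert.IH[of "Suc s"] insert.prems by auto
  have "vanishes_on (b k) ((\<Prod>n\<in>J. lform (b n)) * q)"
    using insert.prems(3)[OF insertI1] unfolding q(2) .
  moreover have "indep3 (b k) (b n)" if "n \<in> J" for n
    using insert.prems(2)[of k n] that insert.hyps(2) by auto
  ultimately have "vanishes_on (b k) q"
    using vanishes_on_cancel_prod[OF insert.hyps(1)] by blast
  then obtain r where "q = lform (b k) * r" "r \<in> form3 s"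
    using lform_dvd_form3[of "b k" q s] insert.prems(1)[OF insertI1] q(1) by blast
  then show ?case
    unfolding prod.insert[OF insert.hyps] q(2) by (intro bexI[of _ r]) (simp_all only: mult_ac)
qed simp

section \<open>Explicit computations for the syzygies of degree 5\<close>

lemma cubic_syzygy_linear_system:
  fixes p0 p1 p2 p3 p4 p5 p6 p7 p8 p9 q0 q1 q2 q3 q4 q5 q6 q7 q8 q9 r0 r1 r2 r3 r4 r5 r6 r7 r8 r9 :: complex
  assumes eqs: "2 * q0 = 0"
    "2 * r0 = 0"
    "2 * q1 = 0"
    "q0 + 2 * q2 + 9 * r0 + 2 * r1 = 0"
    "2 * r2 = 0"
    "15 * p0 + 2 * q3 = 0"
    "- 23 * p0 + q1 + 2 * q4 + 4 * r0 + 9 * r1 + 2 * r3 = 0"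
    "9 * p0 - 2 * q0 + q2 + 2 * q5 + 9 * r2 + 2 * r4 = 0"
    "- p0 + 2 * r5 = 0"
    "15 * p1 + 2 * q6 = 0"
    "- 23 * p1 + 15 * p2 + q3 + 2 * q7 - 15 * r0 + 4 * r1 + 9 * r3 + 2 * r6 = 0"
    "9 * p1 - 23 * p2 - 2 * q1 + q4 + 2 * q8 + 4 * r2 + 9 * r4 + 2 * r7 = 0"
    "- p1 + 9 * p2 - q0 - 2 * q2 + q5 + 2 * q9 + 9 * r5 + 2 * r8 = 0"
    "- p2 + 2 * r9 = 0"
    "15 * p3 = 0"
    "- 23 * p3 + 15 * p4 + q6 - 15 * r1 + 4 * r3 + 9 * r6 = 0"
    "9 * p3 - 23 * p4 + 15 * p5 - 2 * q3 + q7 - 15 * r2 + 4 * r4 + 9 * r7 = 0"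
    "- p3 + 9 * p4 - 23 * p5 - q1 - 2 * q4 + q8 + 4 * r5 + 9 * r8 = 0"
    "- p4 + 9 * p5 - q2 - 2 * q5 + q9 + 9 * r9 = 0"
    "- p5 = 0"
    "15 * p6 = 0"
    "- 23 * p6 + 15 * p7 - 15 * r3 + 4 * r6 = 0"
    "9 * p6 - 23 * p7 + 15 * p8 - 2 * q6 - 15 * r4 + 4 * r7 = 0"
    "- p6 + 9 * p7 - 23 * p8 + 15 * p9 - q3 - 2 * q7 - 15 * r5 + 4 * r8 = 0"
    "- p7 + 9 * p8 - 23 * p9 - q4 - 2 * q8 + 4 * r9 = 0"
    "- p8 + 9 * p9 - q5 - 2 * q9 = 0"
    "- p9 = 0"
    "- 15 * r6 = 0"
    "- 15 * r7 = 0"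
    "- q6 - 15 * r8 = 0"
    "- q7 - 15 * r9 = 0"
    "- q8 = 0"
    "- q9 = 0"
  shows "p0 = 0" "p1 = 0" "p2 = 0" "p3 = 0" "p4 = 0" "p5 = 0" "p6 = 0" "p7 = 0" "p8 = 0" "p9 = 0" "q0 = 0" "q1 = 0" "q2 = 0" "q3 = 0" "q4 = 0" "q5 =
      0" "q6 = 0" "q7 = 0" "q8 = 0" "q9 = 0" "r0 = 0" "r1 = 0" "r2 = 0" "r3 = 0" "r4 = 0" "r5 = 0" "r6 = 0" "r7 = 0" "r8 = 0" "r9 = 0"
proof -
  \<comment> \<open>The unknowns that are the only term of some equation; the other equations are
    then solved for the remaining ones in turn.\<close>
  have z: "q0 = 0" "r0 = 0" "q1 = 0" "r2 = 0" "p3 = 0" "p5 = 0" "p6 = 0" "p9 = 0" "r6 = 0" "r7 = 0" "q8 = 0" "q9 = 0"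
    using eqs(1) eqs(2) eqs(3) eqs(5) eqs(15) eqs(20) eqs(21) eqs(27) eqs(28) eqs(29) eqs(32) eqs(33) by simp_all
  note eqs' = eqs[unfolded z]
  have q3: "2 * q3 = - 15 * p0"
    using eqs'(6) by Groebner_Basis.algebra
  have r5: "2 * r5 = p0"
    using eqs'(9) by Groebner_Basis.algebra
  have q6: "2 * q6 = - 15 * p1"
    using eqs'(10) by Groebner_Basis.algebra
  have r9: "2 * r9 = p2"
    using eqs'(14) by Groebner_Basis.algebra
  have r8: "2 * r8 = p1"
    using eqs'(30) q6 by Groebner_Basis.algebra
  have q7: "2 * q7 = - 15 * p2"
    using eqs'(31) r9 by Groebner_Basis.algebra
  have r1: "r1 = - q2"
    using eqs'(4) by Groebner_Basis.algebra
  have r3: "r3 = p7"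
    using eqs'(22) by Groebner_Basis.algebra
  have q5: "q5 = - p8"
    using eqs'(26) by Groebner_Basis.algebra
  have q4: "q4 = 9 * p8 - p7 + 2 * p2"
    using eqs'(25) r9 by Groebner_Basis.algebra
  have q2: "2 * q2 = 4 * p8 - 2 * p4 + 9 * p2"
    using eqs'(19) q5 r9 by Groebner_Basis.algebra
  have r4: "4 * r4 = 2 * p4 - 9 * p2 - 18 * p0"
    using eqs'(8) q2 q5 by Groebner_Basis.algebra
  have e1: "46 * p0 = 18 * p4 - 73 * p2"
    using eqs'(7) q4 r1 r3 q2 by Groebner_Basis.algebra
  have e6: "42 * p4 = - 6 * p0 - 33 * p2"
    using eqs'(17) q3 q7 r4 by Groebner_Basis.algebra
  have e4: "10 * p8 = 4 * p4 + 9 * p0"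
    using eqs'(13) q2 q5 r5 r8 by Groebner_Basis.algebra
  have p0: "34 * p0 = - 61 * p2"
    using e1 e6 by Groebner_Basis.algebra
  have p4: "34 * p4 = - 18 * p2"
    using e6 p0 by Groebner_Basis.algebra
  have p8: "340 * p8 = - 621 * p2"
    using e4 p4 p0 by Groebner_Basis.algebra
  \<comment> \<open>As \<open>p0\<close>, \<open>p4\<close> and \<open>p8\<close> are multiples of
    \<open>p2\<close>, the relations \<open>e5\<close>, \<open>e9\<close> and \<open>e7\<close> form
    a system in \<open>p1\<close>, \<open>p2\<close> and \<open>p7\<close> alone.\<close>
  have e5: "8 * p7 = 15 * p1 - 60 * p8 - 135 * p2"
    using eqs'(16) q6 r1 r3 q2 by Groebner_Basis.algebra
  have e9: "9 * p7 = 23 * p8 - 15 * p2 - 2 * p1"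
    using eqs'(24) q3 q7 r5 r8 by Groebner_Basis.algebra
  have e7: "4 * p7 = 36 * p8 - 18 * p4 + 8 * p2 - 4 * p0 - 9 * p1"
    using eqs'(18) q4 r5 r8 by Groebner_Basis.algebra
  have p2: "p2 = 0"
    using e5 e9 e7 p0 p4 p8 by Groebner_Basis.algebra
  have p17: "p1 = 0" "p7 = 0"
    using e5 e9 p2 p8 by Groebner_Basis.algebra+
  have p048: "p0 = 0" "p4 = 0" "p8 = 0"
    using p0 p4 p8 p2 by simp_all
  have w1: "q3 = 0" "r5 = 0" "q6 = 0" "r9 = 0" "r8 = 0" "q7 = 0" "q5 = 0" "r3 = 0"
    using q3[unfolded p048] r5[unfolded p048] q6[unfolded p17] r9[unfolded p2] r8[unfolded p17] q7[unfolded p2]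
      q5[unfolded p048] r3[unfolded p17] by simp_all
  have w2: "q2 = 0" "q4 = 0" "r4 = 0"
    using q2[unfolded p048 p2] q4[unfolded p048 p17 p2] r4[unfolded p048 p2] by simp_all
  have "r1 = 0"
    using r1[unfolded w2] by simp
  note w = this p2 p17 p048 w1 w2 z
  show "p0 = 0" "p1 = 0" "p2 = 0" "p3 = 0" "p4 = 0" "p5 = 0" "p6 = 0" "p7 = 0" "p8 = 0" "p9 = 0" "q0 = 0" "q1 = 0" "q2 = 0" "q3 = 0" "q4 = 0" "q5 =
      0" "q6 = 0" "q7 = 0" "q8 = 0" "q9 = 0" "r0 = 0" "r1 = 0" "r2 = 0" "r3 = 0" "r4 = 0" "r5 = 0" "r6 = 0" "r7 = 0" "r8 = 0" "r9 = 0"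
    by (rule w)+
qed

text \<open>The three explicit cubics are, for t = -1 in the chart z = 1, the products of the three
  lines through each coordinate point. Comparing the coefficients of the monomials gives 33 linear
  equations for the 30 coefficients of the unknown cubics.\<close>

lemma cubic_syzygy:
  fixes p q r :: "nat \<Rightarrow> complex"
  assumes syz: "\<And>x y. x * (15 * y^3 - 23 * y^2 + 9 * y - 1) * ((p 6 * y^3 + p 7 * y^2 + p 8 * y + p 9) +
    (p 3 * y^2 + p 4 * y + p 5) * x + (p 1 * y + p 2) * x^2 + p 0 * x^3) +
      y * (2 * x^3 + x^2 - 2 * x - 1) * ((q 6 * y^3 + q 7 * y^2 + q 8 * y + q 9) + (q 3 * y^2 + q 4 * y +
        q 5) * x + (q 1 * y + q 2) * x^2 + q 0 * x^3) +
      (2 * x^3 + 9 * x^2 * y + 4 * x * y^2 - 15 * y^3) * ((r 6 * y^3 + r 7 * y^2 + r 8 * y + r 9) + (r 3 * y^2 +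
        r 4 * y + r 5) * x + (r 1 * y + r 2) * x^2 + r 0 * x^3) = 0"
  shows "\<forall>i<10. p i = 0 \<and> q i = 0 \<and> r i = 0"
proof -
  \<comment> \<open>\<open>?P0\<close> to \<open>?P6\<close> are the coefficients of x^0 to x^6, as
    polynomials in y.\<close>
  let ?P0 = "[:0, - q 9, - q 8, - q 7 - 15 * r 9, - q 6 - 15 * r 8, - 15 * r 7, - 15 * r 6:]"
  let ?P1 = "[:- p 9, - p 8 + 9 * p 9 - q 5 - 2 * q 9, - p 7 + 9 * p 8 - 23 * p 9 - q 4 - 2 * q 8 + 4 * r 9, -
    p 6 + 9 * p 7 - 23 * p 8 + 15 * p 9 - q 3 - 2 * q 7 - 15 * r 5 + 4 * r 8, 9 * p 6 - 23 * p 7 + 15 * p 8 -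
    2 * q 6 - 15 * r 4 + 4 * r 7, - 23 * p 6 + 15 * p 7 - 15 * r 3 + 4 * r 6, 15 * p 6:]"
  let ?P2 = "[:- p 5, - p 4 + 9 * p 5 - q 2 - 2 * q 5 + q 9 + 9 * r 9, - p 3 + 9 * p 4 - 23 * p 5 - q 1 - 2 * q 4 +
    q 8 + 4 * r 5 + 9 * r 8, 9 * p 3 - 23 * p 4 + 15 * p 5 - 2 * q 3 + q 7 - 15 * r 2 + 4 * r 4 + 9 * r 7, -
    23 * p 3 + 15 * p 4 + q 6 - 15 * r 1 + 4 * r 3 + 9 * r 6, 15 * p 3:]"
  let ?P3 = "[:- p 2 + 2 * r 9, - p 1 + 9 * p 2 - q 0 - 2 * q 2 + q 5 + 2 * q 9 + 9 * r 5 + 2 * r 8, 9 * p 1 -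
    23 * p 2 - 2 * q 1 + q 4 + 2 * q 8 + 4 * r 2 + 9 * r 4 + 2 * r 7, - 23 * p 1 + 15 * p 2 + q 3 + 2 * q 7 -
    15 * r 0 + 4 * r 1 + 9 * r 3 + 2 * r 6, 15 * p 1 + 2 * q 6:]"
  let ?P4 = "[:- p 0 + 2 * r 5, 9 * p 0 - 2 * q 0 + q 2 + 2 * q 5 + 9 * r 2 + 2 * r 4, - 23 * p 0 + q 1 + 2 * q 4 +
    4 * r 0 + 9 * r 1 + 2 * r 3, 15 * p 0 + 2 * q 3:]"
  let ?P5 = "[:2 * r 2, q 0 + 2 * q 2 + 9 * r 0 + 2 * r 1, 2 * q 1:]"
  let ?P6 = "[:2 * r 0, 2 * q 0:]"
  have "poly [:poly ?P0 y, poly ?P1 y, poly ?P2 y, poly ?P3 y, poly ?P4 y, poly ?P5 y, poly ?P6 y:] x = 0" for x y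
    using syz[of x y] unfolding poly_pCons poly_0 by Groebner_Basis.algebra
  then have "[:poly ?P0 y, poly ?P1 y, poly ?P2 y, poly ?P3 y, poly ?P4 y, poly ?P5 y, poly ?P6 y:] = 0" for y
    unfolding poly_all_0_iff_0[symmetric] by blast
  then have "poly ?P0 y = 0 \<and> poly ?P1 y = 0 \<and> poly ?P2 y = 0 \<and> poly ?P3 y = 0 \<and> poly ?P4 y = 0 \<and> poly ?P5 y = 0 \<and> poly ?P6 y = 0" for y
    unfolding pCons_eq_0_iff by blast
  then have "?P0 = 0 \<and> ?P1 = 0 \<and> ?P2 = 0 \<and> ?P3 = 0 \<and> ?P4 = 0 \<and> ?P5 = 0 \<and> ?P6 = 0"
    unfolding poly_all_0_iff_0[symmetric] by blast
  note e = this[unfolded pCons_eq_0_iff]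
  have eqs: "2 * q 0 = 0"
    "2 * r 0 = 0"
    "2 * q 1 = 0"
    "q 0 + 2 * q 2 + 9 * r 0 + 2 * r 1 = 0"
    "2 * r 2 = 0"
    "15 * p 0 + 2 * q 3 = 0"
    "- 23 * p 0 + q 1 + 2 * q 4 + 4 * r 0 + 9 * r 1 + 2 * r 3 = 0"
    "9 * p 0 - 2 * q 0 + q 2 + 2 * q 5 + 9 * r 2 + 2 * r 4 = 0"
    "- p 0 + 2 * r 5 = 0"
    "15 * p 1 + 2 * q 6 = 0"
    "- 23 * p 1 + 15 * p 2 + q 3 + 2 * q 7 - 15 * r 0 + 4 * r 1 + 9 * r 3 + 2 * r 6 = 0"
    "9 * p 1 - 23 * p 2 - 2 * q 1 + q 4 + 2 * q 8 + 4 * r 2 + 9 * r 4 + 2 * r 7 = 0"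
    "- p 1 + 9 * p 2 - q 0 - 2 * q 2 + q 5 + 2 * q 9 + 9 * r 5 + 2 * r 8 = 0"
    "- p 2 + 2 * r 9 = 0"
    "15 * p 3 = 0"
    "- 23 * p 3 + 15 * p 4 + q 6 - 15 * r 1 + 4 * r 3 + 9 * r 6 = 0"
    "9 * p 3 - 23 * p 4 + 15 * p 5 - 2 * q 3 + q 7 - 15 * r 2 + 4 * r 4 + 9 * r 7 = 0"
    "- p 3 + 9 * p 4 - 23 * p 5 - q 1 - 2 * q 4 + q 8 + 4 * r 5 + 9 * r 8 = 0"
    "- p 4 + 9 * p 5 - q 2 - 2 * q 5 + q 9 + 9 * r 9 = 0"
    "- p 5 = 0"
    "15 * p 6 = 0"
    "- 23 * p 6 + 15 * p 7 - 15 * r 3 + 4 * r 6 = 0"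
    "9 * p 6 - 23 * p 7 + 15 * p 8 - 2 * q 6 - 15 * r 4 + 4 * r 7 = 0"
    "- p 6 + 9 * p 7 - 23 * p 8 + 15 * p 9 - q 3 - 2 * q 7 - 15 * r 5 + 4 * r 8 = 0"
    "- p 7 + 9 * p 8 - 23 * p 9 - q 4 - 2 * q 8 + 4 * r 9 = 0"
    "- p 8 + 9 * p 9 - q 5 - 2 * q 9 = 0"
    "- p 9 = 0"
    "- 15 * r 6 = 0"
    "- 15 * r 7 = 0"
    "- q 6 - 15 * r 8 = 0"
    "- q 7 - 15 * r 9 = 0"
    "- q 8 = 0"
    "- q 9 = 0"
    using e by blast+
  have "\<forall>i\<in>{0, 1, 2, 3, 4, 5, 6, 7, 8, 9}. p i = 0 \<and> q i = 0 \<and> r i = 0"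
    by (simp add: cubic_syzygy_linear_system[OF eqs] del: One_nat_def)
  moreover have "i \<in> {0, 1, 2, 3, 4, 5, 6, 7, 8, 9}" if "i < 10" for i :: nat
    using that by auto
  ultimately show ?thesis
    by blast
qed

text \<open>With \<open>syzygy_B\<close> and \<open>syzygy_C\<close>, the components of a derivation
  of degree 5 annihilating the special product. A quadruple holds a coefficient and the exponents of
  x, y and z.\<close>

definition syzygy_A :: "(complex \<times> nat \<times> nat \<times> nat) list"
  where "syzygy_A =
    [(27, 5, 0, 0), (129, 4, 1, 0), (- 6, 4, 0, 1), (567, 3, 2, 0), (- 415, 3, 1, 1), (20, 3, 0, 2),
    (- 165, 2, 3, 0), (- 352, 2, 2, 1), (290, 2, 1, 2), (- 89, 2, 0, 3), (- 1350, 1, 4, 0), (645, 1, 3, 1),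
    (8, 1, 2, 2), (82, 1, 1, 3), (- 24, 1, 0, 4), (- 270, 0, 3, 2), (135, 0, 2, 3)]"

definition syzygy_B :: "(complex \<times> nat \<times> nat \<times> nat) list"
  where "syzygy_B =
    [(- 54, 4, 1, 0), (- 573, 3, 2, 0), (345, 3, 1, 1), (- 54, 3, 0, 2), (- 945, 2, 3, 0), (872, 2, 2, 1),
    (- 232, 2, 1, 2), (27, 2, 0, 3), (105, 1, 4, 0), (- 235, 1, 3, 1), (74, 1, 2, 2), (10, 1, 1, 3),
    (675, 0, 5, 0), (- 1110, 0, 4, 1), (260, 0, 3, 2), (91, 0, 2, 3), (- 24, 0, 1, 4)]"

definition syzygy_C :: "(complex \<times> nat \<times> nat \<times> nat) list"
  where "syzygy_C =
    [(- 54, 4, 0, 1), (- 810, 3, 2, 0), (669, 3, 1, 1), (- 141, 3, 0, 2), (- 810, 2, 3, 0), (702, 2, 2, 1),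
    (- 235, 2, 1, 2), (65, 2, 0, 3), (- 435, 1, 3, 1), (593, 1, 2, 2), (- 250, 1, 1, 3), (46, 1, 0, 4),
    (- 1350, 0, 4, 1), (1455, 0, 3, 2), (- 127, 0, 2, 3), (- 98, 0, 1, 4), (12, 0, 0, 5)]"

lemma explicit_syzygy:
  fixes x y z A B C :: complex
  assumes "A = (\<Sum>(c, i, j, k)\<leftarrow>syzygy_A. c * (x ^ i * y ^ j * z ^ k))"
    and "B = (\<Sum>(c, i, j, k)\<leftarrow>syzygy_B. c * (x ^ i * y ^ j * z ^ k))"
    and "C = (\<Sum>(c, i, j, k)\<leftarrow>syzygy_C. c * (x ^ i * y ^ j * z ^ k))"
  obtains q0 q1 q2 q3 q4 q5 q6 q7 q8 where "B - C = (y - z) * q0"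
    "3 * B - C = (3 * y - z) * q1"
    "5 * B - C = (5 * y - z) * q2"
    "A - C = (x - z) * q3"
    "A + C = (x + z) * q4"
    "3 * A + C = (3 * x + z) * q5"
    "A - B = (x - y) * q6"
    "A + 3 * B = (x + 3 * y) * q7"
    "3 * A + 5 * B = (3 * x + 5 * y) * q8"
    "q0 + q1 + q2 + q3 + q4 + q5 + q6 + q7 + q8 = 0"
proof -
  let ?q0 = "- 54 * x^4 + 237 * x^3 * y - 87 * x^3 * z - 135 * x^2 * y^2 + 35 * x^2 * y * z + 38 * x^2 * z^2 +
    105 * x * y^3 + 305 * x * y^2 * z - 214 * x * y * z^2 + 46 * x * z^3 + 675 * y^4 + 915 * y^3 * z -
    280 * y^2 * z^2 - 62 * y * z^3 + 12 * z^4"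
  let ?q1 = "- 54 * x^4 - 303 * x^3 * y + 21 * x^3 * z - 675 * x^2 * y^2 + 413 * x^2 * y * z - 16 * x^2 * z^2 +
    105 * x * y^3 - 55 * x * y^2 * z - 142 * x * y * z^2 + 46 * x * z^3 + 675 * y^4 - 435 * y^3 * z -
    370 * y^2 * z^2 + 10 * y * z^3 + 12 * z^4"
  let ?q2 = "- 54 * x^4 - 411 * x^3 * y + 129 * x^3 * z - 783 * x^2 * y^2 + 575 * x^2 * y * z - 70 * x^2 * z^2 +
    105 * x * y^3 - 127 * x * y^2 * z - 70 * x * y * z^2 + 46 * x * z^3 + 675 * y^4 - 705 * y^3 * z -
    172 * y^2 * z^2 + 82 * y * z^3 + 12 * z^4"
  let ?q3 = "27 * x^4 + 129 * x^3 * y + 75 * x^3 * z + 1377 * x^2 * y^2 - 955 * x^2 * y * z + 236 * x^2 * z^2 +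
    645 * x * y^3 + 323 * x * y^2 * z - 430 * x * y * z^2 + 82 * x * z^3 - 1350 * y^4 + 1725 * y^3 * z -
    262 * y^2 * z^2 - 98 * y * z^3 + 12 * z^4"
  let ?q4 = "27 * x^4 + 129 * x^3 * y - 87 * x^3 * z - 243 * x^2 * y^2 + 125 * x^2 * y * z - 34 * x^2 * z^2 -
    975 * x * y^3 + 593 * x * y^2 * z - 70 * x * y * z^2 + 10 * x * z^3 - 1350 * y^4 + 1185 * y^3 * z +
    8 * y^2 * z^2 - 98 * y * z^3 + 12 * z^4"
  let ?q5 = "27 * x^4 + 129 * x^3 * y - 33 * x^3 * z + 297 * x^2 * y^2 - 235 * x^2 * y * z - 16 * x^2 * z^2 -
    435 * x * y^3 - 217 * x * y^2 * z + 290 * x * y * z^2 - 62 * x * z^3 - 1350 * y^4 + 645 * y^3 * z +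
    278 * y^2 * z^2 - 98 * y * z^3 + 12 * z^4"
  let ?q6 = "27 * x^4 + 210 * x^3 * y - 6 * x^3 * z + 1350 * x^2 * y^2 - 766 * x^2 * y * z + 74 * x^2 * z^2 +
    2130 * x * y^3 - 1990 * x * y^2 * z + 596 * x * y * z^2 - 116 * x * z^3 + 675 * y^4 - 1110 * y^3 * z +
    530 * y^2 * z^2 - 44 * y * z^3 - 24 * z^4"
  let ?q7 = "27 * x^4 - 114 * x^3 * y - 6 * x^3 * z - 810 * x^2 * y^2 + 638 * x^2 * y * z - 142 * x^2 * z^2 -
    570 * x * y^3 + 350 * x * y^2 * z + 20 * x * y * z^2 - 8 * x * z^3 + 675 * y^4 - 1110 * y^3 * z +
    170 * y^2 * z^2 + 136 * y * z^3 - 24 * z^4"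
  let ?q8 = "27 * x^4 - 6 * x^3 * y - 6 * x^3 * z - 378 * x^2 * y^2 + 170 * x^2 * y * z - 70 * x^2 * z^2 -
    1110 * x * y^3 + 818 * x * y^2 * z + 20 * x * y * z^2 - 44 * x * z^3 + 675 * y^4 - 1110 * y^3 * z +
    98 * y^2 * z^2 + 172 * y * z^3 - 24 * z^4"
  note syz = assms[unfolded syzygy_A_def syzygy_B_def syzygy_C_def list.map sum_list.Cons sum_list.Nil prod.case
    power_0 power_one_right mult_1_left mult_1_right add_0_right]
  show thesis
  proof (rule that)
    show "B - C = (y - z) * ?q0"
      unfolding syz by Groebner_Basis.algebra
    show "3 * B - C = (3 * y - z) * ?q1"
      unfolding syz by Groebner_Basis.algebra
    show "5 * B - C = (5 * y - z) * ?q2"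
      unfolding syz by Groebner_Basis.algebra
    show "A - C = (x - z) * ?q3"
      unfolding syz by Groebner_Basis.algebra
    show "A + C = (x + z) * ?q4"
      unfolding syz by Groebner_Basis.algebra
    show "3 * A + C = (3 * x + z) * ?q5"
      unfolding syz by Groebner_Basis.algebra
    show "A - B = (x - y) * ?q6"
      unfolding syz by Groebner_Basis.algebra
    show "A + 3 * B = (x + 3 * y) * ?q7"
      unfolding syz by Groebner_Basis.algebra
    show "3 * A + 5 * B = (3 * x + 5 * y) * ?q8"
      unfolding syz by Groebner_Basis.algebra
    show "?q0 + ?q1 + ?q2 + ?q3 + ?q4 + ?q5 + ?q6 + ?q7 + ?q8 = 0"
      by Groebner_Basis.algebra
  qed
qed

section \<open>The arrangements\<close>

definition vec3 :: "complex \<Rightarrow> complex \<Rightarrow> complex \<Rightarrow> complex ^ 4"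
  where "vec3 p q r = (\<chi> i. if i = 1 then p else if i = 2 then q else if i = 3 then r else 0)"

text \<open>The lines \<open>p\<^sub>ip\<^sub>j\<close> with \<open>i \<in> {1, 2, 3}\<close>, \<open>j \<in> {4, 5, 6}\<close>, where \<open>p\<^sub>1, p\<^sub>2, p\<^sub>3\<close> are the
  coordinate points, \<open>p\<^sub>4 = (1, 1, 1)\<close>, \<open>p\<^sub>5 = (1, - 1 / 3, - 1)\<close> and
  \<open>p\<^sub>6 = (1 / (3 + t), - 1 / 5, - 1)\<close>.  The six points lie on a conic if and only if \<open>t = 0\<close>.\<close>

definition lines :: "complex \<Rightarrow> nat \<Rightarrow> complex ^ 4"
  where "lines t n = [vec3 0 1 (- 1), vec3 0 3 (- 1), vec3 0 5 (- 1),
    vec3 1 0 (- 1), vec3 1 0 1, vec3 (3 + t) 0 1,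
    vec3 1 (- 1) 0, vec3 1 3 0, vec3 (3 + t) 5 0] ! n"

definition cone_poly :: "complex \<Rightarrow> mpoly4"
  where "cone_poly t = (\<Prod>n<9. lform (lines t n))"

lemma vec3_nth [simp]:
  "vec3 p q r $ 1 = p" "vec3 p q r $ 2 = q" "vec3 p q r $ 3 = r" "vec3 p q r $ 4 = 0"
  by (simp_all add: vec3_def)

lemma vec3_hyper0 [simp]: "vec3 p q r \<in> hyper0"
  by (simp add: hyper0_def)

lemma lval_vec3: "lval (vec3 p q r) v = p * xc v + q * yc v + r * zc v"
  by (simp add: lval_def sum_4)

lemma lform_vec3: "lform (vec3 p q r) = mconst p * var 1 + mconst q * var 2 + mconst r * var 3"
  by (simp add: lform_def sum_4)

lemma less_9: "{..<9} = {0, 1, 2, 3, 4, 5, 6, 7, 8 :: nat}"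
  by auto

lemma lines_simps [simp]:
  "lines t 0 = vec3 0 1 (- 1)" "lines t 1 = vec3 0 3 (- 1)" "lines t 2 = vec3 0 5 (- 1)"
  "lines t 3 = vec3 1 0 (- 1)" "lines t 4 = vec3 1 0 1" "lines t 5 = vec3 (3 + t) 0 1"
  "lines t 6 = vec3 1 (- 1) 0" "lines t 7 = vec3 1 3 0" "lines t 8 = vec3 (3 + t) 5 0"
  "lines t (Suc 0) = vec3 0 3 (- 1)"
  by (simp_all add: lines_def eval_nat_numeral)

lemma lines_hyper0: "n < 9 \<Longrightarrow> lines t n \<in> hyper0"
proof -
  assume "n < 9"
  then have "n \<in> {0, 1, 2, 3, 4, 5, 6, 7, 8}"
    by auto
  then show ?thesis
    by auto
qed

lemma indep3_vec3 [simp]: "indep3 (vec3 p q r) (vec3 p' q' r') \<longleftrightarrow>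
    q * r' \<noteq> r * q' \<or> r * p' \<noteq> p * r' \<or> p * q' \<noteq> q * p'"
  by (simp add: indep3_def)

lemma indep3_sym: "indep3 a b \<longleftrightarrow> indep3 b a"
  by (auto simp: indep3_def mult.commute)

lemma cone_arrangement_lines:
  assumes "3 + t \<noteq> 1" "3 + t \<noteq> - 1" "3 + t \<noteq> - 5" "3 * (3 + t) \<noteq> 5"
  shows "cone_arrangement (lines t) {..<9}"
proof -
  define a where "a = 3 + t"
  have ne: "a \<noteq> 1" "a \<noteq> - 1" "a \<noteq> - 5" "3 * a \<noteq> 5"
    using assms by (simp_all only: a_def not_False_eq_True)
  have a: "1 \<noteq> a" "a \<noteq> 1" "- 1 \<noteq> a" "a \<noteq> - 1" "- 5 \<noteq> a" "- a \<noteq> 5" "- a \<noteq> 1" "5 \<noteq> - a" "5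
      \<noteq> a * 3" "5 \<noteq> 3 * a"
    using ne by (auto simp: mult.commute[of a 3] minus_equation_iff[of a])
  have lt: "indep3 (lines t i) (lines t j)" if "i < j" "j < 9" for i j
  proof -
    have "j \<in> {1, 2, 3, 4, 5, 6, 7, 8}"
      using that by auto
    then consider "j = 1" | "j = 2" | "j = 3" | "j = 4" | "j = 5" | "j = 6" | "j = 7" | "j = 8"
      by blast
    then show ?thesis
    proof cases
      case 1
      then have "i \<in> {0}" using that by auto
      with 1 show ?thesis unfolding a_def[symmetric] lines_simps by auto
    next
      case 2
      then have "i \<in> {0, 1}" using that by auto
      with 2 show ?thesis by auto
    next
      case 3
      then have "i \<in> {0, 1, 2}" using that by auto
      with 3 show ?thesis by auto
    next
      case 4
      then have "i \<in> {0, 1, 2, 3}" using that by auto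
      with 4 show ?thesis by auto
    next
      case 5
      then have "i \<in> {0, 1, 2, 3, 4}" using that by auto
      with 5 a show ?thesis by (auto simp: a_def[symmetric])
    next
      case 6
      then have "i \<in> {0, 1, 2, 3, 4, 5}" using that by auto
      with 6 a show ?thesis by (auto simp: a_def[symmetric])
    next
      case 7
      then have "i \<in> {0, 1, 2, 3, 4, 5, 6}" using that by auto
      with 7 a show ?thesis by (auto simp: a_def[symmetric])
    next
      case 8
      then have "i \<in> {0, 1, 2, 3, 4, 5, 6, 7}" using that by auto
      with 8 a show ?thesis by (auto simp: a_def[symmetric])
    qed
  qed
  have "indep3 (lines t i) (lines t j)" if "i < 9" "j < 9" "i \<noteq> j" for i j
    using lt[of i j] lt[of j i] that by (auto simp: indep3_sym[of "lines t j"] linorder_neq_iff)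
  then show ?thesis
    unfolding cone_arrangement_def using lines_hyper0 by auto
qed

lemma cone_arrangement_lines_0: "cone_arrangement (lines 0) {..<9}"
  by (rule cone_arrangement_lines) simp_all

lemma cone_arrangement_lines_m1: "cone_arrangement (lines (- 1)) {..<9}"
  by (rule cone_arrangement_lines) simp_all

lemma cone_poly_form3: "cone_poly t \<in> form3 9"
  using prod_form3[of "{..<9}" "\<lambda>n. lform (lines t n)"] lform_form3 lines_hyper0 by (simp add: cone_poly_def)

lemma cone_poly_wfree: "cone_poly t \<in> wfree"
  using cone_poly_form3 by (simp add: form3_def)

subsection \<open>Polynomial dependence on the parameter\<close>

lemma cone_poly_quadratic:
  "\<exists>F0 F1 F2. \<forall>t. cone_poly t = F0 + mconst t * F1 + mconst (t ^ 2) * F2"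
proof -
  define R where "R = (\<Prod>n\<in>{0, 1, 2, 3, 4, 6, 7}. lform (lines 0 n))"
  have prod: "cone_poly t = R * (lform (lines t 5) * lform (lines t 8))" for t
  proof -
    have "(\<Prod>n\<in>{0, 1, 2, 3, 4, 6, 7}. lform (lines t n)) = R"
      unfolding R_def by simp
    moreover have "{..<9} = insert 5 (insert 8 {0, 1, 2, 3, 4, 6, 7 :: nat})"
      by auto
    ultimately show ?thesis
      by (simp add: cone_poly_def mult_ac del: lines_simps)
  qed
  have lform: "lform (lines t 5) = lform (lines 0 5) + mconst t * var 1"
    "lform (lines t 8) = lform (lines 0 8) + mconst t * var 1" for t
    by (simp_all add: lform_vec3 mconst_add algebra_simps)
  have expand: "r * ((a + c * x) * (b + c * x)) = r * (a * b) + c * (r * (x * (a + b))) + c ^ 2 * (r * x ^ 2)"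
    for r a b c x :: mpoly4
    by (simp add: algebra_simps power2_eq_square)
  have "cone_poly t = R * (lform (lines 0 5) * lform (lines 0 8)) +
      mconst t * (R * (var 1 * (lform (lines 0 5) + lform (lines 0 8)))) + mconst (t ^ 2) * (R * var 1 ^ 2)" for t
    unfolding prod[of t] lform[of t] mconst_power by (rule expand)
  then show ?thesis
    by blast
qed

lemma jac_gen_cone_poly_polynomial: "\<exists>q. \<forall>t. lookup (jac_gen (cone_poly t) k) n = poly q t"
proof -
  obtain F0 F1 F2 where F: "\<And>t. cone_poly t = F0 + mconst t * F1 + mconst (t ^ 2) * F2"
    using cone_poly_quadratic by blast
  have "lookup (jac_gen (cone_poly t) k) n =
      poly [:lookup (jac_gen F0 k) n, lookup (jac_gen F1 k) n, lookup (jac_gen F2 k) n:] t" for t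
  proof -
    have jac: "jac_gen (cone_poly t) k = jac_gen F0 k + mconst t * jac_gen F1 k + mconst (t ^ 2) * jac_gen F2 k"
      by (simp add: jac_gen_def F mpderiv_add mpderiv_mult algebra_simps)
    show ?thesis
      unfolding jac lookup_add lookup_mconst_mult by (simp add: algebra_simps power2_eq_square)
  qed
  then show ?thesis
    by blast
qed

definition jac_dim :: "complex \<Rightarrow> nat \<Rightarrow> nat"
  where "jac_dim t j = mp.dim (jacobian_ideal (cone_poly t) \<inter> form3 j)"

lemma jac_dim_eq_span:
  "jac_dim t (8 + s) = mp.dim (mp.span (jac_gen (cone_poly t) ` (monomials3 s \<times> {1, 2, 3})))"
  unfolding jac_dim_def using jacobian_form3_eq_span[of "cone_poly t" 8 s] cone_poly_form3[of t] by simp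

lemma jac_dim_semicontinuous: "finite {t. jac_dim t j < jac_dim t0 j}"
proof (cases "j < 8")
  case True
  have "jacobian_ideal (cone_poly t0) \<inter> form3 j \<subseteq> {0}"
    using jacobian_form3_low_degree[of "cone_poly t0" 8 j] cone_poly_form3[of t0] True by simp
  then have "jac_dim t0 j \<le> card ({} :: mpoly4 set)"
    unfolding jac_dim_def by (intro mp.dim_le_card) auto
  then show ?thesis
    by simp
next
  case False
  then obtain s where j: "j = 8 + s"
    using le_Suc_ex[of 8 j] by auto
  show ?thesis
    unfolding j jac_dim_eq_span
    by (rule dim_semicontinuous) (use finite_monomials3 jac_gen_cone_poly_polynomial in auto)
qed

lemma jac_dim_le: "jac_dim t j \<le> mp.dim (form3 j)"
  by (rule form3_complement[of j "cone_poly t"]) (unfold jac_dim_def, linarith)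

lemma codim3_cone_poly: "codim3 (cone_poly t) j = mp.dim (form3 j) - jac_dim t j"
  by (simp add: codim3_def jac_dim_def)

subsection \<open>The syzygy of the special arrangement\<close>

lemma sum_lessThan_9: "(\<Sum>n<9::nat. h n) = h 0 + h 1 + h 2 + h 3 + h 4 + h 5 + h 6 + h 7 + (h 8 :: 'a :: comm_monoid_add)"
  by (simp add: eval_nat_numeral lessThan_Suc ac_simps)

text \<open>A syzygy of the partial derivatives is a derivation \<open>A \<partial>\<^sub>x + B \<partial>\<^sub>y + C \<partial>\<^sub>z\<close> annihilating the
  product, and its value on the form \<open>a n\<close> is the coefficient of the \<open>n\<close>-th cofactor.\<close>

lemma mpderiv_combination:
  assumes "cone_arrangement a I" and f: "f = (\<Prod>i\<in>I. lform (a i))"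
  shows "A * mpderiv 1 f + B * mpderiv 2 f + C * mpderiv 3 f =
    (\<Sum>n\<in>I. (mconst (xc (a n)) * A + mconst (yc (a n)) * B + mconst (zc (a n)) * C) * cofactor a I n)"
  unfolding cone_mpderiv[OF assms]
  by (simp add: sum_distrib_left sum.distrib algebra_simps)

definition ternary :: "(complex \<times> nat \<times> nat \<times> nat) list \<Rightarrow> mpoly4"
  where "ternary L = (\<Sum>(c, i, j, k)\<leftarrow>L. mconst c * (var 1 ^ i * var 2 ^ j * var 3 ^ k))"

lemma ternary_Nil [simp]: "ternary [] = 0"
  by (simp add: ternary_def)

lemma ternary_Cons [simp]:
  "ternary ((c, i, j, k) # L) = mconst c * (var 1 ^ i * var 2 ^ j * var 3 ^ k) + ternary L"
  by (simp add: ternary_def)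

lemma meval_ternary: "meval (ternary L) v = (\<Sum>(c, i, j, k)\<leftarrow>L. c * (xc v ^ i * yc v ^ j * zc v ^ k))"
  by (induction L) (auto simp: meval_add meval_mult meval_power)

lemma ternary_form3:
  assumes "\<And>c i j k. (c, i, j, k) \<in> set L \<Longrightarrow> i + j + k = n"
  shows "ternary L \<in> form3 n"
  using assms
proof (induction L)
  case Nil
  then show ?case
    using mp.subspace_0[OF subspace_form3] by simp
next
  case (Cons m L)
  obtain c i j k where m: "m = (c, i, j, k)"
    by (metis surj_pair)
  have "var 1 ^ i \<in> form3 i" "var 2 ^ j \<in> form3 j" "var 3 ^ k \<in> form3 k"
    by (rule form3_power, rule var_form3, simp)+
  then have "var 1 ^ i * var 2 ^ j * var 3 ^ k \<in> form3 n"
    using form3_mult Cons.prems[of c i j k] m by fastforce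
  then have "mconst c * (var 1 ^ i * var 2 ^ j * var 3 ^ k) \<in> form3 n"
    by (rule mp.subspace_scale[OF subspace_form3])
  moreover have "ternary L \<in> form3 n"
    using Cons by auto
  ultimately show ?case
    using mp.subspace_add[OF subspace_form3] m by simp
qed

lemma special_syzygy_exists:
  "\<exists>A\<in>form3 5. \<exists>B\<in>form3 5. \<exists>C\<in>form3 5. A \<noteq> 0 \<and>
    A * mpderiv 1 (cone_poly 0) + B * mpderiv 2 (cone_poly 0) + C * mpderiv 3 (cone_poly 0) = 0"
proof -
  define A where "A = ternary syzygy_A"
  define B where "B = ternary syzygy_B"
  define C where "C = ternary syzygy_C"
  have "A \<in> form3 5" "B \<in> form3 5" "C \<in> form3 5"
    unfolding A_def B_def C_def syzygy_A_def syzygy_B_def syzygy_C_def by ((rule ternary_form3, auto)[1])+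
  \<comment> \<open>The value at (1, 0, 0) is the coefficient of x^5.\<close>
  moreover have "meval A (vec3 1 0 0) = 27"
    unfolding A_def syzygy_A_def ternary_Cons ternary_Nil meval_add meval_mult meval_power meval_mconst meval_var meval_0 by simp
  then have "A \<noteq> 0"
    by auto
  moreover have "A * mpderiv 1 (cone_poly 0) + B * mpderiv 2 (cone_poly 0) + C * mpderiv 3 (cone_poly 0) = 0"
  proof (rule mpoly_eq_0I)
    fix v
    define A' B' C' where "A' = meval A v" and "B' = meval B v" and "C' = meval C v"
    have A': "A' = (\<Sum>(c, i, j, k)\<leftarrow>syzygy_A. c * (xc v ^ i * yc v ^ j * zc v ^ k))"
      unfolding A'_def A_def by (rule meval_ternary)
    have B': "B' = (\<Sum>(c, i, j, k)\<leftarrow>syzygy_B. c * (xc v ^ i * yc v ^ j * zc v ^ k))"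
      unfolding B'_def B_def by (rule meval_ternary)
    have C': "C' = (\<Sum>(c, i, j, k)\<leftarrow>syzygy_C. c * (xc v ^ i * yc v ^ j * zc v ^ k))"
      unfolding C'_def C_def by (rule meval_ternary)
    obtain q0 q1 q2 q3 q4 q5 q6 q7 q8 where q: "B' - C' = (yc v - zc v) * q0" "3 * B' - C' = (3 * yc v - zc v) * q1" "5 * B' - C' = (5 * yc v - zc v)
        * q2" "A' - C' = (xc v - zc v) * q3" "A' + C' = (xc v + zc v) * q4" "3 * A' + C' = (3 * xc v + zc v) * q5" "A' - B' = (xc v - yc v) * q6" "A'
        + 3 * B' = (xc v + 3 * yc v) * q7" "3 * A' + 5 * B' = (3 * xc v + 5 * yc v) * q8"
      and sum: "q0 + q1 + q2 + q3 + q4 + q5 + q6 + q7 + q8 = 0"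
      by (rule explicit_syzygy[OF A' B' C'])
    define q where "q n = [q0, q1, q2, q3, q4, q5, q6, q7, q8] ! n" for n
    have q_simps: "q 0 = q0" "q 1 = q1" "q 2 = q2" "q 3 = q3" "q 4 = q4" "q 5 = q5" "q 6 = q6" "q 7 = q7" "q 8 = q8"
      by (simp_all add: q_def eval_nat_numeral)
    have \<theta>: "xc (lines 0 n) * A' + yc (lines 0 n) * B' + zc (lines 0 n) * C' = lval (lines 0 n) v * q n" if n: "n < 9" for n
    proof -
      have "n \<in> {0, 1, 2, 3, 4, 5, 6, 7, 8}"
        using n by auto
      then consider "n = 0" | "n = 1" | "n = 2" | "n = 3" | "n = 4" | "n = 5" | "n = 6" | "n = 7" | "n = 8"
        by blast
      then show ?thesis
        by cases (simp_all only: lines_simps vec3_nth lval_vec3 q_simps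
          mult_zero_left mult_1_left mult_minus1 add_0 add_0_right add_uminus_conv_diff q)
    qed
    note cone = cone_arrangement_lines_0
    have f: "cone_poly 0 = (\<Prod>n\<in>{..<9}. lform (lines 0 n))"
      by (simp only: cone_poly_def)
    have "meval (A * mpderiv 1 (cone_poly 0) + B * mpderiv 2 (cone_poly 0) + C * mpderiv 3 (cone_poly 0)) v =
        (\<Sum>n<9. (xc (lines 0 n) * A' + yc (lines 0 n) * B' + zc (lines 0 n) * C') * meval (cofactor (lines 0) {..<9} n) v)"
      unfolding mpderiv_combination[OF cone f] A'_def B'_def C'_def
      by (simp add: meval_sum meval_mult meval_add del: lines_simps)
    also have "\<dots> = (\<Sum>n<9. q n * meval (cone_poly 0) v)"
    proof (rule sum.cong)
      fix n :: nat assume n: "n \<in> {..<9}"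
      have "meval (cone_poly 0) v = lval (lines 0 n) v * meval (cofactor (lines 0) {..<9} n) v"
        unfolding lform_cofactor[OF cone f n, symmetric] by (simp add: meval_mult del: lines_simps)
      then show "(xc (lines 0 n) * A' + yc (lines 0 n) * B' + zc (lines 0 n) * C') * meval (cofactor (lines 0) {..<9} n) v =
          q n * meval (cone_poly 0) v"
        using \<theta> n by (simp add: mult_ac del: lines_simps)
    qed simp
    also have "\<dots> = (\<Sum>n<9. q n) * meval (cone_poly 0) v"
      by (simp add: sum_distrib_right)
    also have "(\<Sum>n<9. q n) = 0"
      unfolding sum_lessThan_9 q_simps by (rule sum)
    finally show "meval (A * mpderiv 1 (cone_poly 0) + B * mpderiv 2 (cone_poly 0) + C * mpderiv 3 (cone_poly 0)) v = 0"
      by simp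
  qed
  ultimately show ?thesis
    by blast
qed

subsection \<open>No syzygy of the same degree in general\<close>

text \<open>The coefficients are numbered so that z = 1 gives the expressions of
  \<open>cubic_syzygy\<close>.\<close>

definition cubic :: "(nat \<Rightarrow> complex) \<Rightarrow> complex \<Rightarrow> complex \<Rightarrow> complex \<Rightarrow> complex"
  where "cubic p x y z = (p 6 * y^3 + p 7 * y^2 * z + p 8 * y * z^2 + p 9 * z^3) +
    (p 3 * y^2 + p 4 * y * z + p 5 * z^2) * x + (p 1 * y + p 2 * z) * x^2 + p 0 * x^3"

lemma form3_3_cubic:
  assumes "p \<in> form3 3"
  shows "\<exists>c. \<forall>v. meval p v = cubic c (xc v) (yc v) (zc v)"
proof -
  have 1: "\<exists>c0 c1 c2. p = mconst c0 * var 1 + mconst c1 * var 2 + mconst c2 * var 3" if p: "p \<in> form3 1" for p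
  proof -
    obtain q1 q2 q3 where q: "q1 \<in> form3 0" "q2 \<in> form3 0" "q3 \<in> form3 0" "p = var 1 * q1 + var 2 * q2 + var 3 * q3"
      using form3_Suc_split[of p 0] p by auto
    obtain c1 c2 c3 where "q1 = mconst c1" "q2 = mconst c2" "q3 = mconst c3"
      using q(1-3) form3_0E by metis
    then show ?thesis
      using q(4) by (metis mult.commute)
  qed
  have 2: "\<exists>c :: nat \<Rightarrow> complex. \<forall>v. meval p v = c 0 * xc v ^ 2 + c 1 * xc v * yc v + c 2 * xc v * zc v +
      c 3 * yc v ^ 2 + c 4 * yc v * zc v + c 5 * zc v ^ 2" if p: "p \<in> form3 2" for p
  proof -
    obtain q1 q2 q3 where q: "q1 \<in> form3 1" "q2 \<in> form3 1" "q3 \<in> form3 1" "p = var 1 * q1 + var 2 * q2 + var 3 * q3"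
      using form3_Suc_split[of p 1] p by (auto simp: numeral_2_eq_2)
    obtain a0 a1 a2 where a: "q1 = mconst a0 * var 1 + mconst a1 * var 2 + mconst a2 * var 3"
      using 1[OF q(1)] by blast
    obtain b0 b1 b2 where b: "q2 = mconst b0 * var 1 + mconst b1 * var 2 + mconst b2 * var 3"
      using 1[OF q(2)] by blast
    obtain c0 c1 c2 where c: "q3 = mconst c0 * var 1 + mconst c1 * var 2 + mconst c2 * var 3"
      using 1[OF q(3)] by blast
    have "meval p v = a0 * xc v ^ 2 + (a1 + b0) * xc v * yc v + (a2 + c0) * xc v * zc v +
        b1 * yc v ^ 2 + (b2 + c1) * yc v * zc v + c2 * zc v ^ 2" for v
      unfolding q(4) a b c meval_add meval_mult meval_var meval_mconst by Groebner_Basis.algebra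
    then show ?thesis
      by (intro exI[of _ "\<lambda>i. [a0, a1 + b0, a2 + c0, b1, b2 + c1, c2] ! i"]) (simp add: nth_Cons')
  qed
  obtain q1 q2 q3 where q: "q1 \<in> form3 2" "q2 \<in> form3 2" "q3 \<in> form3 2" "p = var 1 * q1 + var 2 * q2 + var 3 * q3"
    using form3_Suc_split[of p 2] assms by (auto simp: numeral_3_eq_3 numeral_2_eq_2)
  obtain a b c :: "nat \<Rightarrow> complex"
    where abc: "\<And>v. meval q1 v = a 0 * xc v ^ 2 + a 1 * xc v * yc v + a 2 * xc v * zc v +
      a 3 * yc v ^ 2 + a 4 * yc v * zc v + a 5 * zc v ^ 2"
    "\<And>v. meval q2 v = b 0 * xc v ^ 2 + b 1 * xc v * yc v + b 2 * xc v * zc v +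
      b 3 * yc v ^ 2 + b 4 * yc v * zc v + b 5 * zc v ^ 2"
    "\<And>v. meval q3 v = c 0 * xc v ^ 2 + c 1 * xc v * yc v + c 2 * xc v * zc v +
      c 3 * yc v ^ 2 + c 4 * yc v * zc v + c 5 * zc v ^ 2"
    using 2[OF q(1)] 2[OF q(2)] 2[OF q(3)] by blast
  have "meval p v = (b 3 * yc v ^ 3 + (b 4 + c 3) * yc v ^ 2 * zc v + (b 5 + c 4) * yc v * zc v ^ 2 + c 5 * zc v ^ 3) +
      ((a 3 + b 1) * yc v ^ 2 + (a 4 + b 2 + c 1) * yc v * zc v + (a 5 + c 2) * zc v ^ 2) * xc v +
      ((a 1 + b 0) * yc v + (a 2 + c 0) * zc v) * xc v ^ 2 + a 0 * xc v ^ 3" for v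
    unfolding q(4) abc meval_add meval_mult meval_var by Groebner_Basis.algebra
  then show ?thesis
    by (intro exI[of _ "\<lambda>i. [a 0, a 1 + b 0, a 2 + c 0, a 3 + b 1, a 4 + b 2 + c 1, a 5 + c 2, b 3, b 4 + c 3, b 5 + c 4, c 5] ! i"])
      (simp add: cubic_def nth_Cons')
qed

lemma form3_3_eq_0:
  assumes "\<And>v. meval p v = cubic c (xc v) (yc v) (zc v)" "\<forall>i<10. c i = 0"
  shows "p = 0"
  by (rule mpoly_eq_0I) (use assms in \<open>simp add: cubic_def\<close>)

text \<open>Both (y, z) and (b, c) are orthogonal to the nonzero vector (q, r), so they are
  proportional.\<close>

lemma cross_eq_0:
  fixes q r :: "'a :: idom"
  assumes "q * y + r * z = 0" "q * b + r * c = 0" "q \<noteq> 0"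
  shows "y * c - z * b = 0"
proof -
  have "q * (y * c - z * b) = (q * y + r * z) * c - z * (q * b + r * c)"
    by (simp add: algebra_simps)
  then show ?thesis
    using assms by simp
qed

text \<open>A syzygy is a derivation annihilating \<open>f\<close>, hence maps each of the nine
  forms to a multiple of itself. Therefore each 2 x 2 minor of the rows (x, y, z) and (A, B, C) is
  divisible by the three lines through one coordinate point. The cubic quotients satisfy the
  relation of \<open>cubic_syzygy\<close> and vanish, so (A, B, C) is a multiple \<open>h\<close> of
  (x, y, z). This is \<open>h\<close> times the Euler derivation, which sends \<open>f\<close> to
  \<open>9 f\<close>, so \<open>h\<close> is zero.\<close>

lemma generic_no_syzygy:
  fixes f :: mpoly4
  defines "f \<equiv> cone_poly (- 1)"
  assumes ABC: "A \<in> form3 5" "B \<in> form3 5" "C \<in> form3 5"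
    and syz: "A * mpderiv 1 f + B * mpderiv 2 f + C * mpderiv 3 f = 0"
  shows "A = 0 \<and> B = 0 \<and> C = 0"
proof -
  define a where "a = lines (- 1)"
  note cone = cone_arrangement_lines_m1[folded a_def]
  have f: "f = (\<Prod>n\<in>{..<9}. lform (a n))"
    by (simp add: f_def cone_poly_def a_def)
  note indep = cone[unfolded cone_arrangement_def]
  define \<theta> where "\<theta> n = mconst (xc (a n)) * A + mconst (yc (a n)) * B + mconst (zc (a n)) * C" for n
  have sum: "(\<Sum>n\<in>{..<9}. \<theta> n * cofactor a {..<9} n) = 0"
    using syz unfolding mpderiv_combination[OF cone f] \<theta>_def .
  \<comment> \<open>On line \<open>n\<close> the other cofactors vanish, so the value of the
    derivation on the form times its own cofactor does too; that cofactor can be cancelled because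
    the lines are distinct.\<close>
  have van: "vanishes_on (a n) (\<theta> n)" if n: "n < 9" for n
  proof -
    have "vanishes_on (a n) ((\<Prod>m\<in>{..<9} - {n}. lform (a m)) * \<theta> n)"
      unfolding vanishes_on_def
    proof (intro allI impI)
      fix v assume v: "lval (a n) v = 0"
      have "meval (cofactor a {..<9} m) v = 0" if "m \<in> {..<9} - {n}" for m
        using n that v by (auto simp: cofactor_def meval_prod intro!: bexI[of _ n])
      then have "meval (\<Sum>m\<in>{..<9} - {n}. \<theta> m * cofactor a {..<9} m) v = 0"
        by (simp add: meval_sum meval_mult)
      moreover have "meval (\<theta> n * cofactor a {..<9} n + (\<Sum>m\<in>{..<9} - {n}. \<theta> m * cofactor a {..<9} m)) v = 0"
        using sum n by (subst (asm) sum.remove[of _ n]) simp_all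
      ultimately have "meval (\<theta> n * cofactor a {..<9} n) v = 0"
        unfolding meval_add by simp
      then show "meval ((\<Prod>m\<in>{..<9} - {n}. lform (a m)) * \<theta> n) v = 0"
        by (simp add: cofactor_def mult.commute)
    qed
    then show ?thesis
      using indep n by (intro vanishes_on_cancel_prod[of "{..<9} - {n}" "a n" a "\<theta> n"]) auto
  qed
  \<comment> \<open>The minors of the rows (x, y, z) and (A, B, C); they have degree 6, so three
    linear factors leave cubics.\<close>
  define P1 P2 P3 where "P1 = var 2 * C - var 3 * B" and "P2 = var 3 * A - var 1 * C" and "P3 = var 1 * B - var 2 * A"
  have form: "var i * D \<in> form3 6" if "D \<in> form3 5" "i \<noteq> 4" for D i
    using form3_mult[OF var_form3[OF that(2)] that(1)] by simp
  have P: "P1 \<in> form3 6" "P2 \<in> form3 6" "P3 \<in> form3 6"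
    unfolding P1_def P2_def P3_def using ABC by (auto intro!: mp.subspace_diff[OF subspace_form3] form)
  have div: "\<exists>q\<in>form3 3. p = (\<Prod>n\<in>J. lform (a n)) * q"
    if "J \<subseteq> {..<9}" "card J = 3" "p \<in> form3 6" "\<And>n. n \<in> J \<Longrightarrow> vanishes_on (a n) p" for J p
  proof (rule prod_lform_dvd_form3)
    show "finite J"
      using that(1) finite_subset by blast
    show "a n \<in> hyper0 \<and> a n \<noteq> 0" if "n \<in> J" for n
      using cone_nonzero[OF cone refl, of n] indep that \<open>J \<subseteq> {..<9}\<close> by auto
    show "indep3 (a n) (a m)" if "n \<in> J" "m \<in> J" "n \<noteq> m" for n m
      using indep that \<open>J \<subseteq> {..<9}\<close> by auto
  qed (use that in auto)
  have mv: "meval P1 v = yc v * meval C v - zc v * meval B v"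
      "meval P2 v = zc v * meval A v - xc v * meval C v"
      "meval P3 v = xc v * meval B v - yc v * meval A v" for v
    by (simp_all add: P1_def P2_def P3_def meval_diff meval_mult)
  have \<theta>v: "xc (a n) * meval A v + yc (a n) * meval B v + zc (a n) * meval C v = 0" if "n < 9" "lval (a n) v = 0" for n v
    using van[OF that(1)] that(2) by (simp add: vanishes_on_def \<theta>_def meval_add meval_mult)
  have "\<exists>q\<in>form3 3. P1 = (\<Prod>n\<in>{0, 1, 2}. lform (a n)) * q"
  proof (rule div)
    show "vanishes_on (a n) P1" if "n \<in> {0, 1, 2}" for n
      unfolding vanishes_on_def mv
    proof (intro allI impI)
      fix v assume v: "lval (a n) v = 0"
      have "n < 9"
        using that by auto
      from \<theta>v[OF this v] v that have "yc (a n) * yc v + zc (a n) * zc v = 0"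
        "yc (a n) * meval B v + zc (a n) * meval C v = 0" "yc (a n) \<noteq> 0"
        by (auto simp: a_def lval_vec3 add.commute)
      then show "yc v * meval C v - zc v * meval B v = 0"
        by (rule cross_eq_0)
    qed
  qed (use P in auto)
  then obtain U1 where U1: "U1 \<in> form3 3" "P1 = (\<Prod>n\<in>{0, 1, 2}. lform (a n)) * U1"
    by blast
  have "\<exists>q\<in>form3 3. P2 = (\<Prod>n\<in>{3, 4, 5}. lform (a n)) * q"
  proof (rule div)
    show "vanishes_on (a n) P2" if "n \<in> {3, 4, 5}" for n
      unfolding vanishes_on_def mv
    proof (intro allI impI)
      fix v assume v: "lval (a n) v = 0"
      have "n < 9"
        using that by auto
      from \<theta>v[OF this v] v that have "zc (a n) * zc v + xc (a n) * xc v = 0"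
        "zc (a n) * meval C v + xc (a n) * meval A v = 0" "zc (a n) \<noteq> 0"
        by (auto simp: a_def lval_vec3 add.commute)
      then show "zc v * meval A v - xc v * meval C v = 0"
        by (rule cross_eq_0)
    qed
  qed (use P in auto)
  then obtain U2 where U2: "U2 \<in> form3 3" "P2 = (\<Prod>n\<in>{3, 4, 5}. lform (a n)) * U2"
    by blast
  have "\<exists>q\<in>form3 3. P3 = (\<Prod>n\<in>{6, 7, 8}. lform (a n)) * q"
  proof (rule div)
    show "vanishes_on (a n) P3" if "n \<in> {6, 7, 8}" for n
      unfolding vanishes_on_def mv
    proof (intro allI impI)
      fix v assume v: "lval (a n) v = 0"
      have "n < 9"
        using that by auto
      from \<theta>v[OF this v] v that have "xc (a n) * xc v + yc (a n) * yc v = 0"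
        "xc (a n) * meval A v + yc (a n) * meval B v = 0" "xc (a n) \<noteq> 0"
        by (auto simp: a_def lval_vec3 add.commute)
      then show "xc v * meval B v - yc v * meval A v = 0"
        by (rule cross_eq_0)
    qed
  qed (use P in auto)
  then obtain U3 where U3: "U3 \<in> form3 3" "P3 = (\<Prod>n\<in>{6, 7, 8}. lform (a n)) * U3"
    by blast
  obtain p q r where pqr: "\<And>v. meval U1 v = cubic p (xc v) (yc v) (zc v)"
    "\<And>v. meval U2 v = cubic q (xc v) (yc v) (zc v)" "\<And>v. meval U3 v = cubic r (xc v) (yc v) (zc v)"
    using form3_3_cubic[OF U1(1)] form3_3_cubic[OF U2(1)] form3_3_cubic[OF U3(1)] by blast
  have "\<forall>i<10. p i = 0 \<and> q i = 0 \<and> r i = 0"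
  proof (rule cubic_syzygy)
    fix x y :: complex
    let ?v = "vec3 x y 1"
    \<comment> \<open>The minors are orthogonal to the row (x, y, z); here z = 1.\<close>
    have "x * meval P1 ?v + y * meval P2 ?v + meval P3 ?v = 0"
      unfolding mv by (simp add: algebra_simps)
    then have "x * ((y - 1) * ((3 * y - 1) * (5 * y - 1)) * cubic p x y 1) +
        y * ((x - 1) * ((x + 1) * (2 * x + 1)) * cubic q x y 1) +
        ((x - y) * ((x + 3 * y) * (2 * x + 5 * y))) * cubic r x y 1 = 0"
      unfolding U1(2) U2(2) U3(2) meval_mult pqr by (simp add: meval_mult a_def lval_vec3)
    moreover have "(y - 1) * ((3 * y - 1) * (5 * y - 1)) = 15 * y^3 - 23 * y^2 + 9 * y - 1"
      "(x - 1) * ((x + 1) * (2 * x + 1)) = 2 * x^3 + x^2 - 2 * x - 1"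
      "(x - y) * ((x + 3 * y) * (2 * x + 5 * y)) = 2 * x^3 + 9 * x^2 * y + 4 * x * y^2 - 15 * y^3"
      by (simp_all add: algebra_simps power2_eq_square power3_eq_cube)
    ultimately show "x * (15 * y^3 - 23 * y^2 + 9 * y - 1) * ((p 6 * y^3 + p 7 * y^2 + p 8 * y + p 9) + (p 3 * y^2 + p 4 * y + p 5) * x + (p 1 * y + p 2) * x^2 + p 0 * x^3) +
      y * (2 * x^3 + x^2 - 2 * x - 1) * ((q 6 * y^3 + q 7 * y^2 + q 8 * y + q 9) + (q 3 * y^2 + q 4 * y + q 5) * x + (q 1 * y + q 2) * x^2 + q 0 * x^3) +
      (2 * x^3 + 9 * x^2 * y + 4 * x * y^2 - 15 * y^3) * ((r 6 * y^3 + r 7 * y^2 + r 8 * y + r 9) + (r 3 * y^2 + r 4 * y + r 5) * x + (r 1 * y + r 2) * x^2 + r 0 * x^3) = 0"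
      by (simp only: cubic_def mult_1_right power_one mult.assoc)
  qed
  then have "U1 = 0" "U2 = 0" "U3 = 0"
    using form3_3_eq_0 pqr by blast+
  then have eqs: "var 2 * C = var 3 * B" "var 3 * A = var 1 * C" "var 1 * B = var 2 * A"
    using U1(2) U2(2) U3(2) by (simp_all add: P1_def P2_def P3_def)
  \<comment> \<open>Since y divides z B, it divides B; the quotient is the factor
    \<open>h\<close>.\<close>
  have "vanishes_on (vec3 0 1 0) B"
  proof (rule vanishes_on_cancel)
    have "lform (vec3 0 0 1) = var 3"
      by (simp add: lform_vec3)
    then have "lform (vec3 0 0 1) * B = var 2 * C"
      using eqs(1) by simp
    then show "vanishes_on (vec3 0 1 0) (lform (vec3 0 0 1) * B)"
      by (simp add: vanishes_on_def lval_vec3 meval_mult)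
    show "lval (vec3 0 1 0) (vec3 0 0 1) = 0" "lval (vec3 0 0 1) (vec3 0 0 1) \<noteq> 0"
      by (simp_all add: lval_vec3)
  qed
  moreover have "vec3 0 1 0 \<noteq> 0"
    using vec3_nth(2)[of 0 1 0] by (metis zero_index zero_neq_one)
  ultimately obtain h where "B = lform (vec3 0 1 0) * h"
    using lform_dvd_if_vanishes by blast
  then have B: "B = var 2 * h"
    by (simp add: lform_vec3)
  have "var 2 * C = var 2 * (var 3 * h)" "var 2 * A = var 2 * (var 1 * h)"
    using eqs(1) eqs(3)[symmetric] unfolding B by (simp_all add: mult_ac)
  then have A: "A = var 1 * h" and C: "C = var 3 * h"
    using mult_left_cancel[OF var_neq_0[of 2]] by blast+
  \<comment> \<open>The derivation is now \<open>h\<close> times the Euler derivation.\<close>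
  have "h * (\<Sum>i\<in>UNIV. var i * mpderiv i f) = 0"
    using syz mpderiv_4_wfree[OF cone_poly_wfree[of "- 1"]] unfolding A B C f_def
    by (simp add: sum_4 algebra_simps)
  then have "h * (mconst 9 * f) = 0"
    unfolding cone_euler[OF cone f] by simp
  moreover have "f \<noteq> 0"
  proof -
    have "lform (a n) \<noteq> 0" if "n < 9" for n
      using cone_nonzero[OF cone refl, of n] that lform_0 lform_eq_iff[of "a n" 0] by auto
    then show ?thesis
      unfolding f by simp
  qed
  ultimately have "h = 0"
    by simp
  then show ?thesis
    unfolding A B C by simp
qed

text \<open>In degree 13 = 8 + 5 the partial derivatives are multiplied by monomials of degree 5, so
  dependence of the family means a syzygy of that degree.\<close>

lemma jac_dim_special_less: "jac_dim 0 13 < jac_dim (- 1) 13"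
proof -
  let ?K = "monomials3 5 \<times> {1, 2, 3 :: 4}"
  have fin: "finite ?K"
    by (simp add: finite_monomials3)
  have dim: "jac_dim t 13 = mp.dim (mp.span (jac_gen (cone_poly t) ` ?K))" for t
    using jac_dim_eq_span[of t 5] by simp
  have "indep_family ?K (jac_gen (cone_poly (- 1)))"
    unfolding indep_family_jac_gen_iff[OF cone_poly_wfree] using generic_no_syzygy by blast
  then have "jac_dim (- 1) 13 = card ?K"
    unfolding dim by (rule indep_family_dim[OF fin])
  moreover have "\<not> indep_family ?K (jac_gen (cone_poly 0))"
    unfolding indep_family_jac_gen_iff[OF cone_poly_wfree] using special_syzygy_exists by blast
  then have "jac_dim 0 13 < card ?K"
    unfolding dim by (rule dim_less_card[OF fin])
  ultimately show ?thesis
    by simp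
qed

text \<open>Semicontinuity is applied at two base points: at 0 for the weak inequalities in all
  degrees, and at -1 for strictness in degree 13. Each application excludes finitely many
  parameters.\<close>

lemma countable_hilbert_polynomial_cone_poly_eq:
  "countable {t. cone_arrangement (lines t) {..<9} \<and>
     hilbert_polynomial (cone_poly 0) = hilbert_polynomial (cone_poly t)}"
proof (rule countable_subset)
  let ?E = "(\<Union>j. {t. jac_dim t j < jac_dim 0 j}) \<union> {t. jac_dim t 13 < jac_dim (- 1) 13}"
  show "countable ?E"
    using jac_dim_semicontinuous by (intro countable_Un countable_UN) (auto intro: countable_finite)
  have "hilbert_polynomial (cone_poly 0) \<noteq> hilbert_polynomial (cone_poly t)"
    if t: "cone_arrangement (lines t) {..<9}" "t \<notin> ?E" for t
  proof (rule hilbert_polynomial_neqI[OF cone_arrangement_lines_0 cone_poly_def t(1) cone_poly_def])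
    show "codim3 (cone_poly t) j \<le> codim3 (cone_poly 0) j" for j
      using t(2) unfolding codim3_cone_poly by (intro diff_le_mono2) (auto simp: not_less)
    have "jac_dim 0 13 < jac_dim t 13"
      using t(2) jac_dim_special_less by (auto simp: not_less)
    \<comment> \<open>\<open>jac_dim_le\<close> excludes truncation, which would destroy
      strictness.\<close>
    then show "codim3 (cone_poly t) 13 < codim3 (cone_poly 0) 13"
      using jac_dim_le[of t 13] unfolding codim3_cone_poly by linarith
  qed
  then show "{t. cone_arrangement (lines t) {..<9} \<and>
      hilbert_polynomial (cone_poly 0) = hilbert_polynomial (cone_poly t)} \<subseteq> ?E"
    by blast
qed

section \<open>Small deformations of the arrangement\<close>

text \<open>\<open>S\<close> consists of planes that the deformation moves by a small linear map of the form
  \<open>v \<mapsto> v + \<tau> b(v) e\<close>.\<close>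

definition movable :: "nat set \<Rightarrow> bool"
  where "movable S \<longleftrightarrow> (\<exists>\<tau> b e. (\<tau> \<longlongrightarrow> 0) (at 0) \<and>
    (\<forall>\<^sub>F t in at 0. \<forall>i\<in>S. \<forall>v. lval (lines 0 i) v = 0 \<longrightarrow> lval (lines t i) (v + (\<tau> t * lval b v) *s e) = 0))"

lemma movable_subset:
  assumes "movable T" "S \<subseteq> T"
  shows "movable S"
proof -
  obtain \<tau> b e where "(\<tau> \<longlongrightarrow> 0) (at 0)"
    and ker: "\<forall>\<^sub>F t in at 0. \<forall>i\<in>T. \<forall>v. lval (lines 0 i) v = 0 \<longrightarrow> lval (lines t i) (v + (\<tau> t * lval b v) *s e) = 0"
    using assms(1) unfolding movable_def by blast
  moreover have "\<forall>\<^sub>F t in at 0. \<forall>i\<in>S. \<forall>v. lval (lines 0 i) v = 0 \<longrightarrow> lval (lines t i) (v + (\<tau> t * lval b v) *s e) = 0"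
    using ker by (rule eventually_mono) (use assms(2) in blast)
  ultimately show ?thesis
    unfolding movable_def by blast
qed

lemma eventually_affine_ne:
  fixes c d :: complex
  assumes "c \<noteq> 0"
  shows "\<forall>\<^sub>F t in at 0. c + t * d \<noteq> 0"
proof (rule tendsto_imp_eventually_ne[OF _ assms])
  show "((\<lambda>t. c + t * d) \<longlongrightarrow> c) (at 0)"
    by (auto intro!: tendsto_eq_intros)
qed

lemma lines_add: "n < 9 \<Longrightarrow> lines t n = lines 0 n + (if n \<in> {5, 8} then t else 0) *s vec3 1 0 0"
proof -
  assume "n < 9"
  then have "n \<in> {0, 1, 2, 3, 4, 5, 6, 7, 8}"
    by auto
  moreover have "vec3 p q r + c *s vec3 p' q' r' = vec3 (p + c * p') (q + c * q') (r + c * r')" for p q r c p' q' r'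
    by (simp add: vec_eq_iff vec3_def)
  ultimately show ?thesis
    by auto
qed

lemma movable_fixed:
  assumes "S \<subseteq> {..<9} - {5, 8}"
  shows "movable S"
proof -
  have "lval (lines t i) (v + (0 * lval 0 v) *s 0) = 0" if "i \<in> S" "lval (lines 0 i) v = 0" for i t v
  proof -
    have "i < 9" "i \<noteq> 5" "i \<noteq> 8"
      using assms that(1) by auto
    then have "lines t i = lines 0 i"
      using lines_add[of i t] by simp
    then show ?thesis
      using that(2) by simp
  qed
  then show ?thesis
    unfolding movable_def
    by (intro exI[of _ "\<lambda>_. 0"] exI[of _ 0] conjI tendsto_const always_eventually) blast
qed

lemma movable_345: "movable {3, 4, 5}"
  unfolding movable_def
proof (intro exI conjI)
  show "((\<lambda>t. t / (2 * (4 + t))) \<longlongrightarrow> 0) (at (0 :: complex))"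
    by (auto intro!: tendsto_eq_intros)
  have "lval (lines t i) (v + (t / (2 * (4 + t)) * lval (vec3 1 0 1) v) *s vec3 1 0 1) = 0"
    if t: "4 + t * 1 \<noteq> 0" and i: "i \<in> {3, 4, 5}" and v: "lval (lines 0 i) v = 0" for t i v
  proof -
    have t4: "4 + t \<noteq> 0"
      using t by simp
    define s where "s = t / (2 * (4 + t))"
    have ne: "2 * (4 + t) \<noteq> 0"
      using t4 by (metis mult_eq_0_iff zero_neq_numeral)
    have "t = s * (2 * (4 + t))"
      using nonzero_divide_eq_eq[OF ne, of "t" s] unfolding s_def by blast
    then have s: "2 * (s * (4 + t)) = t"
      by (simp only: mult.left_commute)
    have *: "(3 + t) * (x + s * (x + z)) + (z + s * (x + z)) = 0" if "3 * x + z = 0" for x z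
    proof -
      have z: "z = - 3 * x"
        using that by (simp add: eq_neg_iff_add_eq_0 add.commute)
      have "(3 + t) * (x + s * (x + z)) + (z + s * (x + z)) = (t - 2 * (s * (4 + t))) * x"
        unfolding z by (simp add: algebra_simps)
      then show ?thesis
        using s by simp
    qed
    show ?thesis
      using i v *[of "xc v" "zc v"] unfolding s_def[symmetric] by (auto simp: lval_vec3 add_eq_0_iff2)
  qed
  then show "\<forall>\<^sub>F t in at 0. \<forall>i\<in>{3, 4, 5}. \<forall>v. lval (lines 0 i) v = 0 \<longrightarrow>
      lval (lines t i) (v + (t / (2 * (4 + t)) * lval (vec3 1 0 1) v) *s vec3 1 0 1) = 0"
    using eventually_affine_ne[of 4 1] by (auto elim!: eventually_mono simp del: lines_simps)
qed

lemma movable_678: "movable {6, 7, 8}"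
  unfolding movable_def
proof (intro exI conjI)
  show "((\<lambda>t. 5 * t / (4 * (8 + t))) \<longlongrightarrow> 0) (at (0 :: complex))"
    by (auto intro!: tendsto_eq_intros)
  have "lval (lines t i) (v + (5 * t / (4 * (8 + t)) * lval (vec3 1 3 0) v) *s vec3 1 1 0) = 0"
    if t: "8 + t * 1 \<noteq> 0" and i: "i \<in> {6, 7, 8}" and v: "lval (lines 0 i) v = 0" for t i v
  proof -
    have t8: "8 + t \<noteq> 0"
      using t by simp
    define s where "s = 5 * t / (4 * (8 + t))"
    have ne: "4 * (8 + t) \<noteq> 0"
      using t8 by (metis mult_eq_0_iff zero_neq_numeral)
    have "5 * t = s * (4 * (8 + t))"
      using nonzero_divide_eq_eq[OF ne, of "5 * t" s] unfolding s_def by blast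
    then have s: "4 * (s * (8 + t)) = 5 * t"
      by (simp only: mult.left_commute)
    have *: "(3 + t) * (x + s * (x + 3 * y)) + 5 * (y + s * (x + 3 * y)) = 0" if "3 * x + 5 * y = 0" for x y
    proof -
      have "5 * ((3 + t) * (x + s * (x + 3 * y)) + 5 * (y + s * (x + 3 * y))) =
          (5 + 3 * (s * (8 + t))) * (3 * x + 5 * y) + (5 * t - 4 * (s * (8 + t))) * x"
        by (simp add: algebra_simps)
      also have "\<dots> = 0"
        using s that by simp
      finally show ?thesis
        by (metis mult_eq_0_iff zero_neq_numeral)
    qed
    show ?thesis
      using i v *[of "xc v" "yc v"] unfolding s_def[symmetric] by (auto simp: lval_vec3 add_eq_0_iff2)
  qed
  then show "\<forall>\<^sub>F t in at 0. \<forall>i\<in>{6, 7, 8}. \<forall>v. lval (lines 0 i) v = 0 \<longrightarrow>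
      lval (lines t i) (v + (5 * t / (4 * (8 + t)) * lval (vec3 1 3 0) v) *s vec3 1 1 0) = 0"
    using eventually_affine_ne[of 8 1] by (auto elim!: eventually_mono simp del: lines_simps)
qed

lemma movable_258: "movable {2, 5, 8}"
  unfolding movable_def
proof (intro exI conjI)
  show "((\<lambda>t. - t / (3 + t)) \<longlongrightarrow> 0) (at (0 :: complex))"
    by (auto intro!: tendsto_eq_intros)
  have "lval (lines t i) (v + (- t / (3 + t) * lval (vec3 1 0 0) v) *s vec3 1 0 0) = 0"
    if t: "3 + t * 1 \<noteq> 0" and i: "i \<in> {2, 5, 8}" and v: "lval (lines 0 i) v = 0" for t i v
  proof -
    have t3: "3 + t \<noteq> 0"
      using t by simp
    define s where "s = - t / (3 + t)"
    have s: "(3 + t) * (x + s * x) = 3 * x" for x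
      using t3 by (simp add: s_def field_simps)
    show ?thesis
      using i v unfolding s_def[symmetric] by (auto simp: lval_vec3 s)
  qed
  then show "\<forall>\<^sub>F t in at 0. \<forall>i\<in>{2, 5, 8}. \<forall>v. lval (lines 0 i) v = 0 \<longrightarrow>
      lval (lines t i) (v + (- t / (3 + t) * lval (vec3 1 0 0) v) *s vec3 1 0 0) = 0"
    using eventually_affine_ne[of 3 1] by (auto elim!: eventually_mono simp del: lines_simps)
qed

text \<open>At a double point the move goes along the fixed line \<open>i\<close>, in a direction
  \<open>e\<close> on which the form of line \<open>k\<close> is 1. Its size cancels the term
  \<open>t * x\<close> by which that form changes.\<close>

lemma movable_node:
  assumes "i \<in> {..<9} - {5, 8}" "k \<in> {5, 8}"
  shows "movable {i, k}"
proof -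
  have "indep3 (lines 0 i) (lines 0 k)"
    using cone_arrangement_lines_0 assms unfolding cone_arrangement_def by (auto simp del: lines_simps)
  then obtain e where e: "lval (lines 0 i) e = 0" "lval (lines 0 k) e = 1"
    by (rule indep3_witness)
  show ?thesis
    unfolding movable_def
  proof (intro exI conjI)
    show "((\<lambda>t. - t / (1 + t * xc e)) \<longlongrightarrow> 0) (at (0 :: complex))"
      by (auto intro!: tendsto_eq_intros)
    have "lval (lines t j) (v + (- t / (1 + t * xc e) * lval (vec3 1 0 0) v) *s e) = 0"
      if t: "1 + t * xc e \<noteq> 0" and j: "j \<in> {i, k}" and v: "lval (lines 0 j) v = 0" for t j v
    proof -
      define s where "s = - t / (1 + t * xc e)"
      have s: "s * (1 + t * xc e) = - t"
        using t by (simp add: s_def)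
      have x: "lval (vec3 1 0 0) u = xc u" for u
        by (simp add: lval_vec3)
      have "t * x + s * x * (1 + t * xc e) = 0" for x
      proof -
        have "t * x + s * x * (1 + t * xc e) = (s * (1 + t * xc e) + t) * x"
          by (simp add: algebra_simps)
        then show ?thesis
          using s by simp
      qed
      moreover have "lines t k = lines 0 k + t *s vec3 1 0 0" "lines t i = lines 0 i + 0 *s vec3 1 0 0"
        using lines_add[of k t] lines_add[of i t] assms by auto
      ultimately show ?thesis
        using j v e unfolding s_def[symmetric] x
        by (auto simp: lval_add_left lval_scale_left lval_add_right lval_scale_right x simp del: lines_simps)
    qed
    then show "\<forall>\<^sub>F t in at 0. \<forall>j\<in>{i, k}. \<forall>v. lval (lines 0 j) v = 0 \<longrightarrow>
        lval (lines t j) (v + (- t / (1 + t * xc e) * lval (vec3 1 0 0) v) *s e) = 0"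
      using eventually_affine_ne[of 1 "xc e"] by (auto elim!: eventually_mono simp del: lines_simps)
  qed
qed

lemma movable_incidence:
  assumes "v \<in> hyper0 - {0}"
  shows "movable (incidence {..<9} (lines 0) v)"
proof -
  define S where "S = incidence {..<9} (lines 0) v"
  define x y z where "x = xc v" and "y = yc v" and "z = zc v"
  have nz: "x \<noteq> 0 \<or> y \<noteq> 0 \<or> z \<noteq> 0"
  proof (rule ccontr)
    assume "\<not> (x \<noteq> 0 \<or> y \<noteq> 0 \<or> z \<noteq> 0)"
    then have "\<forall>i. v $ i = 0"
      using assms by (auto simp: x_def y_def z_def hyper0_def forall_4)
    then show False
      using assms by (simp add: vec_eq_iff)
  qed
  have mem: "0 \<in> S \<longleftrightarrow> y - z = 0" "1 \<in> S \<longleftrightarrow> 3 * y - z = 0" "2 \<in> S \<longleftrightarrow> 5 * y - z =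
      0" "3 \<in> S \<longleftrightarrow> x - z = 0"
    "4 \<in> S \<longleftrightarrow> x + z = 0" "5 \<in> S \<longleftrightarrow> 3 * x + z = 0" "6 \<in> S \<longleftrightarrow> x - y = 0" "7 \<in>
        S \<longleftrightarrow> x + 3 * y = 0"
    "8 \<in> S \<longleftrightarrow> 3 * x + 5 * y = 0"
    by (simp_all add: S_def incidence_def lval_vec3 x_def y_def z_def)
  have S: "S \<subseteq> {..<9}"
    by (auto simp: S_def incidence_def)
  have sub: "S \<subseteq> T" if "\<And>n. n \<in> {0, 1, 2, 3, 4, 5, 6, 7, 8} - T \<Longrightarrow> n \<notin> S" for T
    using that S unfolding less_9 by blast
  have "movable S"
  proof (cases "5 \<in> S"; cases "8 \<in> S")
    assume 58: "5 \<in> S" "8 \<in> S"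
    have yz: "z = - 3 * x" "y = - (3 / 5) * x"
      using 58 unfolding mem by (auto simp: field_simps add_eq_0_iff)
    have "S \<subseteq> {2, 5, 8}"
      using nz by (intro sub) (auto simp: mem[simplified] yz field_simps)
    then show ?thesis
      using movable_258 movable_subset by blast
  next
    assume 58: "5 \<in> S" "8 \<notin> S"
    have z: "z = - 3 * x"
      using 58 unfolding mem by (auto simp: add_eq_0_iff)
    show ?thesis
    proof (cases "x = 0")
      case True
      have "S \<subseteq> {3, 4, 5}"
        using nz by (intro sub) (auto simp: mem[simplified] z True)
      then show ?thesis
        using movable_345 movable_subset by blast
    next
      case False
      have "\<exists>i\<in>{..<9} - {5, 8}. S \<subseteq> {i, 5}"
      proof -
        consider "y = - 3 * x" | "y = - 1 * x" | "y = - (3 / 5) * x" | "y = 1 * x"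
          | "y \<noteq> - 3 * x" "y \<noteq> - 1 * x" "y \<noteq> - (3 / 5) * x" "y \<noteq> 1 * x"
          by blast
        then show ?thesis
        proof cases
          case 1
          show ?thesis
            using False 58 by (intro bexI[of _ 0] sub) (auto simp: mem[simplified] z 1)
        next
          case 2
          show ?thesis
            using False 58 by (intro bexI[of _ 1] sub) (auto simp: mem[simplified] z 2)
        next
          case 3
          show ?thesis
            using False 58 by (intro bexI[of _ 2] sub) (auto simp: mem[simplified] z 3 field_simps)
        next
          case 4
          show ?thesis
            using False 58 by (intro bexI[of _ 6] sub) (auto simp: mem[simplified] z 4)
        next
          case 5
          have "y - z \<noteq> 0" "3 * y - z \<noteq> 0" "5 * y - z \<noteq> 0" "x - y \<noteq> 0" "x - z \<noteq> 0" "x + z \<noteq> 0"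
            using 5 False by (auto simp: z field_simps add_eq_0_iff)
          then show ?thesis
            using 58 by (intro bexI[of _ 7] sub) (auto simp: mem[simplified])
        qed
      qed
      then show ?thesis
        using movable_node movable_subset by blast
    qed
  next
    assume 58: "5 \<notin> S" "8 \<in> S"
    have y: "y = - (3 / 5) * x"
      using 58 unfolding mem by (auto simp: field_simps add_eq_0_iff)
    show ?thesis
    proof (cases "x = 0")
      case True
      have "S \<subseteq> {6, 7, 8}"
        using nz by (intro sub) (auto simp: mem[simplified] y True)
      then show ?thesis
        using movable_678 movable_subset by blast
    next
      case False
      have "\<exists>i\<in>{..<9} - {5, 8}. S \<subseteq> {i, 8}"
      proof -
        consider "z = - (3 / 5) * x" | "z = - (9 / 5) * x" | "z = 1 * x"
          | "z \<noteq> - (3 / 5) * x" "z \<noteq> - (9 / 5) * x" "z \<noteq> 1 * x"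
          by blast
        then show ?thesis
        proof cases
          case 1
          show ?thesis
            using False 58 by (intro bexI[of _ 0] sub) (auto simp: mem[simplified] y 1 field_simps)
        next
          case 2
          show ?thesis
            using False 58 by (intro bexI[of _ 1] sub) (auto simp: mem[simplified] y 2 field_simps)
        next
          case 3
          show ?thesis
            using False 58 by (intro bexI[of _ 3] sub) (auto simp: mem[simplified] y 3 field_simps)
        next
          case 4
          have "y - z \<noteq> 0" "3 * y - z \<noteq> 0" "5 * y - z \<noteq> 0" "x - z \<noteq> 0" "x - y \<noteq> 0" "x + 3 * y \<noteq> 0"
            using 4 False 58(1) unfolding mem by (auto simp: y field_simps add_eq_0_iff)
          then show ?thesis
            using 58 by (intro bexI[of _ 4] sub) (auto simp: mem[simplified])
        qed
      qed
      then show ?thesis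
        using movable_node movable_subset by blast
    qed
  next
    assume "5 \<notin> S" "8 \<notin> S"
    then show ?thesis
      using S by (intro movable_fixed) auto
  qed
  then show ?thesis
    by (simp add: S_def)
qed

lemma eventually_cone_poly_equivalent:
  "\<forall>\<^sub>F t in at 0. milnor_equivalent (cone_poly 0) (cone_poly t) \<and>
     arrangement_complement (cone_poly 0) homeomorphic_space arrangement_complement (cone_poly t)"
proof -
  \<comment> \<open>Taking all movable index sets keeps the cover finite, so finitely many
    conditions on \<open>t\<close> hold simultaneously near 0.\<close>
  define SS where "SS = {S \<in> Pow {..<9}. movable S}"
  have fin: "finite SS"
    by (simp add: SS_def)
  have nonzero: "lines 0 i \<in> hyper0 - {0}" if "i \<in> {..<9}" for i
    using cone_nonzero[OF cone_arrangement_lines_0 refl that] lines_hyper0 that by auto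
  have nonempty: "{..<9 :: nat} \<noteq> {}"
    unfolding less_9 by simp
  have cover: "\<exists>S\<in>SS. incidence {..<9} (lines 0) v \<subseteq> S" if "v \<in> hyper0 - {0}" for v
    using movable_incidence[OF that] by (intro bexI[of _ "incidence {..<9} (lines 0) v"]) (auto simp: SS_def incidence_def)
  show ?thesis
  proof (rule arrangement_perturbation[OF finite_lessThan nonempty fin nonzero cover])
    fix \<epsilon> :: real assume \<epsilon>: "\<epsilon> > 0"
    "\<And>a' N. (\<And>i. i \<in> {..<9} \<Longrightarrow> a' i \<in> hyper0 \<and> norm (a' i - lines 0 i) \<le> \<epsilon>) \<Longrightarrow>
       (\<And>S v. S \<in> SS \<Longrightarrow> norm (N S v) \<le> \<epsilon> * norm v) \<Longrightarrow>
       (\<And>S u v. S \<in> SS \<Longrightarrow> N S (u - v) = N S u - N S v) \<Longrightarrow>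
       (\<And>S c v. S \<in> SS \<Longrightarrow> N S (c *s v) = c *s N S v) \<Longrightarrow>
       (\<And>S i v. S \<in> SS \<Longrightarrow> i \<in> S \<inter> {..<9} \<Longrightarrow> lval (lines 0 i) v = 0 \<Longrightarrow> lval (a' i) (v
           + N S v) = 0) \<Longrightarrow>
       \<exists>\<Phi> \<Phi>'. homeomorphism {v. (\<Prod>i<9. lval (lines 0 i) v) \<noteq> 0} {v. (\<Prod>i<9. lval (a' i) v) \<noteq> 0} \<Phi> \<Phi>' \<and>
         (\<forall>v\<in>{v. (\<Prod>i<9. lval (lines 0 i) v) \<noteq> 0}. (\<Prod>i<9. lval (a' i) (\<Phi> v)) = (\<Prod>i<9. lval (lines 0 i) v)) \<and>
         (\<forall>c v. c \<noteq> 0 \<longrightarrow> \<Phi> (c *s v) = c *s \<Phi> v)"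
  have "\<forall>S\<in>SS. \<exists>\<tau> b e. (\<tau> \<longlongrightarrow> 0) (at 0) \<and>
      (\<forall>\<^sub>F t in at 0. \<forall>i\<in>S. \<forall>v. lval (lines 0 i) v = 0 \<longrightarrow> lval (lines t i) (v + (\<tau> t * lval b v) *s e) = 0)"
    unfolding SS_def movable_def by blast
  from bchoice[OF this] obtain \<tau> where "\<forall>S\<in>SS. \<exists>b e. (\<tau> S \<longlongrightarrow> 0) (at 0) \<and>
      (\<forall>\<^sub>F t in at 0. \<forall>i\<in>S. \<forall>v. lval (lines 0 i) v = 0 \<longrightarrow> lval (lines t i) (v + (\<tau> S t * lval b v) *s e) = 0)" ..
  from bchoice[OF this] obtain b where "\<forall>S\<in>SS. \<exists>e. (\<tau> S \<longlongrightarrow> 0) (at 0) \<and>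
      (\<forall>\<^sub>F t in at 0. \<forall>i\<in>S. \<forall>v. lval (lines 0 i) v = 0 \<longrightarrow> lval (lines t i) (v + (\<tau> S t * lval (b S) v) *s e) = 0)" ..
  from bchoice[OF this] obtain e where mov: "\<forall>S\<in>SS. (\<tau> S \<longlongrightarrow> 0) (at 0) \<and>
      (\<forall>\<^sub>F t in at 0. \<forall>i\<in>S. \<forall>v. lval (lines 0 i) v = 0 \<longrightarrow> lval (lines t i) (v + (\<tau> S t * lval (b S) v) *s e S) = 0)" ..
  have \<tau>: "(\<tau> S \<longlongrightarrow> 0) (at 0)"
    and ker: "\<forall>\<^sub>F t in at 0. \<forall>i\<in>S. \<forall>v. lval (lines 0 i) v = 0 \<longrightarrow>
        lval (lines t i) (v + (\<tau> S t * lval (b S) v) *s e S) = 0" if "S \<in> SS" for S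
    using mov that by blast+
  \<comment> \<open>The factor 4 comes from \<open>norm_lval_le\<close>; the bound makes the local
    move at most \<epsilon> times the norm of the point.\<close>
  have small: "\<forall>\<^sub>F t in at 0. norm (\<tau> S t) * (4 * norm (b S) * norm (e S)) < \<epsilon>" if "S \<in> SS" for S
  proof -
    have "((\<lambda>t. norm (\<tau> S t) * (4 * norm (b S) * norm (e S))) \<longlongrightarrow> 0) (at 0)"
      using tendsto_norm_zero[OF \<tau>[OF that]] by (rule tendsto_mult_left_zero)
    then show ?thesis
      using \<epsilon>(1) by (rule order_tendstoD(2))
  qed
  have "((\<lambda>t :: complex. norm t * norm (vec3 1 0 0)) \<longlongrightarrow> 0) (at 0)"
    by (auto intro!: tendsto_eq_intros)
  then have close: "\<forall>\<^sub>F t in at 0. norm (t :: complex) * norm (vec3 1 0 0) < \<epsilon>"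
    using \<epsilon>(1) by (rule order_tendstoD(2))
  have "\<forall>\<^sub>F t in at 0. \<forall>S\<in>SS. (\<forall>i\<in>S. \<forall>v. lval (lines 0 i) v = 0 \<longrightarrow>
        lval (lines t i) (v + (\<tau> S t * lval (b S) v) *s e S) = 0) \<and>
      norm (\<tau> S t) * (4 * norm (b S) * norm (e S)) < \<epsilon>"
    using ker small by (intro eventually_ball_finite[OF fin] ballI eventually_conj)
  with close show "\<forall>\<^sub>F t in at 0. milnor_equivalent (cone_poly 0) (cone_poly t) \<and>
     arrangement_complement (cone_poly 0) homeomorphic_space arrangement_complement (cone_poly t)"
  proof eventually_elim
    case (elim t)
    have "\<exists>\<Phi> \<Phi>'. homeomorphism {v. (\<Prod>i<9. lval (lines 0 i) v) \<noteq> 0} {v. (\<Prod>i<9. lval (lines t i) v) \<noteq> 0} \<Phi> \<Phi>' \<and>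
         (\<forall>v\<in>{v. (\<Prod>i<9. lval (lines 0 i) v) \<noteq> 0}. (\<Prod>i<9. lval (lines t i) (\<Phi> v)) = (\<Prod>i<9. lval (lines 0 i) v)) \<and>
         (\<forall>c v. c \<noteq> 0 \<longrightarrow> \<Phi> (c *s v) = c *s \<Phi> v)"
    proof (rule \<epsilon>(2)[of "lines t" "\<lambda>S v. (\<tau> S t * lval (b S) v) *s e S"])
      show "lines t i \<in> hyper0 \<and> norm (lines t i - lines 0 i) \<le> \<epsilon>" if "i \<in> {..<9}" for i
      proof
        show "lines t i \<in> hyper0"
          using that lines_hyper0 by simp
        have "lines t i - lines 0 i = (if i \<in> {5, 8} then t else 0) *s vec3 1 0 0"
          using lines_add[of i t] that by (simp del: lines_simps)
        then have "norm (lines t i - lines 0 i) = norm (if i \<in> {5, 8} then t else 0) * norm (vec3 1 0 0)"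
          by (simp only: norm_vector_scalar_mult)
        also have "\<dots> \<le> norm t * norm (vec3 1 0 0)"
          by (intro mult_right_mono) auto
        finally show "norm (lines t i - lines 0 i) \<le> \<epsilon>"
          using elim(1) by linarith
      qed
      show "norm ((\<tau> S t * lval (b S) v) *s e S) \<le> \<epsilon> * norm v" if "S \<in> SS" for S v
      proof -
        have "norm ((\<tau> S t * lval (b S) v) *s e S) = norm (\<tau> S t) * norm (lval (b S) v) * norm (e S)"
          by (simp add: norm_vector_scalar_mult norm_mult)
        also have "\<dots> \<le> norm (\<tau> S t) * (4 * norm (b S) * norm v) * norm (e S)"
          by (intro mult_right_mono mult_left_mono norm_lval_le) auto
        also have "\<dots> = norm (\<tau> S t) * (4 * norm (b S) * norm (e S)) * norm v"
          by simp
        also have "\<dots> \<le> \<epsilon> * norm v"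
          using elim(2) that by (intro mult_right_mono) (auto intro: less_imp_le)
        finally show ?thesis .
      qed
      show "(\<tau> S t * lval (b S) (u - v)) *s e S = (\<tau> S t * lval (b S) u) *s e S - (\<tau> S t * lval (b S) v) *s e S" for S u v
        by (simp add: lval_diff_right vec_eq_iff algebra_simps)
      show "(\<tau> S t * lval (b S) (c *s v)) *s e S = c *s ((\<tau> S t * lval (b S) v) *s e S)" for S c v
        by (simp add: lval_scale_right vec_eq_iff algebra_simps)
      show "lval (lines t i) (v + (\<tau> S t * lval (b S) v) *s e S) = 0"
        if "S \<in> SS" "i \<in> S \<inter> {..<9}" "lval (lines 0 i) v = 0" for S i v
        using elim(2) that by blast
    qed
    then obtain \<Phi> \<Phi>' where hom: "homeomorphism (milnor_total (cone_poly 0)) (milnor_total (cone_poly t)) \<Phi> \<Phi>'"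
      and fib: "\<And>v. v \<in> milnor_total (cone_poly 0) \<Longrightarrow> meval (cone_poly t) (\<Phi> v) = meval (cone_poly 0) v"
      and scale: "\<And>c v. c \<noteq> 0 \<Longrightarrow> \<Phi> (c *s v) = c *s \<Phi> v"
      unfolding milnor_total_def cone_poly_def meval_prod_lform by blast
    note * = equivariant_homeomorphism_imp[OF finite_lessThan nonempty finite_lessThan nonempty cone_poly_def cone_poly_def hom fib scale]
    show ?case
      using * by blast
  qed
  qed
qed

theorem corollary1p5:
  shows "(\<exists>f f'. plane_arrangement f \<and> plane_arrangement f' \<and>
            arrangement_complement f homeomorphic_space arrangement_complement f' \<and>
            hilbert_polynomial f \<noteq> hilbert_polynomial f') \<and>
         (\<exists>f f'. plane_arrangement f \<and> plane_arrangement f' \<and>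
            milnor_equivalent f f' \<and>
            hilbert_polynomial f \<noteq> hilbert_polynomial f')"
proof -
  \<comment> \<open>The four inequations of \<open>cone_arrangement_lines\<close>, brought to the
    form c + t d with c nonzero.\<close>
  have "\<forall>\<^sub>F t in at 0. 2 + t * 1 \<noteq> (0 :: complex)" "\<forall>\<^sub>F t in at 0. 4 + t * 1 \<noteq> (0 :: complex)"
    "\<forall>\<^sub>F t in at 0. 8 + t * 1 \<noteq> (0 :: complex)" "\<forall>\<^sub>F t in at 0. 4 + t * 3 \<noteq> (0 :: complex)"
    by (rule eventually_affine_ne, simp)+
  then have "\<forall>\<^sub>F t in at 0. cone_arrangement (lines t) {..<9}"
    by eventually_elim (intro cone_arrangement_lines; simp add: algebra_simps eq_neg_iff_add_eq_0)
  with eventually_cone_poly_equivalent obtain d where d: "d > 0" "\<And>t. t \<noteq> 0 \<Longrightarrow> dist t 0 < d \<Longrightarrow>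
      cone_arrangement (lines t) {..<9} \<and> milnor_equivalent (cone_poly 0) (cone_poly t) \<and>
      arrangement_complement (cone_poly 0) homeomorphic_space arrangement_complement (cone_poly t)"
    unfolding eventually_at by (metis (no_types, lifting) UNIV_I min_less_iff_conj)
  \<comment> \<open>The value 0 is added because the equivalence holds only on a punctured disc.

    @DONE placeholder\<close>
  define E where "E = insert 0 {t. cone_arrangement (lines t) {..<9} \<and>
     hilbert_polynomial (cone_poly 0) = hilbert_polynomial (cone_poly t)}"
  have "countable E"
    using countable_hilbert_polynomial_cone_poly_eq by (simp add: E_def)
  \<comment> \<open>A disc is uncountable, so it contains a parameter outside the countable
    exceptional set.\<close>
  then have "\<not> ball 0 d \<subseteq> E"
    using uncountable_ball[OF d(1), of "0 :: complex"] countable_subset by blast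
  then obtain t where t: "t \<in> ball 0 d" "t \<notin> E"
    by blast
  then have "t \<noteq> 0" "dist t 0 < d"
    by (auto simp: E_def)
  note props = d(2)[OF this]
  have "plane_arrangement (cone_poly 0)" "plane_arrangement (cone_poly t)"
    using plane_arrangement_cone[OF cone_arrangement_lines_0 cone_poly_def]
      plane_arrangement_cone[OF _ cone_poly_def] props by blast+
  moreover have "hilbert_polynomial (cone_poly 0) \<noteq> hilbert_polynomial (cone_poly t)"
    using t(2) props by (auto simp: E_def)
  ultimately show ?thesis
    using props by blast
qed

end
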